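(* Let $(S_i,X_i)_{i\ge 1}$, $W_t$, $\Upsilon$, $\ell_{\mathrm i}$, $\ell_{\mathrm s}$, $I_{\mathrm i}$, $I_{\mathrm s}$ be as defined in the context. The following conclusions hold: (a) the functions $I_{\mathrm i}$ and $I_{\mathrm s}$ on $\mathcal{X}$ are lower semicontinuous and convex; (b) if $G\subseteq\mathcal{X}$ is open, then $$\liminf_{t\uparrow+\infty}\frac{1}{t}\ln\mathbb{P}\bigg[\frac{W_t}{t}\in G\bigg]\ge -\inf_{w\in G}\{I_{\mathrm i}(w)\};$$ (c) if $F\subseteq\mathcal{X}$ is compact, then $$\limsup_{t\uparrow+\infty}\frac{1}{t}\ln\mathbb{P}\bigg[\frac{W_t}{t}\in F\bigg]\le -\inf_{w\in F}\{I_{\mathrm s}(w)\};$$ (d) if $F\in\mathcal{B}(\mathcal{X})$ is open convex, or closed convex, or just convex when $\mathcal{X}$ is finite-dimensional, then $$\limsup_{t\uparrow+\infty}\frac{1}{t}\ln\mathbb{P}\bigg[\frac{W_t}{t}\in F\bigg]\le -\inf_{w\in F}\{I_{\mathrm s}(w)\}$$ whenever $\ell_{\mathrm s}<+\infty$ or $I_{\mathrm s}(0)<+\infty$; (e) if $\mathcal{X}$ is finite-dimensional and $\mathbb{E}[e^{\zeta S_1+\sigma\|X_1\|}]<+\infty$ for some numbers $\zeta\le 0$ and $\sigma>0$, then $I_{\mathrm i}$ and $I_{\mathrm s}$ have compact level sets and, for every closed set $F\subseteq\mathcal{X}$, $$\limsup_{t\uparrow+\infty}\frac{1}{t}\ln\mathbb{P}\bigg[\frac{W_t}{t}\in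 F\bigg]\le -\inf_{w\in F}\{I_{\mathrm s}(w)\};$$ (f) if $\mathcal{X}$ is infinite-dimensional and $\mathbb{E}[e^{\sigma S_1+\sigma\|X_1\|}]<+\infty$ for all $\sigma>0$, then $I_{\mathrm i}=I_{\mathrm s}=\Upsilon(1,\cdot\,)$, the function $\Upsilon(1,\cdot\,)$ has compact level sets and, for every closed set $F\subseteq\mathcal{X}$, $$\limsup_{t\uparrow+\infty}\frac{1}{t}\ln\mathbb{P}\bigg[\frac{W_t}{t}\in F\bigg]\le -\inf_{w\in F}\{I_{\mathrm s}(w)\}.$$
   Context: Setting. $(\mathcal{X},\|\cdot\|)$ is a real separable Banach space with Borel $\sigma$-field $\mathcal{B}(\mathcal{X})$ and topological dual $\mathcal{X}^\star$. On a probability space $(\Omega,\mathcal{F},\mathbb{P})$ with expectation $\mathbb{E}$, the pairs $(S_1,X_1),(S_2,X_2),\ldots$ are independent and identically distributed random vectors; the waiting times $S_i$ take positive real values and the rewards $X_i$ take values in $\mathcal{X}$. Any dependence between $S_i$ and $X_i$ is allowed. Put $T_i:=S_1+\cdots+S_i$ for $i\ge 1$; it is assumed that $\lim_{i\uparrow\infty}T_i(\omega)=+\infty$ for all $\omega\in\Omega$. The cumulative reward by time $t\ge 0$ is $W_t:=\sum_{i\ge 1}X_i\mathbf{1}_{\{T_i\le t\}}$. For $(s,w)\in\mathbb{R}\times\mathcal{X}$ let $$J(s,w):=\sup_{(\zeta,\varphi)\in\mathbb{R}\times\mathcal{X}^\star}\Big\{s\zeta+\varphi(w)-\ln\mathbb{E}\big[e^{\zeta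 S_1+\varphi(X_1)}\big]\Big\}\in[0,+\infty].$$ With $B_{w,\delta}:=\{v\in\mathcal{X}:\|v-w\|<\delta\}$, for $(\beta,w)\in\mathbb{R}\times\mathcal{X}$ let $$\Upsilon(\beta,w):=\lim_{\delta\downarrow 0}\ \inf_{s\in(\beta-\delta,\beta+\delta)}\ \inf_{v\in B_{w,\delta}}\ \inf_{\gamma>0}\big\{\gamma J(s/\gamma,v/\gamma)\big\}.$$ Let $$\ell_{\mathrm i}:=-\liminf_{s\uparrow+\infty}\frac1s\ln\mathbb{P}[S_1>s],\qquad \ell_{\mathrm s}:=-\limsup_{s\uparrow+\infty}\frac1s\ln\mathbb{P}[S_1>s],$$ so that $0\le\ell_{\mathrm s}\le\ell_{\mathrm i}\le+\infty$. For $w\in\mathcal{X}$ define $$I_{\mathrm i}(w):=\begin{cases}\inf_{\beta\in[0,1]}\{\Upsilon(\beta,w)+(1-\beta)\ell_{\mathrm i}\}&\text{if }\ell_{\mathrm i}<+\infty,\\ \Upsilon(1,w)&\text{if }\ell_{\mathrm i}=+\infty,\end{cases}\qquad I_{\mathrm s}(w):=\begin{cases}\inf_{\beta\in[0,1]}\{\Upsilon(\beta,w)+(1-\beta)\ell_{\mathrm s}\}&\text{if }\ell_{\mathrm s}<+\infty,\\ \Upsilon(1,w)&\text{if }\ell_{\mathrm s}=+\infty.\end{cases}$$ The level sets of a function $I:\mathcal{X}\to[0,+\infty]$ are the sets $\{w\in\mathcal{X}:I(w)\le\lambda\}$ with $\lambda\in\mathbb{R}$. Conventions: $\ln 0=-\infty$,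 $\ln(+\infty)=+\infty$, $\inf\emptyset=+\infty$. *)

theory Defs
  imports "HOL-Probability.Probability"
begin

section \<open>Extended-valued functions on normed spaces\<close>

text \<open>
  The library's \<^const>\<open>ln\<close> is real-valued with ln 0 = 0.  Here ln 0 is minus infinity and
  ln of infinity is infinity.
\<close>

definition ln_ext :: "ennreal \<Rightarrow> ereal" where
  "ln_ext x = (if x = 0 then - \<infinity> else if x = \<infinity> then \<infinity> else ereal (ln (enn2real x)))"

definition lower_semicontinuous :: "('a::topological_space \<Rightarrow> ereal) \<Rightarrow> bool" where
  "lower_semicontinuous f \<longleftrightarrow> (\<forall>x. \<forall>c < f x. \<forall>\<^sub>F y in nhds x. c < f y)"

text \<open>
  The library's \<^const>\<open>convex_on\<close> is for real-valued functions.  For values in [0,\<infinity>] the ereal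
  convention 0 * \<infinity> = 0 makes the endpoint cases of the inequality trivial.
\<close>

definition ext_convex :: "('a::real_vector \<Rightarrow> ereal) \<Rightarrow> bool" where
  "ext_convex f \<longleftrightarrow>
     (\<forall>x y. \<forall>u\<ge>0. \<forall>v\<ge>0. u + v = 1 \<longrightarrow>
        f (u *\<^sub>R x + v *\<^sub>R y) \<le> ereal u * f x + ereal v * f y)"

definition compact_level_sets :: "('a::topological_space \<Rightarrow> ereal) \<Rightarrow> bool" where
  "compact_level_sets f \<longleftrightarrow> (\<forall>c::real. compact {x. f x \<le> ereal c})"

definition finite_dim_type :: "'a::real_vector itself \<Rightarrow> bool" where
  "finite_dim_type _ \<longleftrightarrow> (\<exists>B::'a set. finite B \<and> span B = UNIV)"


section \<open>Renewal-reward processes\<close>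

text \<open>Sequences are indexed from 1; the values at index 0 are never used.\<close>

definition renewal_time :: "(nat \<Rightarrow> 'w \<Rightarrow> real) \<Rightarrow> nat \<Rightarrow> 'w \<Rightarrow> real" where
  "renewal_time S i \<omega> = (\<Sum>j=1..i. S j \<omega>)"

text \<open>
  The index set below is finite once the renewal times tend to infinity (for infinite index sets
  the sum would be 0 by convention).
\<close>

definition cumulative_reward ::
  "(nat \<Rightarrow> 'w \<Rightarrow> real) \<Rightarrow> (nat \<Rightarrow> 'w \<Rightarrow> 'a::real_normed_vector) \<Rightarrow> real \<Rightarrow> 'w \<Rightarrow> 'a" where
  "cumulative_reward S X t \<omega> = (\<Sum>i | 1 \<le> i \<and> renewal_time S i \<omega> \<le> t. X i \<omega>)"

definition renewal_reward ::
  "'w measure \<Rightarrow> (nat \<Rightarrow> 'w \<Rightarrow> real)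
    \<Rightarrow> (nat \<Rightarrow> 'w \<Rightarrow> 'a::{banach, second_countable_topology}) \<Rightarrow> bool" where
  "renewal_reward M S X \<longleftrightarrow>
     prob_space M \<and>
     prob_space.indep_vars M (\<lambda>_. borel) (\<lambda>i \<omega>. (S i \<omega>, X i \<omega>)) {1..} \<and>
     (\<forall>i\<ge>1. distr M borel (\<lambda>\<omega>. (S i \<omega>, X i \<omega>)) = distr M borel (\<lambda>\<omega>. (S 1 \<omega>, X 1 \<omega>))) \<and>
     (\<forall>i\<ge>1. \<forall>\<omega>\<in>space M. 0 < S i \<omega>) \<and>
     (\<forall>\<omega>\<in>space M. filterlim (\<lambda>i. renewal_time S i \<omega>) at_top sequentially)"


section \<open>Rate functions\<close>

text \<open>
  Up to \<open>rate_I\<close>, the arguments \<open>S\<close> and \<open>X\<close> are single random variables, to be instantiated with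
  the first waiting time and the first reward.
\<close>

definition mgf_pair ::
  "'w measure \<Rightarrow> ('w \<Rightarrow> real) \<Rightarrow> ('w \<Rightarrow> 'a::real_normed_vector) \<Rightarrow> real \<Rightarrow> ('a \<Rightarrow>\<^sub>L real) \<Rightarrow> ennreal"
  where
  "mgf_pair M S X \<zeta> \<phi> = (\<integral>\<^sup>+\<omega>. ennreal (exp (\<zeta> * S \<omega> + blinfun_apply \<phi> (X \<omega>))) \<partial>M)"

definition rate_J ::
  "'w measure \<Rightarrow> ('w \<Rightarrow> real) \<Rightarrow> ('w \<Rightarrow> 'a::real_normed_vector) \<Rightarrow> real \<Rightarrow> 'a \<Rightarrow> ereal" where
  "rate_J M S X s w =
     (SUP (\<zeta>, \<phi>) \<in> (UNIV :: (real \<times> ('a \<Rightarrow>\<^sub>L real)) set).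
        ereal (s * \<zeta> + blinfun_apply \<phi> w) - ln_ext (mgf_pair M S X \<zeta> \<phi>))"

definition inf_scaled_J ::
  "'w measure \<Rightarrow> ('w \<Rightarrow> real) \<Rightarrow> ('w \<Rightarrow> 'a::real_normed_vector) \<Rightarrow> real \<Rightarrow> 'a \<Rightarrow> ereal" where
  "inf_scaled_J M S X s v = (INF \<gamma>\<in>{0<..}. ereal \<gamma> * rate_J M S X (s / \<gamma>) (v /\<^sub>R \<gamma>))"

definition rate_Upsilon ::
  "'w measure \<Rightarrow> ('w \<Rightarrow> real) \<Rightarrow> ('w \<Rightarrow> 'a::real_normed_vector) \<Rightarrow> real \<Rightarrow> 'a \<Rightarrow> ereal" where
  "rate_Upsilon M S X \<beta> w =
     Lim (at_right (0::real))
       (\<lambda>\<delta>. INF s\<in>{\<beta> - \<delta> <..< \<beta> + \<delta>}. INF v\<in>ball w \<delta>. inf_scaled_J M S X s v)"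

text \<open>The limit defining \<^const>\<open>rate_Upsilon\<close> exists by monotonicity.\<close>

lemma tendsto_rate_Upsilon:
  "((\<lambda>\<delta>. INF s\<in>{\<beta> - \<delta> <..< \<beta> + \<delta>}. INF v\<in>ball w \<delta>. inf_scaled_J M S X s v)
     \<longlongrightarrow> rate_Upsilon M S X \<beta> w) (at_right (0::real))"
proof -
  define g where "g = (\<lambda>\<delta>. INF s\<in>{\<beta> - \<delta> <..< \<beta> + \<delta>}. INF v\<in>ball w \<delta>. inf_scaled_J M S X s v)"
  have mono: "g d' \<le> g d" if "d \<le> d'" for d d' :: real
  proof -
    have "{\<beta> - d <..< \<beta> + d} \<subseteq> {\<beta> - d' <..< \<beta> + d'}" using that by auto
    moreover have "ball w d \<subseteq> ball w d'" using that by (rule subset_ball)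
    ultimately show ?thesis
      unfolding g_def by (meson INF_superset_mono order_refl)
  qed
  have "(g \<longlongrightarrow> (SUP d\<in>{0<..}. g d)) (at_right 0)"
  proof (rule order_tendstoI)
    fix a assume "a < (SUP d\<in>{0<..}. g d)"
    then obtain d where d: "d > 0" "a < g d" by (auto simp: less_SUP_iff)
    have "\<forall>\<^sub>F x in at_right 0. x \<in> {0<..<d}"
      using d(1) by (rule eventually_at_right_real)
    then show "\<forall>\<^sub>F x in at_right 0. a < g x"
      by eventually_elim (rule less_le_trans[OF d(2) mono], simp)
  next
    fix a assume a: "(SUP d\<in>{0<..}. g d) < a"
    have "\<forall>\<^sub>F x in at_right 0. x \<in> {0<..<1::real}"
      by (rule eventually_at_right_real) simp
    then show "\<forall>\<^sub>F x in at_right 0. g x < a"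
      by eventually_elim (rule le_less_trans[OF SUP_upper a], simp)
  qed
  then have "(g \<longlongrightarrow> Lim (at_right 0) g) (at_right 0)"
    using tendsto_Lim[OF trivial_limit_at_right_real] by metis
  then show ?thesis
    unfolding rate_Upsilon_def g_def .
qed

definition ell_i :: "'w measure \<Rightarrow> ('w \<Rightarrow> real) \<Rightarrow> ereal" where
  "ell_i M S =
     - Liminf at_top (\<lambda>s::real. ereal (1 / s) * ln_ext (emeasure M {\<omega>\<in>space M. s < S \<omega>}))"

definition ell_s :: "'w measure \<Rightarrow> ('w \<Rightarrow> real) \<Rightarrow> ereal" where
  "ell_s M S =
     - Limsup at_top (\<lambda>s::real. ereal (1 / s) * ln_ext (emeasure M {\<omega>\<in>space M. s < S \<omega>}))"

definition rate_I ::
  "'w measure \<Rightarrow> ('w \<Rightarrow> real) \<Rightarrow> ('w \<Rightarrow> 'a::real_normed_vector) \<Rightarrow> ereal \<Rightarrow> 'a \<Rightarrow> ereal" where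
  "rate_I M S X l w =
     (if l < \<infinity> then (INF \<beta>\<in>{0..1}. rate_Upsilon M S X \<beta> w + ereal (1 - \<beta>) * l)
      else rate_Upsilon M S X 1 w)"

definition rate_I_i ::
  "'w measure \<Rightarrow> (nat \<Rightarrow> 'w \<Rightarrow> real) \<Rightarrow> (nat \<Rightarrow> 'w \<Rightarrow> 'a::real_normed_vector) \<Rightarrow> 'a \<Rightarrow> ereal" where
  "rate_I_i M S X = rate_I M (S 1) (X 1) (ell_i M (S 1))"

definition rate_I_s ::
  "'w measure \<Rightarrow> (nat \<Rightarrow> 'w \<Rightarrow> real) \<Rightarrow> (nat \<Rightarrow> 'w \<Rightarrow> 'a::real_normed_vector) \<Rightarrow> 'a \<Rightarrow> ereal" where
  "rate_I_s M S X = rate_I M (S 1) (X 1) (ell_s M (S 1))"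

definition scaled_log_prob ::
  "'w measure \<Rightarrow> (nat \<Rightarrow> 'w \<Rightarrow> real) \<Rightarrow> (nat \<Rightarrow> 'w \<Rightarrow> 'a::real_normed_vector)
    \<Rightarrow> 'a set \<Rightarrow> real \<Rightarrow> ereal" where
  "scaled_log_prob M S X A t =
     ereal (1 / t) * ln_ext (emeasure M {\<omega>\<in>space M. cumulative_reward S X t \<omega> /\<^sub>R t \<in> A})"

end

theory Submission
  imports Defs
begin

text \<open>
  Write \<open>Theta\<close> for the set of pairs \<open>(\<zeta>, \<phi>)\<close> with E exp(\<zeta> S_1 + \<phi>(X_1)) at most 1.  By Lagrange
  duality, the rate function with parameter \<open>l\<close> is the supremum of \<open>\<zeta> + \<phi> w\<close> over the pairs in
  \<open>Theta\<close> with \<open>\<zeta> \<le> l\<close>.  Semicontinuity and convexity can be read off this formula, and each such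
  pair yields an exponential Chebyshev bound for the cumulative reward, which gives the upper bound
  near every point and, by covering, on compact sets.  On convex sets, the exponential integrals of
  the partial sums are supermultiplicative, so that the upper bound for compact convex sets holds
  without a prefactor, and inner regularity applies.  Exponential tightness reduces closed sets to
  compact ones.

  For the lower bound, the exponents with which the partial sums can reach t z, for large t, form a
  convex cone over the points z.  By Hahn--Banach this cone is described by the linear functionals
  below it, and these belong to \<open>Theta\<close>: for a compact convex set K, the n-th power of the
  exponential integral of Z_1 over K is at most that of the n-th partial sum over n K, which the
  cone controls.  The same argument identifies the dual of the rate function.
\<close>

section \<open>Hahn--Banach for sublinear functionals\<close>

text \<open>Two obstacles shape the estimates. The number of renewals before \<open>t\<close> is
  unbounded, so every bound for partial sums must be summable over that number. Summability comes
  from the positivity of the waiting times: lowering \<zeta> by any amount turns an exponential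
  moment at most 1 into one strictly below 1, the ratio of a geometric series. The waiting time in
  progress at \<open>t\<close> carries no reward and enters through its tail alone, which is O(exp
  (- \<zeta> u)) for each \<zeta> below \<open>ell_s\<close>; this is the source of the constraint
  \<zeta> \<le> l.

  On the dual side, \<open>J\<close> is a conjugate on a possibly infinite-dimensional space and
  nothing is assumed about moments. The biconjugation step, from a functional below \<open>J\<close>
  back to a member of \<open>Theta\<close>, is therefore probabilistic: it uses the power argument
  on compact convex sets that also settles the lower bound.

  For convex sets one \<zeta> has to serve all separating pairs at once, since it governs the tail
  as well. Finiteness of \<open>ell_s\<close>, or of the rate function at 0, supplies an upper bound
  for the \<zeta> of all these pairs.\<close>

definition sublinear :: "('a::real_vector \<Rightarrow> real) \<Rightarrow> bool" where
  "sublinear p \<longleftrightarrow> (\<forall>x y. p (x + y) \<le> p x + p y) \<and> (\<forall>t\<ge>0. \<forall>x. p (t *\<^sub>R x) = t * p x)"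

lemma sublinear_add: "sublinear p \<Longrightarrow> p (x + y) \<le> p x + p y"
  and sublinear_scale: "sublinear p \<Longrightarrow> t \<ge> 0 \<Longrightarrow> p (t *\<^sub>R x) = t * p x"
  by (auto simp: sublinear_def)

lemma sublinear_0: "sublinear p \<Longrightarrow> p 0 = 0"
  using sublinear_scale[of p 0 0] by simp

lemma sublinear_ge_neg: "sublinear p \<Longrightarrow> - p (- x) \<le> p x"
  using sublinear_add[of p x "- x"] sublinear_0[of p] by simp

text \<open>It is enough that sums and positive multiples of members are dominated by further
  members; no single \<open>q i\<close> has to be sublinear. The bound \<open>- p (- x)\<close>
  keeps the infima finite. One inequality for scaling suffices, since applying it to the inverse
  factor gives the reverse.\<close>

lemma sublinear_INF:
  fixes Q :: "'i set" and q :: "'i \<Rightarrow> 'a::real_vector \<Rightarrow> real"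
  assumes ne: "Q \<noteq> {}"
    and low: "\<And>i x. i \<in> Q \<Longrightarrow> - p (- x) \<le> q i x"
    and add: "\<And>i j x y. i \<in> Q \<Longrightarrow> j \<in> Q \<Longrightarrow> \<exists>k\<in>Q. q k (x + y) \<le> q i x + q j y"
    and scale: "\<And>i t x. i \<in> Q \<Longrightarrow> t > 0 \<Longrightarrow> \<exists>k\<in>Q. q k (t *\<^sub>R x) \<le> t * q i x"
  shows "sublinear (\<lambda>x. INF i\<in>Q. q i x)"
proof -
  define u where "u x = (INF i\<in>Q. q i x)" for x
  have bdd: "bdd_below ((\<lambda>i. q i x) ` Q)" for x
    using low by (auto intro!: bdd_belowI2)
  have le: "u x \<le> q i x" if "i \<in> Q" for i x
    unfolding u_def by (rule cINF_lower[OF bdd that])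
  have ge: "c \<le> u x" if "\<And>i. i \<in> Q \<Longrightarrow> c \<le> q i x" for c x
    unfolding u_def by (rule cINF_greatest[OF ne that])
  have sub: "u (x + y) \<le> u x + u y" for x y
  proof -
    have "u (x + y) - q i x \<le> u y" if i: "i \<in> Q" for i
    proof (rule ge)
      fix j assume j: "j \<in> Q"
      from add[OF i j] obtain k where "k \<in> Q" "q k (x + y) \<le> q i x + q j y" by blast
      with le[of k "x + y"] show "u (x + y) - q i x \<le> q j y" by linarith
    qed
    then have "u (x + y) - u y \<le> u x" by (intro ge) (simp add: algebra_simps)
    then show ?thesis by simp
  qed
  have le_scale: "u (t *\<^sub>R x) \<le> t * u x" if t: "t > 0" for t x
  proof -
    have "u (t *\<^sub>R x) / t \<le> u x"
    proof (rule ge)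
      fix i assume i: "i \<in> Q"
      from scale[OF i t] obtain k where "k \<in> Q" "q k (t *\<^sub>R x) \<le> t * q i x" by blast
      with le[of k "t *\<^sub>R x"] t show "u (t *\<^sub>R x) / t \<le> q i x" by (simp add: field_simps)
    qed
    then show ?thesis using t by (simp add: field_simps)
  qed
  have eq_scale: "u (t *\<^sub>R x) = t * u x" if t: "t > 0" for t x
  proof (rule antisym[OF le_scale[OF t]])
    have "u (inverse t *\<^sub>R (t *\<^sub>R x)) \<le> inverse t * u (t *\<^sub>R x)" using t by (intro le_scale) simp
    then show "t * u x \<le> u (t *\<^sub>R x)" using t by (simp add: field_simps)
  qed
  have "u (2 *\<^sub>R 0) = 2 * u 0" by (rule eq_scale) simp
  then have "u 0 = 0" by simp
  then have "u (t *\<^sub>R x) = t * u x" if "t \<ge> 0" for t x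
    using that eq_scale[of t x] by (cases "t = 0") auto
  with sub show ?thesis unfolding sublinear_def u_def by blast
qed

text \<open>
  The subtraction \<open>t * q z\<close> forces the value at \<open>- z\<close> down to \<open>- q z\<close>; a minimal sublinear
  functional is therefore additive.
\<close>

lemma sublinear_lower_at:
  assumes q: "sublinear q"
  obtains r where "sublinear r" "\<And>x. r x \<le> q x" "r (- z) \<le> - q z"
    "\<And>x t. t \<ge> 0 \<Longrightarrow> r x \<le> q (x + t *\<^sub>R z) - t * q z"
proof -
  define g where "g t x = q (x + t *\<^sub>R z) - t * q z" for t x
  have low: "- q (- x) \<le> g t x" if "t \<in> {0..}" for t x
  proof -
    have "q (- x + (x + t *\<^sub>R z)) \<le> q (- x) + q (x + t *\<^sub>R z)" by (rule sublinear_add[OF q])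
    then show ?thesis using that sublinear_scale[OF q, of t z] by (simp add: g_def)
  qed
  define r where "r x = (INF t\<in>{0..}. g t x)" for x
  have le: "r x \<le> g t x" if "t \<ge> 0" for t x
    unfolding r_def using that low by (intro cINF_lower bdd_belowI2[where m = "- q (- x)"]) auto
  have "sublinear (\<lambda>x. INF t\<in>{0..}. g t x)"
  proof (rule sublinear_INF[where p = q])
    show "- q (- x) \<le> g t x" if "t \<in> {0..}" for t x by (rule low[OF that])
    fix s t :: real and x y assume st: "s \<in> {0..}" "t \<in> {0..}"
    have "q ((x + s *\<^sub>R z) + (y + t *\<^sub>R z)) \<le> q (x + s *\<^sub>R z) + q (y + t *\<^sub>R z)"
      by (rule sublinear_add[OF q])
    then have "g (s + t) (x + y) \<le> g s x + g t y" by (simp add: g_def algebra_simps)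
    then show "\<exists>k\<in>{0..}. g k (x + y) \<le> g s x + g t y" using st by (intro bexI[of _ "s + t"]) auto
  next
    fix s t :: real and x assume st: "s \<in> {0..}" "0 < t"
    have "q (t *\<^sub>R (x + s *\<^sub>R z)) = t * q (x + s *\<^sub>R z)" using st by (intro sublinear_scale[OF q]) auto
    then have "g (t * s) (t *\<^sub>R x) \<le> t * g s x" by (simp add: g_def algebra_simps)
    then show "\<exists>k\<in>{0..}. g k (t *\<^sub>R x) \<le> t * g s x" using st by (intro bexI[of _ "t * s"]) auto
  qed auto
  then have "sublinear r" by (simp add: r_def[abs_def])
  moreover have "r x \<le> q x" for x using le[of 0 x] by (simp add: g_def)
  moreover have "r (- z) \<le> - q z" using le[of 1 "- z"] sublinear_0[OF q] by (simp add: g_def)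
  moreover have "r x \<le> q (x + t *\<^sub>R z) - t * q z" if "t \<ge> 0" for x t
    using le[OF that, of x] by (simp add: g_def)
  ultimately show thesis by (rule that)
qed

text \<open>Lowering \<open>p\<close> at \<open>z\<close> before Zorn's lemma secures the last
  conclusion: everything below \<open>p'\<close> is at most \<open>- p z\<close> at
  \<open>- z\<close>, so a linear functional below \<open>p'\<close> is at least \<open>p z\<close>
  at \<open>z\<close>. Chains have lower bounds because all members of \<open>A\<close> lie above
  \<open>- p' (- x)\<close>.\<close>

lemma hahn_banach_sublinear:
  fixes p :: "'a::real_vector \<Rightarrow> real"
  assumes p: "sublinear p"
  obtains f where "linear f" "\<And>x. f x \<le> p x" "p z \<le> f z"
proof -
  obtain p' where p': "sublinear p'" "\<And>x. p' x \<le> p x" "p' (- z) \<le> - p z"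
    using sublinear_lower_at[OF p] by metis
  define A where "A = {q. sublinear q \<and> (\<forall>x. q x \<le> p' x)}"
  define P where "P q r \<longleftrightarrow> (\<forall>x. r x \<le> q x)" for q r :: "'a \<Rightarrow> real"
  have p'A: "p' \<in> A" using p' by (auto simp: A_def)
  have low: "- p' (- x) \<le> q x" if "q \<in> A" for q x
    proof -
    have "sublinear q" "q (- x) \<le> p' (- x)" using that by (auto simp: A_def)
    then show ?thesis using sublinear_ge_neg[of q x] by linarith
  qed
  have po: "partial_order_on A (relation_of P A)"
    by (rule partial_order_on_relation_ofI) (auto simp: P_def intro!: ext intro: order_trans antisym)
  have "\<exists>m\<in>A. \<forall>a\<in>A. P m a \<longrightarrow> a = m"
  proof (rule predicate_Zorn[OF po])
    fix C assume "C \<in> Chains (relation_of P A)"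
    then have CA: "C \<subseteq> A" and tot: "\<And>q r. q \<in> C \<Longrightarrow> r \<in> C \<Longrightarrow> P q r \<or> P r q"
      by (auto simp: Chains_def relation_of_def)
    show "\<exists>u\<in>A. \<forall>a\<in>C. P a u"
    proof (cases "C = {}")
      case True then show ?thesis using p'A by auto
    next
      case False
      define u where "u x = (INF q\<in>C. q x)" for x
      have bdd: "bdd_below ((\<lambda>q. q x) ` C)" for x
        using low CA by (intro bdd_belowI2[where m = "- p' (- x)"]) auto
      have le: "u x \<le> q x" if "q \<in> C" for q x
        unfolding u_def by (rule cINF_lower[OF bdd that])
      have "sublinear (\<lambda>x. INF q\<in>C. q x)"
      proof (rule sublinear_INF[where p = p'])
        show "C \<noteq> {}" by fact
        show "- p' (- x) \<le> q x" if "q \<in> C" for q x using low CA that by auto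
        show "\<exists>k\<in>C. k (x + y) \<le> q x + r y" if qr: "q \<in> C" "r \<in> C" for q r x y
          using tot[OF qr]
        proof
          assume "P q r"
          moreover have "r (x + y) \<le> r x + r y" using qr CA by (intro sublinear_add) (auto simp: A_def)
          ultimately have "r (x + y) \<le> q x + r y" unfolding P_def by (smt (verit))
          then show ?thesis using qr by blast
        next
          assume "P r q"
          moreover have "q (x + y) \<le> q x + q y" using qr CA by (intro sublinear_add) (auto simp: A_def)
          ultimately have "q (x + y) \<le> q x + r y" unfolding P_def by (smt (verit))
          then show ?thesis using qr by blast
        qed
        show "\<exists>k\<in>C. k (t *\<^sub>R x) \<le> t * q x" if "q \<in> C" "t > 0" for q t x
          using that CA by (intro bexI[of _ q]) (auto simp: A_def sublinear_scale)
      qed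
      then have "sublinear u" by (simp add: u_def[abs_def])
      moreover have "u x \<le> p' x" for x
      proof -
        obtain q where q: "q \<in> C" using False by blast
        then have "q x \<le> p' x" using CA by (auto simp: A_def)
        then show ?thesis using le[OF q, of x] by linarith
      qed
      ultimately show ?thesis using le by (auto simp: A_def P_def)
    qed
  qed
  then obtain m where mA: "m \<in> A" and mmin: "\<And>a. a \<in> A \<Longrightarrow> (\<And>x. a x \<le> m x) \<Longrightarrow> a = m"
    by (auto simp: P_def)
  have m: "sublinear m" "\<And>x. m x \<le> p' x" using mA by (auto simp: A_def)
  have add: "m (x + y) = m x + m y" for x y
  proof (rule antisym[OF sublinear_add[OF m(1)]])
    obtain r where r: "sublinear r" "\<And>x. r x \<le> m x"
      "\<And>x t. t \<ge> 0 \<Longrightarrow> r x \<le> m (x + t *\<^sub>R y) - t * m y"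
      using sublinear_lower_at[OF m(1), of y] by metis
    \<comment> \<open>Minimality allows no further lowering at \<open>y\<close>; the bound for
      \<open>r\<close> at t = 1 then says that \<open>m\<close> is superadditive.\<close>
    have "r = m" using r m order_trans[OF r(2) m(2)] by (intro mmin) (auto simp: A_def)
    with r(3)[of 1 x] show "m x + m y \<le> m (x + y)" by simp
  qed
  have neg: "m (- x) = - m x" for x using add[of x "- x"] sublinear_0[OF m(1)] by simp
  have "linear m"
  proof (rule linearI)
    show "m (x + y) = m x + m y" for x y by (rule add)
    show "m (c *\<^sub>R x) = c *\<^sub>R m x" for c x
    proof (cases "c \<ge> 0")
      case True then show ?thesis by (simp add: sublinear_scale[OF m(1)])
    next
      case False
      then have "m (- (c *\<^sub>R x)) = (- c) * m x"
        using sublinear_scale[OF m(1), of "- c" x] by simp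
      then show ?thesis by (simp add: neg)
    qed
  qed
  moreover have "m x \<le> p x" for x using m(2) p'(2) order_trans by blast
  moreover have "p z \<le> m z" using m(2)[of "- z"] p'(3) neg[of z] by simp
  ultimately show thesis by (rule that)
qed

text \<open>
  The sublinear functional to which Hahn--Banach is applied is the infimal convolution of the
  function with epigraph \<open>H\<close> and a large multiple of the norm.
\<close>

lemma hahn_banach_cone:
  fixes H :: "'a::real_normed_vector \<Rightarrow> real \<Rightarrow> bool"
  assumes add: "\<And>x y c d. H x c \<Longrightarrow> H y d \<Longrightarrow> H (x + y) (c + d)"
    and scale: "\<And>x c t. H x c \<Longrightarrow> t > 0 \<Longrightarrow> H (t *\<^sub>R x) (t * c)"
    and nonneg: "\<And>x c. H x c \<Longrightarrow> 0 \<le> c"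
    and ex: "H x0 d0"
    and r: "r > 0" and b: "b \<ge> 0"
    and away: "\<And>x c. H x c \<Longrightarrow> x \<in> ball z r \<Longrightarrow> b \<le> c"
  obtains f where "bounded_linear f" "b \<le> f z" "\<And>x c. H x c \<Longrightarrow> f x \<le> c"
proof -
  \<comment> \<open>With this slope the norm penalty at distance \<open>r\<close> from
    \<open>z\<close> is already \<open>b\<close>, so points of the cone outside the ball cannot push
    \<open>p z\<close> below \<open>b\<close>.\<close>
  define k where "k = b / r"
  have k: "k \<ge> 0" using r b by (simp add: k_def)
  define Q where "Q = {(y, c). H y c}"
  define g :: "'a \<times> real \<Rightarrow> 'a \<Rightarrow> real" where "g = (\<lambda>(y, c) x. c + k * norm (x - y))"
  define p where "p x = (INF i\<in>Q. g i x)" for x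
  have Q0: "(x0, d0) \<in> Q" using ex by (simp add: Q_def)
  have g0: "0 \<le> g i x" if "i \<in> Q" for i x
    using that nonneg k by (auto simp: Q_def g_def)
  have le: "p x \<le> g i x" if "i \<in> Q" for i x
    unfolding p_def by (intro cINF_lower that bdd_belowI2[where m = 0]) (use g0 in auto)
  have ge: "c \<le> p x" if "\<And>i. i \<in> Q \<Longrightarrow> c \<le> g i x" for c x
    unfolding p_def using Q0 that by (intro cINF_greatest) auto
  have "sublinear (\<lambda>x. INF i\<in>Q. g i x)"
  proof (rule sublinear_INF[where p = "\<lambda>_. 0"])
    show "Q \<noteq> {}" using Q0 by auto
    show "- 0 \<le> g i x" if "i \<in> Q" for i x using g0[OF that] by simp
    show "\<exists>l\<in>Q. g l (x + y) \<le> g i x + g j y" if ij: "i \<in> Q" "j \<in> Q" for i j x y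
    proof -
      obtain u c v d where [simp]: "i = (u, c)" "j = (v, d)" by fastforce
      have "norm (x + y - (u + v)) \<le> norm (x - u) + norm (y - v)"
        by (metis add_diff_add norm_triangle_ineq)
      then have "k * norm (x + y - (u + v)) \<le> k * (norm (x - u) + norm (y - v))"
        using k by (rule mult_left_mono)
      then have "g (u + v, c + d) (x + y) \<le> g i x + g j y"
        by (simp add: g_def algebra_simps)
      moreover have "(u + v, c + d) \<in> Q" using ij add by (auto simp: Q_def)
      ultimately show ?thesis by blast
    qed
    show "\<exists>l\<in>Q. g l (t *\<^sub>R x) \<le> t * g i x" if i: "i \<in> Q" "t > 0" for i t x
    proof -
      obtain u c where [simp]: "i = (u, c)" by fastforce
      have "norm (t *\<^sub>R x - t *\<^sub>R u) = t * norm (x - u)"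
        using i by (simp flip: scaleR_diff_right)
      then have "g (t *\<^sub>R u, t * c) (t *\<^sub>R x) \<le> t * g i x"
        by (simp add: g_def algebra_simps)
      moreover have "(t *\<^sub>R u, t * c) \<in> Q" using i scale by (auto simp: Q_def)
      ultimately show ?thesis by blast
    qed
  qed
  then have p: "sublinear p" by (simp add: p_def[abs_def])
  have p_norm: "p x \<le> k * norm x" for x
  proof (rule field_le_epsilon)
    fix e :: real assume e: "e > 0"
    \<comment> \<open>The point \<open>(x0, d0)\<close> is shrunk towards the origin inside the
      cone; \<open>D\<close> is its cost together with its norm penalty, and both scale with
      \<open>t\<close>.\<close>
    define D where "D = d0 + k * norm x0"
    have D: "0 \<le> D" using nonneg[OF ex] k by (simp add: D_def)
    define t where "t = e / (D + 1)"
    have t: "t > 0" "t * D \<le> e" using e D by (auto simp: t_def field_simps)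
    have "p x \<le> g (t *\<^sub>R x0, t * d0) x"
      using scale[OF ex t(1)] by (intro le) (simp add: Q_def)
    also have "\<dots> \<le> t * d0 + k * (norm x + t * norm x0)"
      using k t norm_triangle_ineq4[of x "t *\<^sub>R x0"] by (simp add: g_def mult_left_mono)
    also have "\<dots> = k * norm x + t * D" by (simp add: D_def algebra_simps)
    finally show "p x \<le> k * norm x + e" using t by simp
  qed
  obtain f where f: "linear f" "\<And>x. f x \<le> p x" "p z \<le> f z"
    using hahn_banach_sublinear[OF p] by metis
  have "norm (f x) \<le> norm x * k" for x
    using f(2)[of x] f(2)[of "- x"] p_norm[of x] p_norm[of "- x"] linear_neg[OF f(1), of x]
    by (simp add: mult.commute abs_le_iff)
  then have "bounded_linear f"
    using f(1) by (intro bounded_linear_intro[where K = k]) (auto simp: linear_add linear_cmul)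
  moreover have "b \<le> p z"
  proof (rule ge)
    fix i assume i: "i \<in> Q"
    obtain y c where [simp]: "i = (y, c)" by fastforce
    have H: "H y c" using i by (simp add: Q_def)
    show "b \<le> g i z"
    proof (cases "y \<in> ball z r")
      case True
      then show ?thesis using away[OF H] k by (auto simp: g_def intro: add_increasing2)
    next
      case False
      then have "k * r \<le> k * norm (z - y)" using k by (intro mult_left_mono) (auto simp: dist_norm)
      then show ?thesis using nonneg[OF H] r by (simp add: g_def k_def)
    qed
  qed
  moreover have "f x \<le> c" if "H x c" for x c
    using f(2)[of x] le[of "(x, c)" x] that by (auto simp: Q_def g_def)
  ultimately show thesis using f(3) by (intro that[of f]) auto
qed

text \<open>Hahn--Banach applied to the norm itself. It turns an exponential moment of the norm of
  the reward into a member of \<open>Theta\<close>, which gives coercivity in finite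
  dimension.\<close>

lemma norming_functional:
  fixes x :: "'a::real_normed_vector"
  obtains f :: "'a \<Rightarrow>\<^sub>L real" where "norm x \<le> f x" "\<And>y. f y \<le> norm y"
proof -
  have "sublinear (norm :: 'a \<Rightarrow> real)" by (auto simp: sublinear_def norm_triangle_ineq)
  then obtain f where f: "linear f" "\<And>y. f y \<le> norm y" "norm x \<le> f x"
    using hahn_banach_sublinear by metis
  have "norm (f y) \<le> norm y * 1" for y
    using f(2)[of y] f(2)[of "- y"] linear_neg[OF f(1), of y] by (auto simp: abs_le_iff)
  then have "bounded_linear f"
    using f(1) by (intro bounded_linear_intro[where K = 1]) (auto simp: linear_add linear_cmul)
  then show thesis using f by (intro that[of "Blinfun f"]) (auto simp: bounded_linear_Blinfun_apply)
qed


section \<open>Compact convex sets\<close>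

text \<open>Thickening a convex set by a ball is a Minkowski sum of convex sets, hence convex, so it
  contains the hull as soon as it contains \<open>C\<close>.\<close>

lemma convex_hull_subset_UN_ball:
  fixes C :: "'a::real_normed_vector set"
  assumes C: "C \<subseteq> (\<Union>x\<in>k. ball x e)"
  shows "convex hull C \<subseteq> (\<Union>x\<in>convex hull k. ball x e)"
proof (rule hull_minimal)
  have "(\<Union>x\<in>convex hull k. ball x e) = (\<Union>x\<in>convex hull k. \<Union>y\<in>ball 0 e. {x + y})"
    by (fastforce simp: dist_norm intro!: bexI[of _ "_ - _"] simp: norm_minus_commute)
  then show "convex (\<Union>x\<in>convex hull k. ball x e)"
    by (simp add: convex_sums)
  show "C \<subseteq> (\<Union>x\<in>convex hull k. ball x e)"
    using C hull_subset[of k convex] by blast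
qed

text \<open>Mazur's theorem through total boundedness. Three approximations, by the hull of
  \<open>C\<close>, by the hull of a finite net and by a net of that compact hull, cost e/3
  each.\<close>

lemma compact_closure_convex_hull:
  fixes C :: "'a::banach set"
  assumes "compact C"
  shows "compact (closure (convex hull C))"
  unfolding compact_eq_totally_bounded complete_eq_closed
proof (intro conjI allI impI)
  show "closed (closure (convex hull C))" by simp
  fix e :: real assume e: "e > 0"
  then obtain k where k: "finite k" "C \<subseteq> (\<Union>x\<in>k. ball x (e/3))"
    using assms unfolding compact_eq_totally_bounded by (meson divide_pos_pos zero_less_numeral)
  have "compact (convex hull k)" by (rule finite_imp_compact_convex_hull[OF k(1)])
  with e obtain k' where k': "finite k'" "convex hull k \<subseteq> (\<Union>x\<in>k'. ball x (e/3))"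
    unfolding compact_eq_totally_bounded by (meson divide_pos_pos zero_less_numeral)
  have "closure (convex hull C) \<subseteq> (\<Union>x\<in>k'. ball x e)"
  proof
    fix y assume "y \<in> closure (convex hull C)"
    then obtain z where z: "z \<in> convex hull C" "dist z y < e/3"
      using e by (meson closure_approachable divide_pos_pos zero_less_numeral)
    obtain x where x: "x \<in> convex hull k" "dist x z < e/3"
      using convex_hull_subset_UN_ball[OF k(2)] z(1) by auto
    obtain w where w: "w \<in> k'" "dist w x < e/3" using k'(2) x(1) by auto
    have "dist w y < e"
      using z x w dist_triangle[of w y x] dist_triangle[of x y z] by linarith
    then show "y \<in> (\<Union>x\<in>k'. ball x e)" using w by auto
  qed
  with k'(1) show "\<exists>k. finite k \<and> closure (convex hull C) \<subseteq> (\<Union>x\<in>k. ball x e)" by blast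
qed

text \<open>A compact subset of an open set keeps a margin \<open>e\<close> inside it. The points
  whose e-ball stays in \<open>U\<close> form a convex set, so the hull keeps the same margin and
  its closure cannot leave \<open>U\<close>.\<close>

lemma closure_convex_hull_subset_open:
  fixes C :: "'a::real_normed_vector set"
  assumes "compact C" "C \<subseteq> U" "open U" "convex U"
  shows "closure (convex hull C) \<subseteq> U"
proof -
  obtain e where e: "e > 0" "(\<Union>x\<in>C. ball x e) \<subseteq> U"
    using compact_subset_open_imp_ball_epsilon_subset[OF assms(1,3,2)] by blast
  have hullU: "(\<Union>x\<in>convex hull C. \<Union>y\<in>ball 0 e. {x + y}) \<subseteq> U"
  proof -
    have "convex {x. \<forall>y\<in>ball 0 e. x + y \<in> U}"
    proof (rule convexI; safe)
      fix x y and u v :: real and d :: 'a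
      assume H: "\<forall>d\<in>ball 0 e. x + d \<in> U" "\<forall>d\<in>ball 0 e. y + d \<in> U"
        "0 \<le> u" "0 \<le> v" "u + v = 1" "d \<in> ball 0 e"
      have "u *\<^sub>R (x + d) + v *\<^sub>R (y + d) \<in> U"
        using H by (intro convexD[OF assms(4)]) auto
      also have "u *\<^sub>R (x + d) + v *\<^sub>R (y + d) = u *\<^sub>R x + v *\<^sub>R y + (u + v) *\<^sub>R d"
        by (simp add: algebra_simps)
      finally show "u *\<^sub>R x + v *\<^sub>R y + d \<in> U" using H by simp
    qed
    moreover have "C \<subseteq> {x. \<forall>y\<in>ball 0 e. x + y \<in> U}"
    proof safe
      fix x y :: 'a assume "x \<in> C" "y \<in> ball 0 e"
      then have "x + y \<in> (\<Union>x\<in>C. ball x e)" by (auto intro!: bexI[of _ x] simp: dist_norm)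
      then show "x + y \<in> U" using e by blast
    qed
    ultimately have "convex hull C \<subseteq> {x. \<forall>y\<in>ball 0 e. x + y \<in> U}" by (rule hull_minimal[rotated])
    then show ?thesis by blast
  qed
  have sub: "x + y \<in> U" if "x \<in> convex hull C" "norm y < e" for x y
  proof -
    have "y \<in> ball 0 e" using that(2) by simp
    then have "x + y \<in> (\<Union>x\<in>convex hull C. \<Union>y\<in>ball 0 e. {x + y})" using that(1) by blast
    then show ?thesis using hullU by blast
  qed
  show ?thesis
  proof
    fix y assume "y \<in> closure (convex hull C)"
    then obtain z where "z \<in> convex hull C" "dist z y < e"
      using e by (meson closure_approachable)
    then show "y \<in> U" using sub[of z "y - z"] by (simp add: dist_norm norm_minus_commute)
  qed
qed

section \<open>Caratheodory's theorem and compactness in finite dimension\<close>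

lemma finite_dim_affine_dependent:
  fixes B S :: "'a::real_vector set"
  assumes B: "finite B" "span B = UNIV" and S: "finite S" "card S > card B + 1"
  shows "affine_dependent S"
proof (rule ccontr)
  assume ind: "\<not> affine_dependent S"
  obtain a where a: "a \<in> S" using S by fastforce
  let ?D = "(\<lambda>x. - a + x) ` (S - {a})"
  have "independent ?D"
    using ind affine_dependent_iff_dependent2[OF a] by simp
  then have "card ?D \<le> card B"
    using independent_span_bound[OF B(1), of ?D] B(2) by simp
  moreover have "card ?D = card S - 1"
    using S(1) a by (subst card_image) (auto simp: inj_on_def)
  ultimately show False using S by simp
qed

text \<open>Caratheodory's reduction: moving the coefficients along an affine dependence leaves the
  point fixed, and the motion stops when the first coefficient vanishes.\<close>

lemma convex_hull_remove_affine_dependent: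
  fixes S :: "'a::real_vector set"
  assumes S: "finite S" "affine_dependent S" and x: "x \<in> convex hull S"
  obtains v where "v \<in> S" "x \<in> convex hull (S - {v})"
proof -
  obtain u where u: "\<And>v. v \<in> S \<Longrightarrow> 0 \<le> u v" "sum u S = 1" "(\<Sum>v\<in>S. u v *\<^sub>R v) = x"
    using x unfolding convex_hull_finite[OF S(1)] by auto
  obtain w where w: "sum w S = 0" "\<exists>v\<in>S. w v \<noteq> 0" "(\<Sum>v\<in>S. w v *\<^sub>R v) = 0"
    using S(2) unfolding affine_dependent_explicit_finite[OF S(1)] by auto
  define P where "P = {v \<in> S. w v > 0}"
  have "\<exists>v\<in>S. w v > 0"
  proof (rule ccontr)
    assume "\<not> (\<exists>v\<in>S. w v > 0)"
    then have "\<forall>v\<in>S. - w v = 0"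
      using w(1) S(1) by (intro sum_nonneg_eq_0_iff[THEN iffD1]) (auto simp: sum_negf not_less)
    then show False using w(2) by simp
  qed
  then have P: "finite P" "P \<noteq> {}" using S(1) by (auto simp: P_def)
  \<comment> \<open>The smallest ratio over the positive entries of the dependence is the longest
    move that keeps all coefficients nonnegative; a minimiser is the point that drops out.\<close>
  define t where "t = Min ((\<lambda>v. u v / w v) ` P)"
  have "t \<in> (\<lambda>v. u v / w v) ` P" unfolding t_def using P by (intro Min_in) auto
  then obtain a where a: "a \<in> S" "w a > 0" "t = u a / w a" by (auto simp: P_def)
  have t0: "t \<ge> 0" using a u(1) by simp
  define u' where "u' v = u v - t * w v" for v
  have u'nn: "0 \<le> u' v" if "v \<in> S" for v
  proof (cases "w v > 0")
    case True
    then have "t \<le> u v / w v" unfolding t_def using P that by (intro Min_le) (auto simp: P_def)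
    then show ?thesis using True by (simp add: u'_def field_simps)
  next
    case False
    then have "t * w v \<le> 0" using t0 by (simp add: mult_nonneg_nonpos)
    then show ?thesis using u(1)[OF that] by (simp add: u'_def)
  qed
  have u'a: "u' a = 0" using a by (simp add: u'_def)
  have "sum u' S = 1"
    using u(2) w(1) by (simp add: u'_def sum_subtractf flip: sum_distrib_left)
  moreover have "(\<Sum>v\<in>S. u' v *\<^sub>R v) = x"
    using u(3) w(3)
    by (simp add: u'_def scaleR_diff_left sum_subtractf flip: scaleR_scaleR scaleR_sum_right)
  ultimately have "sum u' (S - {a}) = 1" "(\<Sum>v\<in>S - {a}. u' v *\<^sub>R v) = x"
    using sum.remove[OF S(1) a(1), of u'] sum.remove[OF S(1) a(1), of "\<lambda>v. u' v *\<^sub>R v"] u'a by auto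
  then have "x \<in> convex hull (S - {a})"
    using u'nn S(1) by (subst convex_hull_finite) auto
  with a(1) show thesis by (rule that)
qed

text \<open>By Caratheodory's theorem boundedly many points suffice, so the hull is an iterated join
  of \<open>C\<close> with itself. The hull is compact without taking its closure, which matters for
  convex sets that are neither open nor closed.\<close>

lemma compact_convex_hull_finite_dim:
  fixes C :: "'a::real_normed_vector set"
  assumes fd: "finite_dim_type TYPE('a)" and C: "compact C"
  shows "compact (convex hull C)"
proof -
  obtain B :: "'a set" where B: "finite B" "span B = UNIV"
    using fd by (auto simp: finite_dim_type_def)
  define N where "N = card B + 1"
  define f where "f = (\<lambda>(u::real, a::'a, b). (1 - u) *\<^sub>R a + u *\<^sub>R b)"
  \<comment> \<open>\<open>K n\<close> joins points of \<open>C\<close> by segments \<open>n\<close>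
    times over, so it contains the hull of every set of at most \<open>Suc n\<close> points of
    \<open>C\<close>.\<close>
  define K where "K n = ((\<lambda>A. f ` ({0..1} \<times> C \<times> A)) ^^ n) C" for n :: nat
  have K_Suc: "K (Suc n) = f ` ({0..1} \<times> C \<times> K n)" and K_0: "K 0 = C" for n
    by (auto simp: K_def)
  have K_compact: "compact (K n)" for n
  proof (induction n)
    case (Suc n)
    have "continuous_on ({0..1} \<times> C \<times> K n) f"
      unfolding f_def case_prod_unfold by (intro continuous_intros)
    then show ?case unfolding K_Suc
      by (intro compact_continuous_image compact_Times C Suc compact_Icc)
  qed (simp add: K_0 C)
  have K_hull: "K n \<subseteq> convex hull C" for n
  proof (induction n)
    case (Suc n)
    show ?case unfolding K_Suc f_def
      using Suc hull_subset[of C convex]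
      by (auto intro!: convexD[OF convex_convex_hull])
  qed (simp add: K_0 hull_subset)
  have K_mono: "K n \<subseteq> K (Suc n)" for n
  proof
    fix x assume x: "x \<in> K n"
    obtain c where "c \<in> C"
      using x K_hull[of n] by fastforce
    then show "x \<in> K (Suc n)"
      unfolding K_Suc f_def using x by (intro image_eqI[of _ _ "(1, c, x)"]) auto
  qed
  have hull_K: "convex hull S \<subseteq> K n" if "finite S" "S \<subseteq> C" "card S \<le> Suc n" for S n
    using that
  proof (induction n arbitrary: S)
    case 0
    then consider "S = {}" | a where "S = {a}" by (metis One_nat_def card_1_singletonE card_0_eq le_SucE le_zero_eq)
    then show ?case using 0 by cases (auto simp: K_0)
  next
    case (Suc n)
    show ?case
    proof (cases "S = {}")
      case False
      then obtain a T where S: "S = insert a T" "a \<notin> T" by (meson Set.set_insert ex_in_conv)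
      have T: "convex hull T \<subseteq> K n" using Suc S by (intro Suc.IH) auto
      show ?thesis
      proof (cases "T = {}")
        case True
        have "C \<subseteq> K m" for m using K_mono by (induction m) (auto simp: K_0)
        then show ?thesis using True S Suc.prems by auto
      next
        case False
        show ?thesis unfolding S(1) convex_hull_insert_alt K_Suc f_def
          using False T Suc.prems S by (force simp: image_iff)
      qed
    qed auto
  qed
  have "convex hull C \<subseteq> K N"
  proof
    fix x assume "x \<in> convex hull C"
    then obtain S0 u where "finite S0" "S0 \<subseteq> C" "\<forall>x\<in>S0. 0 \<le> u x" "sum u S0 = 1"
        "(\<Sum>v\<in>S0. u v *\<^sub>R v) = x"
      unfolding convex_hull_explicit[of C] by blast
    then have "finite S0 \<and> S0 \<subseteq> C \<and> x \<in> convex hull S0"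
      by (simp add: convex_hull_finite) blast
    from ex_has_least_nat[of "\<lambda>S. finite S \<and> S \<subseteq> C \<and> x \<in> convex hull S", OF this, of card]
    obtain S where S: "finite S" "S \<subseteq> C" "x \<in> convex hull S"
      and min: "\<And>T. finite T \<and> T \<subseteq> C \<and> x \<in> convex hull T \<Longrightarrow> card S \<le> card T"
      by blast
    have "card S \<le> N"
    proof (rule ccontr)
      assume "\<not> card S \<le> N"
      then have "affine_dependent S"
        using finite_dim_affine_dependent[OF B S(1)] by (simp add: N_def)
      then obtain v where v: "v \<in> S" "x \<in> convex hull (S - {v})"
        using convex_hull_remove_affine_dependent[OF S(1) _ S(3)] by blast
      have "card S \<le> card (S - {v})" using S v by (intro min) auto
      then show False using card_Diff1_less[OF S(1) v(1)] by simp
    qed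
    then show "x \<in> K N" using hull_K[of S N] S by auto
  qed
  then have "convex hull C = K N" using K_hull by blast
  then show ?thesis using K_compact by simp
qed

text \<open>Induction over the spanning set. The compact set found for \<open>span B\<close> makes
  that span closed, so a new vector \<open>b\<close> has positive distance from it; this distance
  bounds the coefficient of \<open>b\<close> in a vector of norm at most 1, and with it the
  remaining part.\<close>

lemma span_finite_unit_ball_in_compact:
  fixes B :: "'a::real_normed_vector set"
  assumes "finite B"
  shows "\<exists>K. compact K \<and> K \<subseteq> span B \<and> span B \<inter> cball 0 1 \<subseteq> K"
  using assms
proof (induction B)
  case empty
  show ?case by (intro exI[of _ "{0}"]) auto
next
  case (insert b B)
  then obtain K where K: "compact K" "K \<subseteq> span B" "span B \<inter> cball 0 1 \<subseteq> K" by blast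
  show ?case
  proof (cases "b \<in> span B")
    case True
    then show ?thesis using K by (auto simp: span_redundant)
  next
    case False
    have scaled: "x \<in> (\<lambda>x. R *\<^sub>R x) ` K" if "x \<in> span B" "norm x \<le> R" "R > 0" for x R
    proof -
      have "inverse R *\<^sub>R x \<in> span B \<inter> cball 0 1"
        using that by (auto simp: span_scale field_simps)
      then show ?thesis using K(3) that by (intro image_eqI[of _ _ "inverse R *\<^sub>R x"]) auto
    qed
    have "closed (span B)"
      unfolding closed_sequential_limits
    proof safe
      fix x l assume x: "\<forall>n. x n \<in> span B" "x \<longlonglongrightarrow> l"
      then obtain R where R: "R > 0" "\<And>n. norm (x n) \<le> R"
        using Bseq_def convergent_def convergent_imp_Bseq by metis
      have "closed ((\<lambda>x. R *\<^sub>R x) ` K)" using K(1) by (intro compact_imp_closed compact_scaling)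
      then have "l \<in> (\<lambda>x. R *\<^sub>R x) ` K"
        using scaled R x by (meson closed_sequentially)
      then show "l \<in> span B" using K(2) by (auto intro: span_scale)
    qed
    then have d: "infdist b (span B) > 0" (is "?d > 0")
      using False span_zero[of B] by (intro infdist_pos_not_in_closed) auto
    \<comment> \<open>The coefficient of \<open>b\<close> is at most 1 /
      \<open>infdist b (span B)\<close> in absolute value, so removing the multiple of
      \<open>b\<close> leaves a vector of norm at most \<open>R\<close>.\<close>
    define R where "R = 1 + norm b / ?d"
    have R: "R > 0" using d by (simp add: R_def add_pos_nonneg)
    define K' where "K' = {x + y | x y. x \<in> (\<lambda>x. R *\<^sub>R x) ` K \<and> y \<in> (\<lambda>c. c *\<^sub>R b) ` {-(1/?d)..1/?d}}"
    have "compact K'" unfolding K'_def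
      by (intro compact_sums compact_scaling K compact_continuous_image continuous_intros) auto
    moreover have "K' \<subseteq> span (insert b B)"
      unfolding K'_def using K(2) span_mono[of B "insert b B"]
      by (auto intro!: span_add span_scale span_base[of b])
    moreover have "y \<in> K'" if y: "y \<in> span (insert b B)" "norm y \<le> 1" for y
    proof -
      obtain c where c: "y - c *\<^sub>R b \<in> span B" using y(1) by (auto simp: span_breakdown_eq)
      have cd: "\<bar>c\<bar> * ?d \<le> 1"
      proof (cases "c = 0")
        case False
        have "?d \<le> dist b (- (inverse c *\<^sub>R (y - c *\<^sub>R b)))"
          using c by (intro infdist_le span_neg span_scale)
        also have "\<dots> = norm (inverse c *\<^sub>R y)" using False by (simp add: dist_norm algebra_simps)
        also have "\<dots> \<le> inverse \<bar>c\<bar>" using y(2) False by (simp add: field_simps)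
        finally show ?thesis using False by (simp add: field_simps)
      qed simp
      have c1: "\<bar>c\<bar> \<le> 1 / ?d" using cd d by (simp add: field_simps)
      have "norm (y - c *\<^sub>R b) \<le> norm y + \<bar>c\<bar> * norm b"
        by (metis norm_scaleR norm_triangle_ineq4)
      also have "\<dots> \<le> 1 + 1 / ?d * norm b" using c1 y(2) by (intro add_mono mult_right_mono) auto
      finally have "y - c *\<^sub>R b \<in> (\<lambda>x. R *\<^sub>R x) ` K" using c R by (intro scaled) (auto simp: R_def)
      moreover have "c *\<^sub>R b \<in> (\<lambda>c. c *\<^sub>R b) ` {-(1/?d)..1/?d}"
        using c1 by (intro imageI) (auto simp: abs_le_iff minus_le_iff)
      moreover have "y = (y - c *\<^sub>R b) + c *\<^sub>R b" by simp
      ultimately show ?thesis unfolding K'_def by blast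
    qed
    ultimately show ?thesis by (intro exI[of _ K']) auto
  qed
qed

lemma finite_dim_compact:
  fixes F :: "'a::real_normed_vector set"
  assumes fd: "finite_dim_type TYPE('a)" and F: "closed F" "bounded F"
  shows "compact F"
proof -
  obtain B :: "'a set" where B: "finite B" "span B = UNIV"
    using fd by (auto simp: finite_dim_type_def)
  obtain K :: "'a set" where K: "compact K" "cball 0 1 \<subseteq> K"
    using span_finite_unit_ball_in_compact[OF B(1)] B(2) by auto
  obtain R where R: "R > 0" "\<And>x. x \<in> F \<Longrightarrow> norm x \<le> R" using F(2) by (auto simp: bounded_pos)
  have "F \<subseteq> (\<lambda>x. R *\<^sub>R x) ` K"
  proof
    fix x assume "x \<in> F"
    then have "inverse R *\<^sub>R x \<in> K" using R K(2) by (auto simp: subset_iff field_simps)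
    then show "x \<in> (\<lambda>x. R *\<^sub>R x) ` K" using R by (intro image_eqI[of _ _ "inverse R *\<^sub>R x"]) auto
  qed
  then have "F = F \<inter> (\<lambda>x. R *\<^sub>R x) ` K" by blast
  then show ?thesis using closed_Int_compact[OF F(1) compact_scaling[OF K(1)]] by metis
qed


section \<open>Partial sums of the renewal process\<close>

locale renewal =
  fixes M :: "'w measure"
    and S :: "nat \<Rightarrow> 'w \<Rightarrow> real"
    and X :: "nat \<Rightarrow> 'w \<Rightarrow> 'a::{banach, second_countable_topology}"
  assumes rr: "renewal_reward M S X"
begin

sublocale prob_space M
  using rr unfolding renewal_reward_def by blast

definition Z :: "nat \<Rightarrow> 'w \<Rightarrow> real \<times> 'a" where
  "Z i \<omega> = (S i \<omega>, X i \<omega>)"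

definition Zsum :: "nat \<Rightarrow> 'w \<Rightarrow> real \<times> 'a" where
  "Zsum n \<omega> = (\<Sum>i=1..n. Z i \<omega>)"

definition law :: "nat \<Rightarrow> (real \<times> 'a) measure" where
  "law n = distr M borel (Zsum n)"

definition step_law :: "(real \<times> 'a) measure" where
  "step_law = distr M borel (Z 1)"

lemma indep_Z: "indep_vars (\<lambda>_. borel) Z {1..}"
  using rr unfolding renewal_reward_def Z_def[abs_def] by blast

lemma Z_measurable: "i \<ge> 1 \<Longrightarrow> Z i \<in> borel_measurable M"
  using indep_Z by (auto simp: indep_vars_def)

lemma distr_Z: "i \<ge> 1 \<Longrightarrow> distr M borel (Z i) = step_law"
  using rr unfolding renewal_reward_def Z_def[abs_def] step_law_def by blast

lemma S_measurable: "i \<ge> 1 \<Longrightarrow> S i \<in> borel_measurable M"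
  and X_measurable: "i \<ge> 1 \<Longrightarrow> X i \<in> borel_measurable M"
proof -
  assume i: "i \<ge> 1"
  have [measurable]: "Z i \<in> borel_measurable M" by (rule Z_measurable[OF i])
  have "(fst :: real \<times> 'a \<Rightarrow> real) \<in> borel_measurable borel" "(snd :: real \<times> 'a \<Rightarrow> 'a) \<in> borel_measurable borel"
    by (intro borel_measurable_continuous_onI continuous_intros)+
  then have "(\<lambda>\<omega>. fst (Z i \<omega>)) \<in> borel_measurable M" "(\<lambda>\<omega>. snd (Z i \<omega>)) \<in> borel_measurable M"
    by (auto intro: measurable_compose[OF Z_measurable[OF i]])
  then show "S i \<in> borel_measurable M" "X i \<in> borel_measurable M" by (simp_all add: Z_def)
qed

lemma S_pos: "i \<ge> 1 \<Longrightarrow> \<omega> \<in> space M \<Longrightarrow> S i \<omega> > 0"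
  using rr unfolding renewal_reward_def by blast

lemma renewal_time_at_top: "\<omega> \<in> space M \<Longrightarrow> filterlim (\<lambda>i. renewal_time S i \<omega>) at_top sequentially"
  using rr unfolding renewal_reward_def by blast

lemma Zsum_measurable [measurable]: "Zsum n \<in> borel_measurable M"
  unfolding Zsum_def[abs_def] by (intro borel_measurable_sum Z_measurable) auto

lemma Zsum_0 [simp]: "Zsum 0 \<omega> = 0"
  by (simp add: Zsum_def)

lemma Zsum_Suc: "Zsum (Suc n) \<omega> = Zsum n \<omega> + Z (Suc n) \<omega>"
  by (simp add: Zsum_def)

lemma Zsum_1 [simp]: "Zsum (Suc 0) = Z (Suc 0)"
  by (rule ext) (simp add: Zsum_def)

lemma fst_Zsum: "fst (Zsum n \<omega>) = renewal_time S n \<omega>"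
  and snd_Zsum: "snd (Zsum n \<omega>) = (\<Sum>i=1..n. X i \<omega>)"
  by (simp_all add: Zsum_def Z_def renewal_time_def fst_sum snd_sum)

lemma sets_law [simp, measurable_cong]: "sets (law n) = sets borel"
  and space_law [simp]: "space (law n) = UNIV"
  and sets_step_law [simp, measurable_cong]: "sets step_law = sets borel"
  and space_step_law [simp]: "space step_law = UNIV"
  by (simp_all add: law_def step_law_def)

lemma prob_space_law: "prob_space (law n)"
  unfolding law_def by (rule prob_space_distr[OF Zsum_measurable])

lemma prob_space_step_law: "prob_space step_law"
  unfolding step_law_def by (rule prob_space_distr) (simp add: Z_measurable)

lemma law_1: "law 1 = step_law"
  by (simp add: law_def step_law_def)

lemma emeasure_law: "A \<in> sets borel \<Longrightarrow> emeasure (law n) A = emeasure M {\<omega>\<in>space M. Zsum n \<omega> \<in> A}"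
  unfolding law_def
  by (subst emeasure_distr[OF Zsum_measurable]) (auto intro!: arg_cong[where f = "emeasure M"])

lemma nn_integral_law:
  "f \<in> borel_measurable borel \<Longrightarrow> (\<integral>\<^sup>+x. f x \<partial>law n) = (\<integral>\<^sup>+\<omega>. f (Zsum n \<omega>) \<partial>M)"
  unfolding law_def by (subst nn_integral_distr[OF Zsum_measurable]) auto

lemma nn_integral_step_law:
  "f \<in> borel_measurable borel \<Longrightarrow> i \<ge> 1 \<Longrightarrow> (\<integral>\<^sup>+x. f x \<partial>step_law) = (\<integral>\<^sup>+\<omega>. f (Z i \<omega>) \<partial>M)"
  using nn_integral_distr[OF Z_measurable, of i f] distr_Z[of i] by simp

lemma emeasure_law_le_1: "emeasure (law n) A \<le> 1"
  using prob_space_law by (rule prob_space.emeasure_le_1)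

text \<open>The first \<open>n\<close> steps and step \<open>Suc n\<close> are restrictions of one
  independent family to disjoint index sets, so their joint law is a product and the last step can
  be integrated out first. The variable \<open>V\<close> is left general because it stands for a
  partial sum in one use and for the indicator of an event in the other.\<close>

lemma nn_integral_past_step:
  assumes g: "g \<in> measurable (PiM {1..n} (\<lambda>_. borel)) N"
    and V: "\<And>\<omega>. \<omega> \<in> space M \<Longrightarrow> V \<omega> = g (\<lambda>i\<in>{1..n}. Z i \<omega>)"
    and F: "case_prod F \<in> borel_measurable (N \<Otimes>\<^sub>M borel)"
  shows "(\<integral>\<^sup>+\<omega>. F (V \<omega>) (Z (Suc n) \<omega>) \<partial>M) = (\<integral>\<^sup>+\<omega>. (\<integral>\<^sup>+z. F (V \<omega>) z \<partial>step_law) \<partial>M)"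
proof -
  let ?P = "PiM {1..n} (\<lambda>_. borel :: (real \<times> 'a) measure)"
    and ?Q = "PiM {Suc n} (\<lambda>_. borel :: (real \<times> 'a) measure)"
  define U where "U \<omega> = (\<lambda>i\<in>{1..n}. Z i \<omega>)" for \<omega>
  define W where "W \<omega> = (\<lambda>i\<in>{Suc n}. Z i \<omega>)" for \<omega>
  have "indep_var ?P U ?Q W"
    unfolding U_def[abs_def] W_def[abs_def] by (rule indep_var_restrict[OF indep_Z]) auto
  then have eq: "distr M ?P U \<Otimes>\<^sub>M distr M ?Q W = distr M (?P \<Otimes>\<^sub>M ?Q) (\<lambda>\<omega>. (U \<omega>, W \<omega>))"
    and Um [measurable]: "U \<in> measurable M ?P" and Wm [measurable]: "W \<in> measurable M ?Q"
    by (auto simp: indep_var_distribution_eq)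
  interpret W: prob_space "distr M ?Q W" by (rule prob_space_distr[OF Wm])
  have comp: "(\<lambda>f. f (Suc n)) \<in> measurable ?Q borel"
    by (rule measurable_component_singleton) simp
  have pair: "(\<lambda>p. (g (fst p), snd p (Suc n))) \<in> measurable (?P \<Otimes>\<^sub>M ?Q) (N \<Otimes>\<^sub>M borel)"
    by (intro measurable_Pair measurable_compose[OF measurable_fst g] measurable_compose[OF measurable_snd comp])
  have F1: "(\<lambda>p. F (g (fst p)) (snd p (Suc n))) \<in> borel_measurable (?P \<Otimes>\<^sub>M ?Q)"
    using measurable_compose[OF pair F] by simp
  have F2: "(\<lambda>z. F v z) \<in> borel_measurable borel" if "v \<in> space N" for v
    using measurable_compose[OF measurable_Pair1'[OF that] F] by simp
  have step: "(\<integral>\<^sup>+w. F (g u) (w (Suc n)) \<partial>distr M ?Q W) = (\<integral>\<^sup>+z. F (g u) z \<partial>step_law)" if u: "u \<in> space ?P" for u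
  proof -
    have gu: "g u \<in> space N" using measurable_space[OF g u] .
    have "(\<integral>\<^sup>+w. F (g u) (w (Suc n)) \<partial>distr M ?Q W) = (\<integral>\<^sup>+\<omega>. F (g u) (W \<omega> (Suc n)) \<partial>M)"
      using measurable_compose[OF comp F2[OF gu]] by (subst nn_integral_distr[OF Wm]) auto
    also have "\<dots> = (\<integral>\<^sup>+z. F (g u) z \<partial>step_law)"
      using nn_integral_step_law[OF F2[OF gu], of "Suc n"] by (simp add: W_def)
    finally show ?thesis .
  qed
  have "(\<integral>\<^sup>+\<omega>. F (V \<omega>) (Z (Suc n) \<omega>) \<partial>M) = (\<integral>\<^sup>+\<omega>. F (g (U \<omega>)) (W \<omega> (Suc n)) \<partial>M)"
    by (intro nn_integral_cong) (simp add: V U_def W_def)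
  also have "\<dots> = (\<integral>\<^sup>+p. F (g (fst p)) (snd p (Suc n)) \<partial>distr M (?P \<Otimes>\<^sub>M ?Q) (\<lambda>\<omega>. (U \<omega>, W \<omega>)))"
    using F1 by (subst nn_integral_distr[OF measurable_Pair[OF Um Wm]]) auto
  also have "\<dots> = (\<integral>\<^sup>+u. (\<integral>\<^sup>+w. F (g u) (w (Suc n)) \<partial>distr M ?Q W) \<partial>distr M ?P U)"
  proof -
    have "(\<lambda>p. F (g (fst p)) (snd p (Suc n))) \<in> borel_measurable (distr M ?P U \<Otimes>\<^sub>M distr M ?Q W)"
      using F1 by (simp add: eq)
    from W.nn_integral_fst[OF this] show ?thesis
      unfolding eq[symmetric] by simp
  qed
  also have "\<dots> = (\<integral>\<^sup>+u. (\<integral>\<^sup>+z. F (g u) z \<partial>step_law) \<partial>distr M ?P U)"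
    by (intro nn_integral_cong step) simp
  also have "\<dots> = (\<integral>\<^sup>+\<omega>. (\<integral>\<^sup>+z. F (g (U \<omega>)) z \<partial>step_law) \<partial>M)"
  proof (rule nn_integral_distr[OF Um])
    interpret sl: prob_space step_law by (rule prob_space_step_law)
    have "sets (N \<Otimes>\<^sub>M step_law) = sets (N \<Otimes>\<^sub>M borel)" by (intro sets_pair_measure_cong) auto
    then have "case_prod F \<in> borel_measurable (N \<Otimes>\<^sub>M step_law)"
      using F by (simp cong: measurable_cong_sets)
    then have "(\<lambda>v. \<integral>\<^sup>+z. F v z \<partial>step_law) \<in> borel_measurable N"
      by (rule sl.borel_measurable_nn_integral)
    from measurable_compose[OF g this]
    show "(\<lambda>u. \<integral>\<^sup>+z. F (g u) z \<partial>step_law) \<in> borel_measurable (distr M ?P U)" by simp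
  qed
  also have "\<dots> = (\<integral>\<^sup>+\<omega>. (\<integral>\<^sup>+z. F (V \<omega>) z \<partial>step_law) \<partial>M)"
    by (intro nn_integral_cong) (simp add: V U_def)
  finally show ?thesis .
qed

lemma nn_integral_Zsum_step:
  assumes F: "(\<lambda>(x, z). F x z) \<in> borel_measurable (borel \<Otimes>\<^sub>M borel)"
  shows "(\<integral>\<^sup>+\<omega>. F (Zsum n \<omega>) (Z (Suc n) \<omega>) \<partial>M) = (\<integral>\<^sup>+x. (\<integral>\<^sup>+z. F x z \<partial>step_law) \<partial>law n)"
proof -
  interpret sl: prob_space step_law by (rule prob_space_step_law)
  have "(\<integral>\<^sup>+\<omega>. F (Zsum n \<omega>) (Z (Suc n) \<omega>) \<partial>M) = (\<integral>\<^sup>+\<omega>. (\<integral>\<^sup>+z. F (Zsum n \<omega>) z \<partial>step_law) \<partial>M)"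
    by (rule nn_integral_past_step[where g = "\<lambda>f. \<Sum>i=1..n. f i" and N = borel])
      (use F in \<open>auto simp: Zsum_def intro!: borel_measurable_sum measurable_component_singleton\<close>)
  also have "\<dots> = (\<integral>\<^sup>+x. (\<integral>\<^sup>+z. F x z \<partial>step_law) \<partial>law n)"
  proof (rule nn_integral_law[symmetric])
    have "sets (borel \<Otimes>\<^sub>M step_law) = sets (borel \<Otimes>\<^sub>M (borel :: (real \<times> 'a) measure))"
      by (intro sets_pair_measure_cong) auto
    then have "(\<lambda>(x, z). F x z) \<in> borel_measurable (borel \<Otimes>\<^sub>M step_law)"
      using F by (simp cong: measurable_cong_sets)
    then show "(\<lambda>x. \<integral>\<^sup>+z. F x z \<partial>step_law) \<in> borel_measurable borel"
      by (rule sl.borel_measurable_nn_integral)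
  qed
  finally show ?thesis .
qed

section \<open>Convolution and supermultiplicativity of the laws\<close>

lemma nn_integral_law_Suc:
  assumes [measurable]: "f \<in> borel_measurable borel"
  shows "(\<integral>\<^sup>+x. f x \<partial>law (Suc n)) = (\<integral>\<^sup>+x. (\<integral>\<^sup>+z. f (x + z) \<partial>step_law) \<partial>law n)"
proof -
  have "(\<integral>\<^sup>+x. f x \<partial>law (Suc n)) = (\<integral>\<^sup>+\<omega>. f (Zsum n \<omega> + Z (Suc n) \<omega>) \<partial>M)"
    by (subst nn_integral_law) (auto simp: Zsum_Suc)
  also have "\<dots> = (\<integral>\<^sup>+x. (\<integral>\<^sup>+z. f (x + z) \<partial>step_law) \<partial>law n)"
    by (rule nn_integral_Zsum_step) measurable
  finally show ?thesis .
qed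

lemma law_0: "law 0 = return borel 0"
proof (rule measure_eqI)
  fix A assume A: "A \<in> sets (law 0)"
  then show "emeasure (law 0) A = emeasure (return borel 0) A"
    by (subst emeasure_law) (auto simp: emeasure_space_1 indicator_def)
qed simp

lemma nn_integral_law_add:
  assumes [measurable]: "f \<in> borel_measurable borel"
  shows "(\<integral>\<^sup>+x. f x \<partial>law (n + m)) = (\<integral>\<^sup>+x. (\<integral>\<^sup>+y. f (x + y) \<partial>law m) \<partial>law n)"
  using assms
proof (induction m arbitrary: f)
  case 0
  note [measurable] = 0
  show ?case by (simp add: law_0 nn_integral_return)
next
  case (Suc m)
  note [measurable] = Suc.prems
  interpret sl: prob_space step_law by (rule prob_space_step_law)
  have "(\<integral>\<^sup>+x. f x \<partial>law (n + Suc m)) = (\<integral>\<^sup>+x. (\<integral>\<^sup>+z. f (x + z) \<partial>step_law) \<partial>law (n + m))"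
    by (simp add: nn_integral_law_Suc)
  also have "\<dots> = (\<integral>\<^sup>+x. (\<integral>\<^sup>+y. (\<integral>\<^sup>+z. f (x + y + z) \<partial>step_law) \<partial>law m) \<partial>law n)"
    by (rule Suc.IH) measurable
  also have "\<dots> = (\<integral>\<^sup>+x. (\<integral>\<^sup>+y. f (x + y) \<partial>law (Suc m)) \<partial>law n)"
    by (intro nn_integral_cong) (simp add: nn_integral_law_Suc add.assoc)
  finally show ?case .
qed

lemma nn_integral_law_supermult:
  assumes [measurable]: "f \<in> borel_measurable borel" "g \<in> borel_measurable borel" "h \<in> borel_measurable borel"
    and le: "\<And>x y. g x * h y \<le> f (x + y)"
  shows "(\<integral>\<^sup>+x. g x \<partial>law n) * (\<integral>\<^sup>+x. h x \<partial>law m) \<le> (\<integral>\<^sup>+x. f x \<partial>law (n + m))"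
proof -
  have "(\<integral>\<^sup>+x. g x \<partial>law n) * (\<integral>\<^sup>+x. h x \<partial>law m) = (\<integral>\<^sup>+x. (\<integral>\<^sup>+y. g x * h y \<partial>law m) \<partial>law n)"
    by (simp add: nn_integral_cmult nn_integral_multc)
  also have "\<dots> \<le> (\<integral>\<^sup>+x. (\<integral>\<^sup>+y. f (x + y) \<partial>law m) \<partial>law n)"
    by (intro nn_integral_mono le)
  finally show ?thesis by (simp add: nn_integral_law_add)
qed

lemma emeasure_law_supermult:
  assumes "A \<in> sets borel" "B \<in> sets borel" "C \<in> sets borel"
    and "\<And>x y. x \<in> A \<Longrightarrow> y \<in> B \<Longrightarrow> x + y \<in> C"
  shows "emeasure (law n) A * emeasure (law m) B \<le> emeasure (law (n + m)) C"
proof -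
  have "(\<integral>\<^sup>+x. indicator A x \<partial>law n) * (\<integral>\<^sup>+x. indicator B x \<partial>law m) \<le> (\<integral>\<^sup>+x. indicator C x \<partial>law (n + m))"
    by (rule nn_integral_law_supermult) (use assms in \<open>auto simp: indicator_def\<close>)
  then show ?thesis using assms by simp
qed

text \<open>One block of \<open>n\<close> steps is split off at a time. The condition on
  \<open>f 0\<close> starts the induction, as \<open>law 0\<close> is the unit mass at 0.\<close>

lemma nn_integral_law_power:
  assumes [measurable]: "\<And>k. f k \<in> borel_measurable borel"
    and le: "\<And>k x y. f k x * f 1 y \<le> f (Suc k) (x + y)"
    and "f 0 0 \<ge> (1::ennreal)"
  shows "(\<integral>\<^sup>+x. f 1 x \<partial>law n) ^ k \<le> (\<integral>\<^sup>+x. f k x \<partial>law (n * k))"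
proof (induction k)
  case 0
  have "(\<integral>\<^sup>+x. f 0 x \<partial>law (n * 0)) = f 0 0" by (simp add: law_0 nn_integral_return)
  then show ?case using \<open>f 0 0 \<ge> 1\<close> by simp
next
  case (Suc k)
  have "(\<integral>\<^sup>+x. f 1 x \<partial>law n) ^ Suc k \<le> (\<integral>\<^sup>+x. f k x \<partial>law (n * k)) * (\<integral>\<^sup>+x. f 1 x \<partial>law n)"
    using Suc by (simp add: mult.commute mult_left_mono)
  also have "\<dots> \<le> (\<integral>\<^sup>+x. f (Suc k) x \<partial>law (n * k + n))"
    by (rule nn_integral_law_supermult) (use le in auto)
  finally show ?case by (simp add: add.commute)
qed

text \<open>Serves the lower bound: after the partial sum has reached \<open>A\<close>, either one
  long waiting time (m = 1) or \<open>m\<close> moderate steps follow, and the probability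
  factorises.\<close>

lemma emeasure_past_block:
  assumes [measurable]: "A \<in> sets borel" "B \<in> sets borel"
  shows "emeasure M {\<omega>\<in>space M. Zsum n \<omega> \<in> A \<and> (\<forall>i\<in>{n<..n+m}. Z i \<omega> \<in> B)}
    = emeasure (law n) A * emeasure step_law B ^ m"
proof (induction m)
  case 0
  show ?case by (simp add: emeasure_law)
next
  case (Suc m)
  define V where "V \<omega> = (indicator {\<omega>. Zsum n \<omega> \<in> A \<and> (\<forall>i\<in>{n<..n+m}. Z i \<omega> \<in> B)} \<omega> :: ennreal)" for \<omega>
  \<comment> \<open>Writing the event as a product of indicators of coordinates makes its
    measurability on the product space evident.\<close>
  define g where "g f = (indicator A (\<Sum>i=1..n. f i) * (\<Prod>i\<in>{n<..n+m}. indicator B (f i)) :: ennreal)" for f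
  have Vm: "{\<omega>\<in>space M. Zsum n \<omega> \<in> A \<and> (\<forall>i\<in>{n<..n+k}. Z i \<omega> \<in> B)} \<in> sets M" for k
  proof -
    have "{\<omega>\<in>space M. Zsum n \<omega> \<in> A} \<inter> {\<omega>\<in>space M. \<forall>i\<in>{n<..n+k}. Z i \<omega> \<in> B} \<in> sets M"
    proof (intro sets.Int sets.sets_Collect_finite_All)
      show "{\<omega>\<in>space M. Z i \<omega> \<in> B} \<in> sets M" if "i \<in> {n<..n+k}" for i
      proof -
        have [measurable]: "Z i \<in> borel_measurable M" using that by (intro Z_measurable) auto
        show ?thesis by measurable
      qed
    qed auto
    moreover have "{\<omega>\<in>space M. Zsum n \<omega> \<in> A} \<inter> {\<omega>\<in>space M. \<forall>i\<in>{n<..n+k}. Z i \<omega> \<in> B}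
      = {\<omega>\<in>space M. Zsum n \<omega> \<in> A \<and> (\<forall>i\<in>{n<..n+k}. Z i \<omega> \<in> B)}" by auto
    ultimately show ?thesis by simp
  qed
  have V_eq: "V \<omega> = indicator {\<omega>\<in>space M. Zsum n \<omega> \<in> A \<and> (\<forall>i\<in>{n<..n+m}. Z i \<omega> \<in> B)} \<omega>"
    if "\<omega> \<in> space M" for \<omega> using that by (auto simp: V_def indicator_def)
  have gm: "g \<in> measurable (PiM {1..n+m} (\<lambda>_. borel)) borel"
  proof -
    have [measurable]: "(\<lambda>f. f i) \<in> measurable (PiM {1..n+m} (\<lambda>_. borel :: (real \<times> 'a) measure)) borel"
      if "i \<in> {1..n+m}" for i using that by (rule measurable_component_singleton)
    have sum_m: "(\<lambda>f. \<Sum>i=1..n. f i) \<in> measurable (PiM {1..n+m} (\<lambda>_. borel :: (real \<times> 'a) measure)) borel"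
      by (intro borel_measurable_sum measurable_component_singleton) auto
    have "(\<lambda>f. indicator A (\<Sum>i=1..n. f i) :: ennreal) \<in> borel_measurable (PiM {1..n+m} (\<lambda>_. borel))"
      by (rule measurable_compose[OF sum_m]) simp
    moreover have "(\<lambda>f. indicator B (f i) :: ennreal) \<in> borel_measurable (PiM {1..n+m} (\<lambda>_. borel))"
      if "i \<in> {n<..n+m}" for i
      using that by (intro measurable_compose[OF measurable_component_singleton[of i]]) auto
    ultimately show ?thesis unfolding g_def[abs_def]
      by (intro borel_measurable_times_ennreal borel_measurable_prod_ennreal)
  qed
  have Vg: "V \<omega> = g (\<lambda>i\<in>{1..n+m}. Z i \<omega>)" for \<omega>
  proof -
    have "(\<Sum>i=1..n. (\<lambda>i\<in>{1..n+m}. Z i \<omega>) i) = Zsum n \<omega>" unfolding Zsum_def by (intro sum.cong) auto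
    moreover have "(\<Prod>i\<in>{n<..n+m}. indicator B ((\<lambda>i\<in>{1..n+m}. Z i \<omega>) i)) =
      (\<Prod>i\<in>{n<..n+m}. indicator B (Z i \<omega>) :: ennreal)" by (intro prod.cong) auto
    moreover have "(\<Prod>i\<in>{n<..n+m}. indicator B (Z i \<omega>) :: ennreal) = (if \<forall>i\<in>{n<..n+m}. Z i \<omega> \<in> B then 1 else 0)"
      by (auto simp: indicator_def intro!: prod.neutral)
    ultimately show ?thesis by (simp add: V_def g_def indicator_def)
  qed
  have "emeasure M {\<omega>\<in>space M. Zsum n \<omega> \<in> A \<and> (\<forall>i\<in>{n<..n+Suc m}. Z i \<omega> \<in> B)}
    = (\<integral>\<^sup>+\<omega>. indicator {\<omega>\<in>space M. Zsum n \<omega> \<in> A \<and> (\<forall>i\<in>{n<..n+Suc m}. Z i \<omega> \<in> B)} \<omega> \<partial>M)"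
    using Vm[of "Suc m"] by simp
  also have "\<dots> = (\<integral>\<^sup>+\<omega>. V \<omega> * indicator B (Z (Suc (n + m)) \<omega>) \<partial>M)"
  proof (rule nn_integral_cong)
    fix \<omega> assume "\<omega> \<in> space M"
    moreover have "{n<..n+Suc m} = insert (Suc (n+m)) {n<..n+m}" by auto
    ultimately show "indicator {\<omega>\<in>space M. Zsum n \<omega> \<in> A \<and> (\<forall>i\<in>{n<..n+Suc m}. Z i \<omega> \<in> B)} \<omega>
       = V \<omega> * (indicator B (Z (Suc (n + m)) \<omega>) :: ennreal)"
      by (auto simp: V_def indicator_def)
  qed
  also have "\<dots> = (\<integral>\<^sup>+\<omega>. (\<integral>\<^sup>+z. V \<omega> * indicator B z \<partial>step_law) \<partial>M)"
    by (rule nn_integral_past_step[OF gm Vg]) measurable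
  also have "\<dots> = (\<integral>\<^sup>+\<omega>. V \<omega> * emeasure step_law B \<partial>M)"
    by (intro nn_integral_cong) (simp add: nn_integral_cmult_indicator)
  also have "\<dots> = (\<integral>\<^sup>+\<omega>. indicator {\<omega>\<in>space M. Zsum n \<omega> \<in> A \<and> (\<forall>i\<in>{n<..n+m}. Z i \<omega> \<in> B)} \<omega> * emeasure step_law B \<partial>M)"
    by (intro nn_integral_cong) (simp add: V_eq)
  also have "\<dots> = emeasure M {\<omega>\<in>space M. Zsum n \<omega> \<in> A \<and> (\<forall>i\<in>{n<..n+m}. Z i \<omega> \<in> B)} * emeasure step_law B"
    using Vm[of m] by (subst nn_integral_multc) auto
  finally show ?case by (simp only: Suc power_Suc2 mult.assoc)
qed

end


section \<open>Exponential bounds for partial sums\<close>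

text \<open>Finite Borel measures on a separable Banach space are inner regular. Closed convex hulls
  of finite unions of compact sets, with 0 adjoined, are still compact by Mazur's theorem and
  increase with \<open>m\<close>.\<close>

lemma compact_convex_exhaustion:
  fixes N :: "'a::{banach, second_countable_topology} measure"
  assumes sets: "sets N = sets borel" and fin: "emeasure N (space N) \<noteq> \<infinity>"
  obtains K :: "nat \<Rightarrow> 'a set"
  where "\<And>m. compact (K m)" "\<And>m. convex (K m)" "\<And>m. 0 \<in> K m" "incseq K" "AE x in N. \<exists>m. x \<in> K m"
proof -
  have sp: "space N = UNIV" using sets_eq_imp_space_eq[OF sets] by simp
  interpret finite_measure N by standard (use fin in simp)
  have "\<exists>C. compact C \<and> measure N (UNIV - C) < 1 / real (Suc m)" for m
  proof (cases "emeasure N UNIV = 0")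
    case True
    then show ?thesis by (intro exI[of _ "{}"]) (simp add: measure_def)
  next
    case False
    have reg: "emeasure N UNIV = (SUP K \<in> {K. K \<subseteq> UNIV \<and> compact K}. emeasure N K)"
      by (rule inner_regular[OF sets fin]) simp
    have "measure N UNIV > 0" using False sp by (simp add: emeasure_eq_measure zero_less_measure_iff)
    then have "ennreal (measure N UNIV - 1 / real (Suc m)) < emeasure N UNIV"
      by (simp add: emeasure_eq_measure ennreal_less_iff ennreal_lessI)
    then obtain C where C: "compact C" "ennreal (measure N UNIV - 1 / real (Suc m)) < emeasure N C"
      unfolding reg less_SUP_iff by auto
    have "measure N UNIV - 1 / real (Suc m) < measure N C"
      using C(2) unfolding emeasure_eq_measure
      by (metis ennreal_leI measure_nonneg not_less)
    moreover have "measure N (UNIV - C) = measure N UNIV - measure N C"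
      using finite_measure_compl[of C] C(1) sp sets by (simp add: compact_imp_closed)
    ultimately show ?thesis using C(1) by (intro exI[of _ C]) auto
  qed
  then obtain C where C: "\<And>m. compact (C m)" "\<And>m. measure N (UNIV - C m) < 1 / real (Suc m)"
    by metis
  define K where "K m = closure (convex hull (insert 0 (\<Union>i\<le>m. C i)))" for m
  have "compact (K m)" for m
    unfolding K_def by (intro compact_closure_convex_hull compact_insert compact_UN C) auto
  moreover have "convex (K m)" for m unfolding K_def by (simp add: convex_closure convex_convex_hull)
  moreover have sub: "insert 0 (\<Union>i\<le>m. C i) \<subseteq> K m" for m
    unfolding K_def by (rule order_trans[OF hull_subset closure_subset])
  then have "0 \<in> K m" for m by blast
  moreover have "incseq K"
    unfolding incseq_def K_def by (intro allI impI closure_mono hull_mono insert_mono UN_mono) auto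
  \<comment> \<open>A point missed by every \<open>K m\<close> lies in all complements
    \<open>UNIV - C m\<close>, whose measures tend to 0.\<close>
  moreover have "AE x in N. \<exists>m. x \<in> K m"
  proof (rule AE_I')
    have Km: "UNIV - C m \<in> sets N" for m using C(1) sets by (simp add: compact_imp_closed)
    have "measure N (\<Inter>m. UNIV - C m) = 0"
    proof (rule antisym[OF field_le_epsilon])
      fix e :: real assume "e > 0"
      then obtain m where m: "1 / real (Suc m) < e" using nat_approx_posE by metis
      have "measure N (\<Inter>m. UNIV - C m) \<le> measure N (UNIV - C m)"
        by (intro finite_measure_mono Km) auto
      with C(2)[of m] m show "measure N (\<Inter>m. UNIV - C m) \<le> 0 + e" by linarith
    qed simp
    then show "(\<Inter>m. UNIV - C m) \<in> null_sets N"
      using Km sets.countable_INT[where A = "\<lambda>m. UNIV - C m" and X = UNIV and M = N]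
      by (simp only: null_sets_def emeasure_eq_measure mem_Collect_eq ennreal_0) blast
    show "{x \<in> space N. \<nexists>m. x \<in> K m} \<subseteq> (\<Inter>m. UNIV - C m)" using sub by blast
  qed
  ultimately show thesis by (rule that)
qed

lemma nn_integral_le_of_exhaustion:
  assumes "f \<in> borel_measurable N" "\<And>m. K m \<in> sets N" "incseq K" "AE x in N. \<exists>m. x \<in> K m"
    and le: "\<And>m. (\<integral>\<^sup>+x. f x * indicator (K m) x \<partial>N) \<le> c"
  shows "(\<integral>\<^sup>+x. f x \<partial>N) \<le> c"
proof -
  note [measurable] = assms(1,2)
  have "(\<integral>\<^sup>+x. f x \<partial>N) = (\<integral>\<^sup>+x. (SUP m. f x * indicator (K m) x) \<partial>N)"
  proof (rule nn_integral_cong_AE)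
    show "AE x in N. f x = (SUP m. f x * indicator (K m) x)"
      using assms(4)
    proof eventually_elim
      case (elim x)
      then obtain m where "x \<in> K m" by blast
      then have "f x \<le> (SUP m. f x * indicator (K m) x)"
        by (intro SUP_upper2[of m]) auto
      moreover have "(SUP m. f x * indicator (K m) x) \<le> f x"
        by (intro SUP_least) (auto simp: indicator_def)
      ultimately show ?case by (rule antisym)
    qed
  qed
  also have "\<dots> = (SUP m. \<integral>\<^sup>+x. f x * indicator (K m) x \<partial>N)"
    using assms(3) by (intro nn_integral_monotone_convergence_SUP)
      (auto simp: incseq_def le_fun_def indicator_def)
  also have "\<dots> \<le> c" by (intro SUP_least le)
  finally show ?thesis .
qed

text \<open>A constant factor disappears on taking k-th roots: powers of a ratio above 1 would
  outgrow it.\<close>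

lemma le_of_power_le:
  fixes r q :: real
  assumes "0 \<le> r" "0 < q" "\<And>k. k \<ge> 1 \<Longrightarrow> r ^ k \<le> c * q ^ k"
  shows "r \<le> q"
proof (rule ccontr)
  assume "\<not> r \<le> q"
  then have "1 < r / q" using assms(2) by simp
  then obtain k where k: "max c 1 < (r / q) ^ k" using real_arch_pow by blast
  then have "k \<ge> 1" by (cases k) auto
  from assms(3)[OF this] have "(r / q) ^ k \<le> c"
    using assms(2) by (simp add: power_divide field_simps)
  with k show False by simp
qed

lemma ennreal_le_of_power_le:
  fixes p :: ennreal
  assumes "0 < q" "\<And>k. k \<ge> 1 \<Longrightarrow> p ^ k \<le> ennreal (c * q ^ k)"
  shows "p \<le> ennreal q"
proof -
  \<comment> \<open>The case k = 1 makes \<open>p\<close> finite, so that it may be treated as a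
    real number.\<close>
  have "p ^ 1 \<le> ennreal (c * q ^ 1)" by (rule assms(2)) simp
  then have "p < \<infinity>" by (auto simp: top_unique less_top[symmetric] intro: le_less_trans)
  then obtain r where r: "p = ennreal r" "r \<ge> 0" by (cases p) auto
  have "r \<le> q"
  proof (rule le_of_power_le[OF r(2) assms(1), of "max c 0"])
    fix k :: nat assume "k \<ge> 1"
    then have "ennreal (r ^ k) \<le> ennreal (c * q ^ k)"
      using assms(2)[of k] r by (simp add: ennreal_power)
    also have "\<dots> \<le> ennreal (max c 0 * q ^ k)"
      using assms(1) by (intro ennreal_leI mult_right_mono) auto
    finally show "r ^ k \<le> max c 0 * q ^ k" using assms(1) by (subst (asm) ennreal_le_iff) auto
  qed
  then show ?thesis using r by (simp add: ennreal_leI)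
qed

lemma convex_add_divideR:
  fixes D :: "'b::real_vector set"
  assumes "convex D" "x /\<^sub>R a \<in> D" "y /\<^sub>R b \<in> D" "0 < a" "0 < b"
  shows "(x + y) /\<^sub>R (a + b) \<in> D"
proof -
  have "(a / (a + b)) *\<^sub>R (x /\<^sub>R a) + (b / (a + b)) *\<^sub>R (y /\<^sub>R b) \<in> D"
    using assms by (intro convexD) (auto simp flip: add_divide_distrib)
  also have "(a / (a + b)) *\<^sub>R (x /\<^sub>R a) + (b / (a + b)) *\<^sub>R (y /\<^sub>R b) = (x + y) /\<^sub>R (a + b)"
    using assms(4,5) by (simp add: scaleR_add_right field_simps)
  finally show ?thesis .
qed

lemma sets_divideR_borel [measurable]:
  fixes D :: "'b::real_normed_vector set"
  assumes "D \<in> sets borel"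
  shows "{x. x /\<^sub>R t \<in> D} \<in> sets borel"
proof -
  have "(\<lambda>x::'b. x /\<^sub>R t) \<in> borel_measurable borel"
    by (intro borel_measurable_continuous_onI continuous_intros)
  from measurable_sets[OF this assms] show ?thesis by (simp add: vimage_def)
qed

lemma borel_measurable_bounded_linear:
  "bounded_linear f \<Longrightarrow> f \<in> borel_measurable borel"
  by (intro borel_measurable_continuous_onI linear_continuous_on)

context renewal
begin

text \<open>If each of \<open>k\<close> blocks of \<open>n\<close> steps ends in t D, their sum lies
  in (k t) D by convexity, and the exponential weight is multiplicative.\<close>

lemma law_power:
  fixes \<theta> :: "real \<times> 'a \<Rightarrow> real"
  assumes \<theta>: "bounded_linear \<theta>" and D: "convex D" "D \<in> sets borel" and t: "t > 0" and k: "k \<ge> 1"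
  shows "(\<integral>\<^sup>+x. ennreal (exp (\<theta> x)) * indicator {x. x /\<^sub>R t \<in> D} x \<partial>law n) ^ k
    \<le> (\<integral>\<^sup>+x. ennreal (exp (\<theta> x)) * indicator {x. x /\<^sub>R (real k * t) \<in> D} x \<partial>law (n * k))"
proof -
  interpret \<theta>: bounded_linear \<theta> by (rule \<theta>)
  note [measurable] = borel_measurable_bounded_linear[OF \<theta>] D(2)
  \<comment> \<open>For k = 0 the scaled condition would say that 0 lies in \<open>D\<close>, since
    dividing by 0 yields 0; the singleton that carries \<open>law 0\<close> takes its place.\<close>
  define f where "f k x = ennreal (exp (\<theta> x)) *
    indicator (if k = 0 then {0} else {x. x /\<^sub>R (real k * t) \<in> D}) x" for k :: nat and x
  have "(\<integral>\<^sup>+x. f 1 x \<partial>law n) ^ k \<le> (\<integral>\<^sup>+x. f k x \<partial>law (n * k))"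
  proof (rule nn_integral_law_power)
    have [measurable]: "(if k = 0 then {0} else {x. x /\<^sub>R (real k * t) \<in> D}) \<in> sets borel" for k :: nat
      using sets_divideR_borel[OF D(2)] by auto
    show "f k \<in> borel_measurable borel" for k
      unfolding f_def by measurable
    show "f k x * f 1 y \<le> f (Suc k) (x + y)" for k x y
    proof (cases "f k x * f 1 y = 0")
      case False
      have "(x + y) /\<^sub>R (real (Suc k) * t) \<in> D"
      proof (cases "k = 0")
        case True
        then show ?thesis using False by (auto simp: f_def indicator_def split: if_splits)
      next
        case k: False
        then have "x /\<^sub>R (real k * t) \<in> D" "y /\<^sub>R t \<in> D"
          using False by (auto simp: f_def indicator_def split: if_splits)
        then have "(x + y) /\<^sub>R (real k * t + t) \<in> D"
          using t k by (intro convex_add_divideR[OF D(1)]) auto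
        then show ?thesis by (simp add: algebra_simps)
      qed
      then have "f (Suc k) (x + y) = ennreal (exp (\<theta> x)) * ennreal (exp (\<theta> y))"
        by (simp add: f_def \<theta>.add exp_add ennreal_mult)
      moreover have "f k x \<le> ennreal (exp (\<theta> x))" "f 1 y \<le> ennreal (exp (\<theta> y))"
        by (auto simp: f_def indicator_def)
      ultimately show ?thesis by (simp add: mult_mono)
    next
      case True
      then show ?thesis by (simp only: zero_le)
    qed
    show "1 \<le> f 0 0" by (simp add: f_def)
  qed
  then show ?thesis using k by (simp add: f_def)
qed

lemma emeasure_law_power:
  assumes D: "convex D" "D \<in> sets borel" and t: "t > 0" and k: "k \<ge> 1"
  shows "emeasure (law n) {x. x /\<^sub>R t \<in> D} ^ k \<le> emeasure (law (n * k)) {x. x /\<^sub>R (real k * t) \<in> D}"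
  using law_power[OF bounded_linear_zero D t k, of n] sets_divideR_borel[OF D(2)]
  by (simp del: inverse_mult_distrib)

text \<open>
  For compact convex \<open>K\<close>, the nth power of the exponential integral over \<open>K\<close> is at most the
  exponential integral of the law of the nth partial sum over \<open>n K\<close>, which finitely many of the
  local bounds control.
\<close>

lemma mgf_le_1_of_local_bounds:
  fixes \<theta> :: "real \<times> 'a \<Rightarrow> real"
  assumes \<theta>: "bounded_linear \<theta>"
    and loc: "\<And>z e. e > 0 \<Longrightarrow> \<exists>U. open U \<and> z \<in> U \<and>
      (\<forall>n\<ge>1. emeasure (law n) {x. x /\<^sub>R real n \<in> U} \<le> ennreal (exp (- real n * (\<theta> z - e))))"
  shows "(\<integral>\<^sup>+z. ennreal (exp (\<theta> z)) \<partial>step_law) \<le> 1"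
proof -
  interpret \<theta>: bounded_linear \<theta> by (rule \<theta>)
  note [measurable] = borel_measurable_bounded_linear[OF \<theta>]
  have cont: "continuous_on UNIV \<theta>" using \<theta> by (rule linear_continuous_on)
  interpret sl: prob_space step_law by (rule prob_space_step_law)
  have compact_case: "(\<integral>\<^sup>+z. ennreal (exp (\<theta> z)) * indicator K z \<partial>step_law) \<le> 1" (is "?p \<le> 1")
    if K: "compact K" "convex K" for K
  proof (rule ennreal_le_epsilon)
    fix e' :: real assume e': "e' > 0"
    \<comment> \<open>Two errors of size \<open>e\<close> occur, one in the local bound and one in
      the variation of \<open>\<theta>\<close> on the neighbourhood; together they cost the factor
      exp (2 e) = 1 + e'.\<close>
    define e where "e = ln (1 + e') / 2"
    have e: "e > 0" "exp (2 * e) = 1 + e'" using e' by (auto simp: e_def)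
    have Kb [measurable]: "K \<in> sets borel" using K(1) by (simp add: compact_imp_closed)
    obtain U where U: "\<And>z. open (U z)" "\<And>z. z \<in> U z"
      "\<And>z n. n \<ge> 1 \<Longrightarrow> emeasure (law n) {x. x /\<^sub>R real n \<in> U z} \<le> ennreal (exp (- real n * (\<theta> z - e)))"
      using loc[OF e(1)] by metis
    define V where "V z = U z \<inter> {x. \<theta> x < \<theta> z + e}" for z
    have V: "open (V z)" "z \<in> V z" for z
      unfolding V_def using U(1,2)[of z] e by (auto intro!: open_Int open_Collect_less cont simp del: split_paired_All)
    obtain F where F: "finite F" "K \<subseteq> (\<Union>z\<in>F. V z)"
      using compactE_image[OF K(1), of K V] V by (metis UN_I subsetI)
    show "?p \<le> 1 + ennreal e'"
    proof -
      have "?p \<le> ennreal (exp (2 * e))"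
      proof (rule ennreal_le_of_power_le[where c = "real (card F)"])
        fix k :: nat assume k: "k \<ge> 1"
        have V_bound: "(\<integral>\<^sup>+x. ennreal (exp (\<theta> x)) * indicator {x. x /\<^sub>R real k \<in> V z} x \<partial>law k) \<le> ennreal (exp (2 * e) ^ k)" for z
        proof -
          have "(\<integral>\<^sup>+x. ennreal (exp (\<theta> x)) * indicator {x. x /\<^sub>R real k \<in> V z} x \<partial>law k)
            \<le> (\<integral>\<^sup>+x. ennreal (exp (real k * (\<theta> z + e))) * indicator {x. x /\<^sub>R real k \<in> U z} x \<partial>law k)"
          proof (rule nn_integral_mono)
            fix x
            have "\<theta> x \<le> real k * (\<theta> z + e)" if "x /\<^sub>R real k \<in> V z"
              using that k by (auto simp: V_def \<theta>.scaleR field_simps)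
            then show "ennreal (exp (\<theta> x)) * indicator {x. x /\<^sub>R real k \<in> V z} x
              \<le> ennreal (exp (real k * (\<theta> z + e))) * indicator {x. x /\<^sub>R real k \<in> U z} x"
              by (auto simp: indicator_def V_def intro!: ennreal_leI)
          qed
          also have "\<dots> = ennreal (exp (real k * (\<theta> z + e))) * emeasure (law k) {x. x /\<^sub>R real k \<in> U z}"
            using U(1) by (intro nn_integral_cmult_indicator) (simp add: sets_divideR_borel)
          also have "\<dots> \<le> ennreal (exp (real k * (\<theta> z + e))) * ennreal (exp (- real k * (\<theta> z - e)))"
            by (intro mult_left_mono U(3)[OF k]) simp
          also have "\<dots> = ennreal (exp (real k * (\<theta> z + e) + - real k * (\<theta> z - e)))"
            by (simp only: exp_add ennreal_mult exp_ge_zero)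
          also have "real k * (\<theta> z + e) + - real k * (\<theta> z - e) = real k * (2 * e)" by (simp add: algebra_simps)
          finally show ?thesis by (simp add: exp_of_nat_mult)
        qed
        have [measurable]: "{x. x /\<^sub>R real k \<in> V z} \<in> sets borel" for z
          using V by (simp add: sets_divideR_borel)
        have "?p ^ k \<le> (\<integral>\<^sup>+x. ennreal (exp (\<theta> x)) * indicator {x. x /\<^sub>R real k \<in> K} x \<partial>law k)"
          using law_power[OF \<theta> K(2) Kb, of 1 k 1] k by (simp add: law_1[simplified])
        also have "\<dots> \<le> (\<integral>\<^sup>+x. (\<Sum>z\<in>F. ennreal (exp (\<theta> x)) * indicator {x. x /\<^sub>R real k \<in> V z} x) \<partial>law k)"
        proof (rule nn_integral_mono)
          fix x
          show "ennreal (exp (\<theta> x)) * indicator {x. x /\<^sub>R real k \<in> K} x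
            \<le> (\<Sum>z\<in>F. ennreal (exp (\<theta> x)) * indicator {x. x /\<^sub>R real k \<in> V z} x)"
          proof (cases "x /\<^sub>R real k \<in> K")
            case True
            then obtain z where z: "z \<in> F" "x /\<^sub>R real k \<in> V z" using F by blast
            have "ennreal (exp (\<theta> x)) * indicator {x. x /\<^sub>R real k \<in> V z} x
              \<le> (\<Sum>z\<in>F. ennreal (exp (\<theta> x)) * indicator {x. x /\<^sub>R real k \<in> V z} x)"
              using z(1) F(1) by (intro member_le_sum) auto
            then show ?thesis using True z by simp
          qed simp
        qed
        also have "\<dots> = (\<Sum>z\<in>F. \<integral>\<^sup>+x. ennreal (exp (\<theta> x)) * indicator {x. x /\<^sub>R real k \<in> V z} x \<partial>law k)"
          by (rule nn_integral_sum) measurable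
        also have "\<dots> \<le> (\<Sum>z\<in>F. ennreal (exp (2 * e) ^ k))" by (intro sum_mono V_bound)
        also have "\<dots> = ennreal (real (card F) * exp (2 * e) ^ k)"
          by (simp add: ennreal_mult ennreal_of_nat_eq_real_of_nat)
        finally show "?p ^ k \<le> ennreal (real (card F) * exp (2 * e) ^ k)" .
      qed simp
      then show ?thesis using e e' by simp
    qed
  qed
  obtain K :: "nat \<Rightarrow> (real \<times> 'a) set" where K: "\<And>m. compact (K m)" "\<And>m. convex (K m)" "incseq K"
    "AE x in step_law. \<exists>m. x \<in> K m"
  proof (rule compact_convex_exhaustion[OF sets_step_law])
    show "emeasure step_law (space step_law) \<noteq> \<infinity>" by (simp add: sl.emeasure_space_1)
  qed auto
  show ?thesis
  proof (rule nn_integral_le_of_exhaustion[OF _ _ K(3,4) compact_case[OF K(1,2)]])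
    show "K m \<in> sets step_law" for m using K(1)[of m] by (simp add: compact_imp_closed)
  qed measurable
qed

section \<open>The cone of achievable exponents\<close>

definition achievable :: "real \<times> 'a \<Rightarrow> real \<Rightarrow> bool" where
  "achievable z c \<longleftrightarrow> (\<forall>r>0. \<exists>t0. \<forall>t\<ge>t0. \<exists>n.
     ennreal (exp (- t * c)) \<le> emeasure (law n) {x. x /\<^sub>R t \<in> ball z r})"

lemma achievable_obtain:
  assumes "achievable z c" "r > 0"
  obtains t n where "t \<ge> 1" "ennreal (exp (- t * c)) \<le> emeasure (law n) {x. x /\<^sub>R t \<in> ball z r}"
proof -
  obtain t0 where "\<And>t. t \<ge> t0 \<Longrightarrow> \<exists>n. ennreal (exp (- t * c)) \<le> emeasure (law n) {x. x /\<^sub>R t \<in> ball z r}"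
    using assms unfolding achievable_def by blast
  from this[of "max t0 1"] show thesis using that[of "max t0 1"] by auto
qed

lemma achievable_nonneg:
  assumes "achievable z c" shows "0 \<le> c"
proof -
  obtain t n where tn: "t \<ge> 1" "ennreal (exp (- t * c)) \<le> emeasure (law n) {x. x /\<^sub>R t \<in> ball z 1}"
    using achievable_obtain[OF assms, of 1] by auto
  have "ennreal (exp (- t * c)) \<le> 1" using tn(2) emeasure_law_le_1 by (rule order_trans)
  then have "- t * c \<le> 0" by (simp add: ennreal_le_1)
  then show ?thesis using tn(1) by (simp add: zero_le_mult_iff)
qed

lemma achievable_0: "achievable 0 0"
  unfolding achievable_def
proof (intro allI impI)
  fix r :: real assume "r > 0"
  then have "emeasure (law 0) {x :: real \<times> 'a. x /\<^sub>R t \<in> ball 0 r} = 1" for t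
    by (subst law_0, subst emeasure_return) (auto simp: sets_divideR_borel indicator_def)
  then show "\<exists>t0. \<forall>t\<ge>t0. \<exists>n. ennreal (exp (- t * 0)) \<le> emeasure (law n) {x. x /\<^sub>R t \<in> ball 0 r}"
    by (intro exI[of _ 0] allI impI exI[of _ "0::nat"]) (simp only: mult_zero_right exp_zero ennreal_1 order_refl)
qed

text \<open>The number of summands is left free in \<open>achievable\<close> and may depend on
  \<open>t\<close>, so \<open>n + m\<close> summands serve the sum of two points on the same time
  scale. This freedom is what makes the achievable pairs a cone.\<close>

lemma achievable_add:
  assumes "achievable x c" "achievable y d"
  shows "achievable (x + y) (c + d)"
  unfolding achievable_def
proof (intro allI impI)
  fix r :: real assume r: "r > 0"
  then have r2: "r / 2 > 0" by simp
  obtain t1 where t1: "\<And>t. t \<ge> t1 \<Longrightarrow> \<exists>n. ennreal (exp (- t * c)) \<le> emeasure (law n) {z. z /\<^sub>R t \<in> ball x (r/2)}"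
    using assms(1) r2 unfolding achievable_def by blast
  obtain t2 where t2: "\<And>t. t \<ge> t2 \<Longrightarrow> \<exists>n. ennreal (exp (- t * d)) \<le> emeasure (law n) {z. z /\<^sub>R t \<in> ball y (r/2)}"
    using assms(2) r2 unfolding achievable_def by blast
  show "\<exists>t0. \<forall>t\<ge>t0. \<exists>n. ennreal (exp (- t * (c + d))) \<le> emeasure (law n) {z. z /\<^sub>R t \<in> ball (x + y) r}"
  proof (rule exI[of _ "max t1 t2"], intro allI impI)
    fix t assume t: "max t1 t2 \<le> t"
    obtain n where n: "ennreal (exp (- t * c)) \<le> emeasure (law n) {z. z /\<^sub>R t \<in> ball x (r/2)}" using t1 t by auto
    obtain m where m: "ennreal (exp (- t * d)) \<le> emeasure (law m) {z. z /\<^sub>R t \<in> ball y (r/2)}" using t2 t by auto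
    have "ennreal (exp (- t * (c + d))) = ennreal (exp (- t * c)) * ennreal (exp (- t * d))"
      by (simp add: ring_distribs exp_add exp_diff ennreal_mult[symmetric] exp_minus field_simps)
    also have "\<dots> \<le> emeasure (law n) {z. z /\<^sub>R t \<in> ball x (r/2)} * emeasure (law m) {z. z /\<^sub>R t \<in> ball y (r/2)}"
      using n m by (rule mult_mono) auto
    also have "\<dots> \<le> emeasure (law (n + m)) {z. z /\<^sub>R t \<in> ball (x + y) r}"
    proof (rule emeasure_law_supermult)
      fix u v assume "u \<in> {z. z /\<^sub>R t \<in> ball x (r/2)}" "v \<in> {z. z /\<^sub>R t \<in> ball y (r/2)}"
      then have "dist x (u /\<^sub>R t) < r/2" "dist y (v /\<^sub>R t) < r/2" by auto
      then have "dist (x + y) (u /\<^sub>R t + v /\<^sub>R t) < r"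
        using dist_triangle_add[of x y "u /\<^sub>R t" "v /\<^sub>R t"] by linarith
      then show "u + v \<in> {z. z /\<^sub>R t \<in> ball (x + y) r}" by (simp add: scaleR_add_right)
    qed (auto simp: sets_divideR_borel)
    finally show "\<exists>n. ennreal (exp (- t * (c + d))) \<le> emeasure (law n) {z. z /\<^sub>R t \<in> ball (x + y) r}" by blast
  qed
qed

lemma achievable_scale:
  assumes "achievable x c" and a: "a > 0"
  shows "achievable (a *\<^sub>R x) (a * c)"
  unfolding achievable_def
proof (intro allI impI)
  fix r :: real assume r: "r > 0"
  then have "r / a > 0" using a by simp
  then obtain t1 where t1: "\<And>t. t \<ge> t1 \<Longrightarrow> \<exists>n. ennreal (exp (- t * c)) \<le> emeasure (law n) {z. z /\<^sub>R t \<in> ball x (r/a)}"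
    using assms(1) unfolding achievable_def by blast
  show "\<exists>t0. \<forall>t\<ge>t0. \<exists>n. ennreal (exp (- t * (a * c))) \<le> emeasure (law n) {z. z /\<^sub>R t \<in> ball (a *\<^sub>R x) r}"
  proof (rule exI[of _ "max t1 1 / a"], intro allI impI)
    fix t assume t: "max t1 1 / a \<le> t"
    then have "t1 \<le> a * t" using a by (simp add: field_simps)
    then obtain n where n: "ennreal (exp (- (a * t) * c)) \<le> emeasure (law n) {z. z /\<^sub>R (a * t) \<in> ball x (r/a)}" using t1 by blast
    have "{z. z /\<^sub>R (a * t) \<in> ball x (r/a)} = {z. z /\<^sub>R t \<in> ball (a *\<^sub>R x) r}"
    proof -
      have "dist (a *\<^sub>R x) (z /\<^sub>R t) = a * dist x (z /\<^sub>R (a * t))" for z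
      proof -
        have "a *\<^sub>R x - z /\<^sub>R t = a *\<^sub>R (x - z /\<^sub>R (a * t))" using a by (simp add: scaleR_diff_right)
        then show ?thesis using a by (simp add: dist_norm)
      qed
      then show ?thesis using a by (auto simp: field_simps)
    qed
    with n show "\<exists>n. ennreal (exp (- t * (a * c))) \<le> emeasure (law n) {z. z /\<^sub>R t \<in> ball (a *\<^sub>R x) r}"
      by (auto simp: algebra_simps)
  qed
qed

text \<open>A single good time is enough: the block is repeated as often as it fits into t', which
  leaves a remainder of time shorter than \<open>t\<close>. Since c \<ge> 0, the repeated block
  costs no more than t' c, and the enlarged radius absorbs the remainder.\<close>

lemma eventually_lower_bound_of_single:
  assumes c: "0 \<le> c" and t: "t > 0" and r: "0 < r" "r < r'"
    and le: "ennreal (exp (- t * c)) \<le> emeasure (law n) {x. x /\<^sub>R t \<in> ball z r}"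
  shows "\<exists>t0. \<forall>t'\<ge>t0. \<exists>n'. ennreal (exp (- t' * c)) \<le> emeasure (law n') {x. x /\<^sub>R t' \<in> ball z r'}"
\<comment> \<open>The second term of the threshold makes the displacement caused by the remainder,
  at most \<open>t * norm z\<close>, smaller than (r' - r) t'.\<close>
proof (rule exI[of _ "max t (t * norm z / (r' - r) + 1)"], intro allI impI)
  fix t' assume t': "max t (t * norm z / (r' - r) + 1) \<le> t'"
  define q where "q = nat \<lfloor>t' / t\<rfloor>"
  define s where "s = real q * t"
  have q1: "q \<ge> 1" using t t' by (simp add: q_def le_nat_iff field_simps)
  have fl: "real q \<le> t' / t" "t' / t < real q + 1"
    using t t' by (auto simp: q_def)
  then have s: "s \<le> t'" "t' - t < s" using t by (auto simp: s_def field_simps)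
  have s0: "s > 0" using q1 t by (simp add: s_def)
  have tz: "t * norm z < (r' - r) * t'"
  proof -
    have "t * norm z / (r' - r) < t'" using t' by simp
    then show ?thesis using r by (simp add: field_simps)
  qed
  have "ennreal (exp (- t' * c)) \<le> ennreal (exp (- t * c)) ^ q"
  proof -
    have "- t' * c \<le> real q * (- t * c)"
      using mult_right_mono[OF s(1) c] by (simp add: s_def algebra_simps)
    then show ?thesis by (simp add: ennreal_power exp_of_nat_mult[symmetric] ennreal_leI)
  qed
  also have "\<dots> \<le> emeasure (law n) {x. x /\<^sub>R t \<in> ball z r} ^ q"
    by (intro power_mono le) simp
  also have "\<dots> \<le> emeasure (law (n * q)) {x. x /\<^sub>R s \<in> ball z r}"
    unfolding s_def by (rule emeasure_law_power) (use t q1 in auto)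
  also have "\<dots> \<le> emeasure (law (n * q)) {x. x /\<^sub>R t' \<in> ball z r'}"
  proof (rule emeasure_mono)
    show "{x. x /\<^sub>R s \<in> ball z r} \<subseteq> {x. x /\<^sub>R t' \<in> ball z r'}"
    proof safe
      fix x assume "x /\<^sub>R s \<in> ball z r"
      then have x: "norm (z - x /\<^sub>R s) < r" by (simp add: dist_norm)
      have t'0: "t' > 0" using s s0 by linarith
      have "t' *\<^sub>R (z - x /\<^sub>R t') = s *\<^sub>R (z - x /\<^sub>R s) + (t' - s) *\<^sub>R z"
        using s0 t'0 by (simp add: algebra_simps)
      then have "t' * norm (z - x /\<^sub>R t') = norm (s *\<^sub>R (z - x /\<^sub>R s) + (t' - s) *\<^sub>R z)"
        using t'0 by (metis abs_of_pos norm_scaleR)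
      also have "\<dots> \<le> s * norm (z - x /\<^sub>R s) + (t' - s) * norm z"
        using s s0 by (intro order_trans[OF norm_triangle_ineq]) simp
      also have "\<dots> \<le> t' * r + t * norm z"
        using s s0 x r by (intro add_mono mult_mono) auto
      also have "\<dots> < t' * r'" using tz by (simp add: algebra_simps)
      finally have "norm (z - x /\<^sub>R t') < r'" using t'0 by simp
      then show "x /\<^sub>R t' \<in> ball z r'" by (simp add: dist_norm)
    qed
  qed (simp add: sets_divideR_borel)
  finally show "\<exists>n'. ennreal (exp (- t' * c)) \<le> emeasure (law n') {x. x /\<^sub>R t' \<in> ball z r'}" by blast
qed

text \<open>Contraposition of the previous lemma: failure at arbitrarily late times becomes failure
  at all positive times, for all \<open>n\<close>, in a smaller ball. Such a bound without
  asymptotics is what the power argument for exponential moments asks for.\<close>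

lemma not_achievable_upper_bound:
  assumes "\<not> achievable z c" and c: "0 \<le> c"
  obtains r where "r > 0"
    "\<And>t n. t > 0 \<Longrightarrow> emeasure (law n) {x. x /\<^sub>R t \<in> ball z r} < ennreal (exp (- t * c))"
proof -
  obtain r where r: "r > 0" and no: "\<not> (\<exists>t0. \<forall>t\<ge>t0. \<exists>n. ennreal (exp (- t * c)) \<le> emeasure (law n) {x. x /\<^sub>R t \<in> ball z r})"
    using assms(1) unfolding achievable_def by blast
  show thesis
  proof (rule that[of "r / 2"])
    show "r / 2 > 0" using r by simp
    fix t n assume t: "(t::real) > 0"
    show "emeasure (law n) {x. x /\<^sub>R t \<in> ball z (r/2)} < ennreal (exp (- t * c))"
    proof (rule ccontr)
      assume "\<not> ?thesis"
      then have "ennreal (exp (- t * c)) \<le> emeasure (law n) {x. x /\<^sub>R t \<in> ball z (r/2)}" by simp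
      from eventually_lower_bound_of_single[OF c t _ _ this, of r] r no show False by auto
    qed
  qed
qed

text \<open>
  The set of pairs \<open>(z, c)\<close> such that \<open>c\<close> is achievable at \<open>z\<close> is a convex cone; a linear
  functional below it has exponential moment at most 1.
\<close>

lemma achievable_of_dual:
  assumes dual: "\<And>\<theta>. bounded_linear \<theta> \<Longrightarrow> (\<integral>\<^sup>+z. ennreal (exp (\<theta> z)) \<partial>step_law) \<le> 1 \<Longrightarrow> \<theta> z < A"
  shows "achievable z A"
proof (rule ccontr)
  assume no: "\<not> achievable z A"
  \<comment> \<open>The functional 0 has exponential moment 1, so the hypothesis applies to
    it.\<close>
  have A: "0 \<le> A" using dual[of "\<lambda>_. 0"] prob_space.emeasure_space_1[OF prob_space_step_law]
    by (simp add: bounded_linear_zero)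
  obtain r where r: "r > 0"
    "\<And>t n. t > 0 \<Longrightarrow> emeasure (law n) {x. x /\<^sub>R t \<in> ball z r} < ennreal (exp (- t * A))"
    using not_achievable_upper_bound[OF no A] by metis
  obtain \<theta> where \<theta>: "bounded_linear \<theta>" "A \<le> \<theta> z" "\<And>x c. achievable x c \<Longrightarrow> \<theta> x \<le> c"
  proof (rule hahn_banach_cone[OF achievable_add achievable_scale achievable_nonneg achievable_0,
        where r = "r/2" and b = A and z = z])
    \<comment> \<open>A ball of radius r/2 about a point within r/2 of \<open>z\<close> stays inside
      the ball on which the probabilities are below the rate \<open>A\<close>.\<close>
    show "A \<le> c" if ach: "achievable x c" "x \<in> ball z (r/2)" for x c
    proof -
      obtain t n where tn: "t \<ge> 1" "ennreal (exp (- t * c)) \<le> emeasure (law n) {y. y /\<^sub>R t \<in> ball x (r/2)}"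
        using achievable_obtain[OF ach(1), of "r/2"] r by (metis half_gt_zero)
      have "{y. y /\<^sub>R t \<in> ball x (r/2)} \<subseteq> {y. y /\<^sub>R t \<in> ball z r}"
      proof safe
        fix y assume "y /\<^sub>R t \<in> ball x (r/2)"
        then show "y /\<^sub>R t \<in> ball z r" using ach(2) dist_triangle[of z "y /\<^sub>R t" x] by simp
      qed
      then have "emeasure (law n) {y. y /\<^sub>R t \<in> ball x (r/2)} \<le> emeasure (law n) {y. y /\<^sub>R t \<in> ball z r}"
        by (rule emeasure_mono) (simp add: sets_divideR_borel)
      also have "\<dots> < ennreal (exp (- t * A))" using tn by (intro r) auto
      finally have "ennreal (exp (- t * c)) < ennreal (exp (- t * A))" using tn(2) by (rule le_less_trans[rotated])
      then have "t * A < t * c" by (simp add: ennreal_less_iff)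
      then show ?thesis using tn(1) by simp
    qed
  qed (use r A in auto)
  have "(\<integral>\<^sup>+z. ennreal (exp (\<theta> z)) \<partial>step_law) \<le> 1"
  \<comment> \<open>\<open>\<theta> y - e\<close> is not achievable at \<open>y\<close>, because
    \<open>\<theta>\<close> lies below all achievable values; for negative exponents the bound
    exceeds 1 and is trivial.\<close>
  proof (rule mgf_le_1_of_local_bounds[OF \<theta>(1)])
    fix y and e :: real assume e: "e > 0"
    show "\<exists>U. open U \<and> y \<in> U \<and> (\<forall>n\<ge>1. emeasure (law n) {x. x /\<^sub>R real n \<in> U} \<le> ennreal (exp (- real n * (\<theta> y - e))))"
    proof (cases "\<theta> y - e \<ge> 0")
      case True
      have "\<not> achievable y (\<theta> y - e)" using \<theta>(3)[of y "\<theta> y - e"] e by auto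
      from not_achievable_upper_bound[OF this True] obtain r where "r > 0"
        "\<And>t n. t > 0 \<Longrightarrow> emeasure (law n) {x. x /\<^sub>R t \<in> ball y r} < ennreal (exp (- t * (\<theta> y - e)))" by metis
      then show ?thesis by (intro exI[of _ "ball y r"]) (auto intro!: less_imp_le)
    next
      case False
      have "emeasure (law n) {x. x /\<^sub>R real n \<in> UNIV} \<le> ennreal (exp (- real n * (\<theta> y - e)))" for n
      proof -
        have "1 \<le> exp (- real n * (\<theta> y - e))" using False by (simp add: mult_nonneg_nonpos)
        then have "1 \<le> ennreal (exp (- real n * (\<theta> y - e)))" by (simp add: ennreal_ge_1)
        then show ?thesis using emeasure_law_le_1 order_trans by blast
      qed
      then show ?thesis by (intro exI[of _ UNIV]) auto
    qed
  qed
  with dual[OF \<theta>(1)] \<theta>(2) show False by auto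
qed

end


section \<open>Dual form of the rate functions\<close>

text \<open>\<open>rate_Upsilon\<close> is the lower semicontinuous regularisation of
  \<open>inf_scaled_J\<close> in both variables, so bounds along a convergent sequence pass to the
  limit point.\<close>

lemma rate_Upsilon_le:
  assumes s: "s \<longlonglongrightarrow> \<beta>" and v: "v \<longlonglongrightarrow> w" and b: "b \<longlonglongrightarrow> B"
    and le: "\<And>n. inf_scaled_J M S X (s n) (v n) \<le> ereal (b n)"
  shows "rate_Upsilon M S X \<beta> w \<le> ereal B"
proof (rule tendsto_upperbound[OF tendsto_rate_Upsilon])
  have "\<forall>\<^sub>F \<delta> in at_right (0::real). \<delta> > 0" by (simp add: eventually_at_right_less)
  then show "\<forall>\<^sub>F \<delta> in at_right 0. (INF s\<in>{\<beta> - \<delta> <..< \<beta> + \<delta>}. INF v\<in>ball w \<delta>. inf_scaled_J M S X s v) \<le> ereal B"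
  proof eventually_elim
    case (elim \<delta>)
    have "\<forall>\<^sub>F n in sequentially. dist (s n) \<beta> < \<delta>" "\<forall>\<^sub>F n in sequentially. dist (v n) w < \<delta>"
      using s v elim by (auto simp: tendsto_iff)
    then have "\<forall>\<^sub>F n in sequentially.
      (INF s\<in>{\<beta> - \<delta> <..< \<beta> + \<delta>}. INF v\<in>ball w \<delta>. inf_scaled_J M S X s v) \<le> ereal (b n)"
    proof eventually_elim
      case (elim n)
      then have "s n \<in> {\<beta> - \<delta> <..< \<beta> + \<delta>}" "v n \<in> ball w \<delta>"
        by (auto simp: dist_real_def dist_commute abs_less_iff)
      then show ?case using le[of n] by (meson INF_lower2)
    qed
    moreover have "(\<lambda>n. ereal (b n)) \<longlonglongrightarrow> ereal B" using b by simp
    ultimately show ?case by (intro tendsto_lowerbound) auto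
  qed
qed simp

lemma blinfun_prod_real:
  fixes \<theta> :: "real \<times> 'a::real_normed_vector \<Rightarrow> real"
  assumes "bounded_linear \<theta>"
  obtains \<zeta> and \<phi> :: "'a \<Rightarrow>\<^sub>L real" where "\<And>z. \<theta> z = \<zeta> * fst z + \<phi> (snd z)"
proof (rule that)
  interpret \<theta>: bounded_linear \<theta> by fact
  have "bounded_linear (\<lambda>w::'a. (0::real, w))" by (intro bounded_linear_intros)
  then have bl: "bounded_linear (\<lambda>w. \<theta> (0, w))" by (rule bounded_linear_compose[OF assms])
  fix z :: "real \<times> 'a"
  have "\<theta> z = \<theta> (fst z *\<^sub>R (1, 0) + (0, snd z))" by simp
  also have "\<dots> = \<theta> (1, 0) * fst z + \<theta> (0, snd z)"
    by (subst \<theta>.add, subst \<theta>.scaleR) simp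
  finally show "\<theta> z = \<theta> (1, 0) * fst z + Blinfun (\<lambda>w. \<theta> (0, w)) (snd z)"
    by (simp add: bounded_linear_Blinfun_apply[OF bl])
qed

lemma bounded_linear_prod_real:
  fixes \<phi> :: "'a::real_normed_vector \<Rightarrow>\<^sub>L real"
  shows "bounded_linear (\<lambda>z::real \<times> 'a. \<zeta> * fst z + \<phi> (snd z))"
  by (intro bounded_linear_add bounded_linear_mult_right[THEN bounded_linear_compose]
      bounded_linear_fst blinfun.bounded_linear_right[THEN bounded_linear_compose] bounded_linear_snd)

lemma borel_measurable_blinfun_apply [measurable (raw)]:
  fixes \<phi> :: "'a::real_normed_vector \<Rightarrow>\<^sub>L real"
  assumes "f \<in> borel_measurable N"
  shows "(\<lambda>x. \<phi> (f x)) \<in> borel_measurable N"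
  by (rule measurable_compose[OF assms borel_measurable_bounded_linear[OF blinfun.bounded_linear_right]])

lemma blinfun_apply_zero_fun [simp]: "blinfun_apply 0 = (\<lambda>x. 0)"
  by (rule ext) simp

context renewal
begin

section \<open>Exponential moments, \<open>Theta\<close> and the conjugate \<open>J\<close>\<close>

definition mgf :: "real \<Rightarrow> ('a \<Rightarrow>\<^sub>L real) \<Rightarrow> ennreal" where
  "mgf \<zeta> \<phi> = mgf_pair M (S 1) (X 1) \<zeta> \<phi>"

text \<open>Real-valued, hence meaningful only where \<open>mgf\<close> is finite; elsewhere it
  takes the default value 0.\<close>

definition Lam :: "real \<Rightarrow> ('a \<Rightarrow>\<^sub>L real) \<Rightarrow> real" where
  "Lam \<zeta> \<phi> = ln (enn2real (mgf \<zeta> \<phi>))"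

definition Theta :: "(real \<times> ('a \<Rightarrow>\<^sub>L real)) set" where
  "Theta = {(\<zeta>, \<phi>). mgf \<zeta> \<phi> \<le> 1}"

abbreviation J :: "real \<Rightarrow> 'a \<Rightarrow> ereal" where
  "J \<equiv> rate_J M (S 1) (X 1)"

lemma mgf_step_law:
  fixes \<phi> :: "'a \<Rightarrow>\<^sub>L real"
  shows "mgf \<zeta> \<phi> = (\<integral>\<^sup>+z. ennreal (exp (\<zeta> * fst z + \<phi> (snd z))) \<partial>step_law)"
  unfolding mgf_def mgf_pair_def
  by (subst nn_integral_step_law[of _ 1])
    (auto simp: Z_def intro!: measurable_compose[OF borel_measurable_bounded_linear[OF bounded_linear_prod_real]])

lemma mgf_pos: "mgf \<zeta> \<phi> > 0"
proof (rule ccontr)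
  assume "\<not> ?thesis"
  then have "(\<integral>\<^sup>+\<omega>. ennreal (exp (\<zeta> * S 1 \<omega> + \<phi> (X 1 \<omega>))) \<partial>M) = 0"
    by (simp add: mgf_def mgf_pair_def)
  moreover have [measurable]: "S 1 \<in> borel_measurable M" "X 1 \<in> borel_measurable M"
    by (simp_all add: S_measurable X_measurable)
  ultimately have "AE \<omega> in M. False"
    by (subst (asm) nn_integral_0_iff_AE) (auto simp: not_le)
  then show False by simp
qed

lemma mgf_0 [simp]: "mgf 0 0 = 1"
  by (simp add: mgf_def mgf_pair_def emeasure_space_1)

lemma exp_Lam: "mgf \<zeta> \<phi> < \<infinity> \<Longrightarrow> mgf \<zeta> \<phi> = ennreal (exp (Lam \<zeta> \<phi>))"
  unfolding Lam_def using mgf_pos[of \<zeta> \<phi>] by (simp add: enn2real_positive_iff)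

lemma ln_ext_mgf: "mgf \<zeta> \<phi> < \<infinity> \<Longrightarrow> ln_ext (mgf \<zeta> \<phi>) = ereal (Lam \<zeta> \<phi>)"
  using mgf_pos[of \<zeta> \<phi>] by (auto simp: ln_ext_def Lam_def)

lemma Theta_finite: "(\<zeta>, \<phi>) \<in> Theta \<Longrightarrow> mgf \<zeta> \<phi> < \<infinity>"
  unfolding Theta_def using ennreal_one_less_top by (auto intro: le_less_trans)

lemma Lam_nonpos: "(\<zeta>, \<phi>) \<in> Theta \<Longrightarrow> Lam \<zeta> \<phi> \<le> 0"
  using exp_Lam[OF Theta_finite, of \<zeta> \<phi>] by (auto simp: Theta_def)

lemma zero_in_Theta: "(0, 0) \<in> Theta"
  by (simp add: Theta_def)

text \<open>Pairs with infinite moment contribute minus infinity to the supremum and drop out. What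
  remains is the conjugate of \<open>Lam\<close> on its finite domain, free of extended
  arithmetic.\<close>

lemma J_le_iff: "J s w \<le> ereal c \<longleftrightarrow> (\<forall>\<zeta> \<phi>. mgf \<zeta> \<phi> < \<infinity> \<longrightarrow> s * \<zeta> + \<phi> w - Lam \<zeta> \<phi> \<le> c)"
proof -
  have "J s w \<le> ereal c \<longleftrightarrow> (\<forall>\<zeta> \<phi>. ereal (s * \<zeta> + blinfun_apply \<phi> w) - ln_ext (mgf \<zeta> \<phi>) \<le> ereal c)"
    by (simp add: rate_J_def SUP_le_iff mgf_def)
  also have "\<dots> \<longleftrightarrow> (\<forall>\<zeta> \<phi>. mgf \<zeta> \<phi> < \<infinity> \<longrightarrow> s * \<zeta> + \<phi> w - Lam \<zeta> \<phi> \<le> c)"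
  proof (intro all_cong1)
    fix \<zeta> and \<phi> :: "'a \<Rightarrow>\<^sub>L real"
    show "ereal (s * \<zeta> + \<phi> w) - ln_ext (mgf \<zeta> \<phi>) \<le> ereal c \<longleftrightarrow>
      (mgf \<zeta> \<phi> < \<infinity> \<longrightarrow> s * \<zeta> + \<phi> w - Lam \<zeta> \<phi> \<le> c)"
      by (cases "mgf \<zeta> \<phi> < \<infinity>") (auto simp: ln_ext_mgf less_top[symmetric], simp add: ln_ext_def)
  qed
  finally show ?thesis .
qed

text \<open>The waiting time is positive everywhere, so lowering \<zeta> lowers the integrand
  strictly, and equal integrals would force the difference to vanish almost everywhere. The strict
  gap provides the geometric ratio in sums over the number of renewals.\<close>

lemma mgf_strict:
  assumes "(\<zeta>, \<phi>) \<in> Theta" "\<zeta>' < \<zeta>"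
  shows "mgf \<zeta>' \<phi> < 1"
proof (rule ccontr)
  assume "\<not> ?thesis"
  have [measurable]: "S 1 \<in> borel_measurable M" "X 1 \<in> borel_measurable M"
    by (simp_all add: S_measurable X_measurable)
  define f g where "f \<omega> = ennreal (exp (\<zeta>' * S 1 \<omega> + \<phi> (X 1 \<omega>)))"
    and "g \<omega> = ennreal (exp (\<zeta> * S 1 \<omega> + \<phi> (X 1 \<omega>)))" for \<omega>
  have [measurable]: "f \<in> borel_measurable M" "g \<in> borel_measurable M"
    unfolding f_def g_def by measurable
  have fg: "f \<omega> < g \<omega>" if "\<omega> \<in> space M" for \<omega>
    using S_pos[OF _ that, of 1] assms(2) by (simp add: f_def g_def ennreal_less_iff)
  have g1: "(\<integral>\<^sup>+\<omega>. g \<omega> \<partial>M) \<le> 1" using assms(1) by (simp add: Theta_def mgf_def mgf_pair_def g_def)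
  have f1: "1 \<le> (\<integral>\<^sup>+\<omega>. f \<omega> \<partial>M)" using \<open>\<not> _\<close> by (simp add: mgf_def mgf_pair_def f_def)
  have fle: "(\<integral>\<^sup>+\<omega>. f \<omega> \<partial>M) \<le> (\<integral>\<^sup>+\<omega>. g \<omega> \<partial>M)"
    using fg by (intro nn_integral_mono) (auto intro: less_imp_le)
  have "(\<integral>\<^sup>+\<omega>. g \<omega> - f \<omega> \<partial>M) = (\<integral>\<^sup>+\<omega>. g \<omega> \<partial>M) - (\<integral>\<^sup>+\<omega>. f \<omega> \<partial>M)"
    using fg fle g1 by (intro nn_integral_diff) (auto intro: less_imp_le simp: top_unique)
  also have "\<dots> = 0" using f1 g1 fle by (metis diff_eq_0_ennreal ennreal_one_less_top le_less_trans order_trans)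
  finally have "AE \<omega> in M. g \<omega> - f \<omega> \<le> 0" by (subst (asm) nn_integral_0_iff_AE) (auto simp: not_le)
  then have "AE \<omega> in M. \<omega> \<in> space M \<longrightarrow> False"
  proof eventually_elim
    case (elim \<omega>)
    show ?case
    proof (cases "\<omega> \<in> space M")
      case True
      then have "0 < g \<omega> - f \<omega>" using fg diff_gt_0_iff_gt_ennreal by blast
      then show ?thesis using elim by simp
    qed (use elim in simp)
  qed
  then show False by simp
qed

lemma mgf_mono: "\<zeta>' \<le> \<zeta> \<Longrightarrow> mgf \<zeta>' \<phi> \<le> mgf \<zeta> \<phi>"
  unfolding mgf_def mgf_pair_def using S_pos
  by (intro nn_integral_mono ennreal_leI) (auto intro: mult_right_mono less_imp_le)

lemma Theta_mono: "(\<zeta>, \<phi>) \<in> Theta \<Longrightarrow> \<zeta>' \<le> \<zeta> \<Longrightarrow> (\<zeta>', \<phi>) \<in> Theta"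
  using mgf_mono[of \<zeta>' \<zeta> \<phi>] by (auto simp: Theta_def)

lemma nn_integral_law_exp:
  fixes \<phi> :: "'a \<Rightarrow>\<^sub>L real"
  shows "(\<integral>\<^sup>+x. ennreal (exp (\<zeta> * fst x + \<phi> (snd x))) \<partial>law n) = mgf \<zeta> \<phi> ^ n"
proof (induction n)
  case 0
  show ?case unfolding law_0
    by (subst nn_integral_return)
      (auto intro!: measurable_compose[OF borel_measurable_bounded_linear[OF bounded_linear_prod_real]])
next
  case (Suc n)
  define \<theta> where "\<theta> = (\<lambda>z. \<zeta> * fst z + \<phi> (snd z))"
  have bl: "bounded_linear \<theta>" unfolding \<theta>_def by (rule bounded_linear_prod_real)
  interpret \<theta>: bounded_linear \<theta> by (rule bl)
  note [measurable] = borel_measurable_bounded_linear[OF bl]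
  have IH: "(\<integral>\<^sup>+x. ennreal (exp (\<theta> x)) \<partial>law n) = mgf \<zeta> \<phi> ^ n" using Suc by (simp add: \<theta>_def)
  have "(\<integral>\<^sup>+x. ennreal (exp (\<theta> x)) \<partial>law (Suc n)) =
    (\<integral>\<^sup>+x. (\<integral>\<^sup>+z. ennreal (exp (\<theta> (x + z))) \<partial>step_law) \<partial>law n)"
    by (rule nn_integral_law_Suc) measurable
  also have "\<dots> = (\<integral>\<^sup>+x. (\<integral>\<^sup>+z. ennreal (exp (\<theta> x)) * ennreal (exp (\<theta> z)) \<partial>step_law) \<partial>law n)"
    by (simp add: \<theta>.add exp_add ennreal_mult)
  also have "\<dots> = (\<integral>\<^sup>+x. ennreal (exp (\<theta> x)) * mgf \<zeta> \<phi> \<partial>law n)"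
  proof -
    have "mgf \<zeta> \<phi> = (\<integral>\<^sup>+z. ennreal (exp (\<theta> z)) \<partial>step_law)" by (simp add: mgf_step_law \<theta>_def)
    then show ?thesis by (simp add: nn_integral_cmult)
  qed
  also have "\<dots> = mgf \<zeta> \<phi> ^ Suc n" by (simp add: nn_integral_multc IH mult.commute)
  finally show ?case by (simp add: \<theta>_def)
qed

text \<open>Exponential Chebyshev on the open half-space cut out by a pair whose term in the
  supremum exceeds \<open>c\<close>.\<close>

lemma less_J_local_bound:
  assumes "ereal c < J s w"
  shows "\<exists>U. open U \<and> (s, w) \<in> U \<and> (\<forall>n\<ge>1. emeasure (law n) {x. x /\<^sub>R real n \<in> U} \<le> ennreal (exp (- real n * c)))"
proof -
  obtain \<zeta> \<phi> where fin: "mgf \<zeta> \<phi> < \<infinity>" and gt: "c < s * \<zeta> + \<phi> w - Lam \<zeta> \<phi>"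
    using assms J_le_iff[of s w c] by (force simp: not_le)
  define \<theta> where "\<theta> = (\<lambda>z. \<zeta> * fst z + \<phi> (snd z))"
  have bl: "bounded_linear \<theta>" unfolding \<theta>_def by (rule bounded_linear_prod_real)
  interpret \<theta>: bounded_linear \<theta> by (rule bl)
  note [measurable] = borel_measurable_bounded_linear[OF bl]
  define U where "U = {z. c + Lam \<zeta> \<phi> < \<theta> z}"
  have U: "open U" unfolding U_def
    by (intro open_Collect_less linear_continuous_on bl continuous_intros)
  moreover have "(s, w) \<in> U" using gt by (simp add: U_def \<theta>_def algebra_simps)
  moreover have "emeasure (law n) {x. x /\<^sub>R real n \<in> U} \<le> ennreal (exp (- real n * c))" if n: "n \<ge> 1" for n
  proof -
    let ?a = "ennreal (exp (real n * (c + Lam \<zeta> \<phi>)))"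
    have [measurable]: "{x. x /\<^sub>R real n \<in> U} \<in> sets borel" using U by (simp add: sets_divideR_borel)
    have "?a * emeasure (law n) {x. x /\<^sub>R real n \<in> U} = (\<integral>\<^sup>+x. ?a * indicator {x. x /\<^sub>R real n \<in> U} x \<partial>law n)"
      by (simp add: nn_integral_cmult_indicator)
    also have "\<dots> \<le> (\<integral>\<^sup>+x. ennreal (exp (\<theta> x)) \<partial>law n)"
    proof (rule nn_integral_mono)
      fix x
      have "real n * (c + Lam \<zeta> \<phi>) \<le> \<theta> x" if "x /\<^sub>R real n \<in> U"
        using that n by (simp add: U_def \<theta>.scaleR field_simps)
      then show "?a * indicator {x. x /\<^sub>R real n \<in> U} x \<le> ennreal (exp (\<theta> x))"
        by (auto simp: indicator_def intro!: ennreal_leI)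
    qed
    also have "\<dots> = ennreal (exp (real n * Lam \<zeta> \<phi>))"
      using exp_Lam[OF fin] by (simp add: \<theta>_def nn_integral_law_exp ennreal_power exp_of_nat_mult)
    finally have "ennreal (exp (- (real n * (c + Lam \<zeta> \<phi>)))) * (?a * emeasure (law n) {x. x /\<^sub>R real n \<in> U})
      \<le> ennreal (exp (- (real n * (c + Lam \<zeta> \<phi>)))) * ennreal (exp (real n * Lam \<zeta> \<phi>))"
      by (rule mult_left_mono) simp
    moreover have "ennreal (exp (- (real n * (c + Lam \<zeta> \<phi>)))) * ?a = 1"
      by (simp add: ennreal_mult[symmetric] exp_add[symmetric])
    moreover have "ennreal (exp (- (real n * (c + Lam \<zeta> \<phi>)))) * ennreal (exp (real n * Lam \<zeta> \<phi>)) = ennreal (exp (- real n * c))"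
      by (simp add: ennreal_mult[symmetric] exp_add[symmetric] algebra_simps)
    ultimately show ?thesis by (simp add: mult.assoc[symmetric])
  qed
  ultimately show ?thesis by blast
qed

text \<open>The hard half of biconjugation: a linear functional below the conjugate \<open>J\<close>
  has a logarithmic moment at most 0. The Chebyshev half-spaces supply the local bounds, so no
  topology on the dual space is involved.\<close>

lemma in_Theta_of_le_J:
  fixes \<phi> :: "'a \<Rightarrow>\<^sub>L real"
  assumes "\<And>s w. ereal (\<zeta> * s + \<phi> w) \<le> J s w"
  shows "(\<zeta>, \<phi>) \<in> Theta"
proof -
  have "(\<integral>\<^sup>+z. ennreal (exp (\<zeta> * fst z + \<phi> (snd z))) \<partial>step_law) \<le> 1"
  proof (rule mgf_le_1_of_local_bounds[OF bounded_linear_prod_real])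
    fix z :: "real \<times> 'a" and e :: real assume "e > 0"
    then have "ereal (\<zeta> * fst z + \<phi> (snd z) - e) < ereal (\<zeta> * fst z + \<phi> (snd z))" by simp
    also have "\<dots> \<le> J (fst z) (snd z)" by (rule assms)
    finally show "\<exists>U. open U \<and> z \<in> U \<and> (\<forall>n\<ge>1. emeasure (law n) {x. x /\<^sub>R real n \<in> U}
        \<le> ennreal (exp (- real n * (\<zeta> * fst z + \<phi> (snd z) - e))))"
      using less_J_local_bound[of _ "fst z" "snd z"] by simp
  qed
  then show ?thesis by (simp add: Theta_def mgf_step_law)
qed

text \<open>Were \<open>J\<close> infinite everywhere, every functional would lie below it and (1,
  0) would be in \<open>Theta\<close>; lowering 1 to 0 would then give a moment below 1, whereas
  \<open>mgf 0 0\<close> is 1. The point found here makes the cone nonempty for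
  Hahn--Banach.\<close>

lemma J_finite_somewhere: "\<exists>s w c. J s w \<le> ereal c"
proof (rule ccontr)
  assume "\<not> ?thesis"
  then have no: "\<not> J s w \<le> ereal c" for s w c by blast
  have "J s w = \<infinity>" for s w
    using no[of s w "real_of_ereal (J s w)"] by (cases "J s w") auto
  then have "(1, 0) \<in> Theta" by (intro in_Theta_of_le_J) simp
  from mgf_strict[OF this, of 0] show False by simp
qed

text \<open>
  The epigraph, up to closure, of the infimal convolution of \<open>inf_scaled_J\<close> with the linear cost
  \<open>l\<close> per unit of time during which no renewal occurs (\<open>real_of_ereal\<close> sends infinity to 0).
\<close>

definition cost_cone :: "ereal \<Rightarrow> real \<times> 'a \<Rightarrow> real \<Rightarrow> bool" where
  "cost_cone l z c \<longleftrightarrow> (\<exists>\<gamma>>0. \<exists>u\<ge>0. (l = \<infinity> \<longrightarrow> u = 0) \<and>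
     (\<forall>\<zeta> \<phi>. mgf \<zeta> \<phi> < \<infinity> \<longrightarrow>
        (fst z - u) * \<zeta> + \<phi> (snd z) - \<gamma> * Lam \<zeta> \<phi> \<le> c - u * real_of_ereal l))"

section \<open>Strong duality through the cost cone\<close>

lemma cost_cone_add:
  assumes "cost_cone l x c" "cost_cone l y d"
  shows "cost_cone l (x + y) (c + d)"
proof -
  obtain g u where 1: "g > 0" "u \<ge> 0" "l = \<infinity> \<longrightarrow> u = 0"
    "\<And>\<zeta> \<phi>. mgf \<zeta> \<phi> < \<infinity> \<Longrightarrow> (fst x - u) * \<zeta> + \<phi> (snd x) - g * Lam \<zeta> \<phi> \<le> c - u * real_of_ereal l"
    using assms(1) unfolding cost_cone_def by blast
  obtain h v where 2: "h > 0" "v \<ge> 0" "l = \<infinity> \<longrightarrow> v = 0"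
    "\<And>\<zeta> \<phi>. mgf \<zeta> \<phi> < \<infinity> \<Longrightarrow> (fst y - v) * \<zeta> + \<phi> (snd y) - h * Lam \<zeta> \<phi> \<le> d - v * real_of_ereal l"
    using assms(2) unfolding cost_cone_def by blast
  have "(fst (x + y) - (u + v)) * \<zeta> + \<phi> (snd (x + y)) - (g + h) * Lam \<zeta> \<phi> \<le> c + d - (u + v) * real_of_ereal l"
    if "mgf \<zeta> \<phi> < \<infinity>" for \<zeta> \<phi>
    using 1(4)[OF that] 2(4)[OF that] by (simp add: blinfun.add_right algebra_simps)
  then show ?thesis unfolding cost_cone_def
    using 1 2 by (intro exI[of _ "g + h"] conjI exI[of _ "u + v"]) auto
qed

lemma cost_cone_scale:
  assumes "cost_cone l x c" and t: "t > 0"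
  shows "cost_cone l (t *\<^sub>R x) (t * c)"
proof -
  obtain g u where 1: "g > 0" "u \<ge> 0" "l = \<infinity> \<longrightarrow> u = 0"
    "\<And>\<zeta> \<phi>. mgf \<zeta> \<phi> < \<infinity> \<Longrightarrow> (fst x - u) * \<zeta> + \<phi> (snd x) - g * Lam \<zeta> \<phi> \<le> c - u * real_of_ereal l"
    using assms(1) unfolding cost_cone_def by blast
  have "(fst (t *\<^sub>R x) - t * u) * \<zeta> + \<phi> (snd (t *\<^sub>R x)) - t * g * Lam \<zeta> \<phi> \<le> t * c - t * u * real_of_ereal l"
    if "mgf \<zeta> \<phi> < \<infinity>" for \<zeta> \<phi>
    using mult_left_mono[OF 1(4)[OF that], of t] t by (simp add: blinfun.scaleR_right algebra_simps)
  then show ?thesis unfolding cost_cone_def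
    using 1 t by (intro exI[of _ "t * g"] conjI exI[of _ "t * u"]) auto
qed

lemma cost_cone_nonneg:
  assumes "cost_cone l x c" "0 \<le> l" shows "0 \<le> c"
proof -
  obtain g u where 1: "g > 0" "u \<ge> 0"
    "\<And>\<zeta> \<phi>. mgf \<zeta> \<phi> < \<infinity> \<Longrightarrow> (fst x - u) * \<zeta> + \<phi> (snd x) - g * Lam \<zeta> \<phi> \<le> c - u * real_of_ereal l"
    using assms(1) unfolding cost_cone_def by blast
  have "0 \<le> c - u * real_of_ereal l" using 1(3)[of 0 0] by (simp add: Lam_def)
  moreover have "0 \<le> u * real_of_ereal l" using 1(2) assms(2) by (simp add: real_of_ereal_pos)
  ultimately show ?thesis by simp
qed

lemma cost_cone_of_J: "J s w \<le> ereal c \<Longrightarrow> cost_cone l (s, w) c"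
  unfolding cost_cone_def J_le_iff by (intro exI[of _ 1] conjI exI[of _ 0]) auto

text \<open>Idle time is charged at rate \<open>l\<close>; letting it grow shows that a functional
  below the cone has time slope \<zeta> at most \<open>l\<close>.\<close>

lemma cost_cone_wait: "cost_cone l (s, w) c \<Longrightarrow> l < \<infinity> \<Longrightarrow> u \<ge> 0 \<Longrightarrow> cost_cone l (s + u, w) (c + u * real_of_ereal l)"
  unfolding cost_cone_def
proof (elim exE conjE)
  fix g v assume H: "g > 0" "v \<ge> 0" "l < \<infinity>" "u \<ge> 0"
    "\<forall>\<zeta> \<phi>. mgf \<zeta> \<phi> < \<infinity> \<longrightarrow> (fst (s, w) - v) * \<zeta> + \<phi> (snd (s, w)) - g * Lam \<zeta> \<phi> \<le> c - v * real_of_ereal l"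
  show "\<exists>g>0. \<exists>v\<ge>0. (l = \<infinity> \<longrightarrow> v = 0) \<and> (\<forall>\<zeta> \<phi>. mgf \<zeta> \<phi> < \<infinity> \<longrightarrow>
      (fst (s + u, w) - v) * \<zeta> + \<phi> (snd (s + u, w)) - g * Lam \<zeta> \<phi> \<le> c + u * real_of_ereal l - v * real_of_ereal l)"
    using H by (intro exI[of _ g] conjI exI[of _ "v + u"]) (auto simp: algebra_simps)
qed

text \<open>Reads membership in the cone as a point of the infimal convolution: \<gamma> is absorbed
  into the scaled \<open>J\<close>, and \<open>u\<close> is the idle time. It cannot exceed
  \<open>s\<close>, because \<open>J\<close> is infinite at negative times.\<close>

lemma cost_cone_decompose:
  assumes "cost_cone l (s, w) c"
  obtains u where "0 \<le> u" "l = \<infinity> \<Longrightarrow> u = 0" "u \<le> s"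
    "inf_scaled_J M (S 1) (X 1) (s - u) w \<le> ereal (c - u * real_of_ereal l)"
proof -
  obtain g u where 1: "g > 0" "u \<ge> 0" "l = \<infinity> \<longrightarrow> u = 0"
    "\<And>\<zeta> \<phi>. mgf \<zeta> \<phi> < \<infinity> \<Longrightarrow> (s - u) * \<zeta> + \<phi> w - g * Lam \<zeta> \<phi> \<le> c - u * real_of_ereal l"
    using assms unfolding cost_cone_def by auto
  have "J ((s - u) / g) (w /\<^sub>R g) \<le> ereal ((c - u * real_of_ereal l) / g)"
    unfolding J_le_iff
  proof (intro allI impI)
    fix \<zeta> \<phi> assume "mgf \<zeta> \<phi> < \<infinity>"
    from 1(4)[OF this] have "((s - u) * \<zeta> + \<phi> w - g * Lam \<zeta> \<phi>) / g \<le> (c - u * real_of_ereal l) / g"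
      using 1(1) by (simp add: divide_right_mono)
    then show "(s - u) / g * \<zeta> + \<phi> (w /\<^sub>R g) - Lam \<zeta> \<phi> \<le> (c - u * real_of_ereal l) / g"
      using 1(1) by (simp add: blinfun.scaleR_right field_simps)
  qed
  then have "ereal g * J ((s - u) / g) (w /\<^sub>R g) \<le> ereal g * ereal ((c - u * real_of_ereal l) / g)"
    using 1(1) by (intro ereal_mult_left_mono) auto
  then have "inf_scaled_J M (S 1) (X 1) (s - u) w \<le> ereal (c - u * real_of_ereal l)"
    using 1(1) unfolding inf_scaled_J_def by (intro INF_lower2[of g]) auto
  moreover have "u \<le> s"
  proof (rule ccontr)
    assume "\<not> u \<le> s"
    define d where "d = c - u * real_of_ereal l"
    \<comment> \<open>Chosen so that (s - u) \<zeta> exceeds the allowed bound \<open>d\<close>. As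
      \<zeta> is negative, (\<zeta>, 0) lies in \<open>Theta\<close> and the term with
      \<open>Lam\<close> has the favourable sign.\<close>
    define \<zeta> where "\<zeta> = - (\<bar>d\<bar> + 1) / (u - s)"
    have "\<zeta> \<le> 0" using \<open>\<not> u \<le> s\<close> by (simp add: \<zeta>_def divide_nonpos_pos)
    then have T: "(\<zeta>, 0) \<in> Theta" using zero_in_Theta Theta_mono by blast
    have "(s - u) * \<zeta> - g * Lam \<zeta> 0 \<le> d" using 1(4)[OF Theta_finite[OF T]] by (simp add: d_def)
    moreover have "g * Lam \<zeta> 0 \<le> 0" using Lam_nonpos[OF T] 1(1) by (simp add: mult_nonneg_nonpos)
    moreover have "(s - u) * \<zeta> = \<bar>d\<bar> + 1" using \<open>\<not> u \<le> s\<close> by (simp add: \<zeta>_def field_simps)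
    ultimately show False by linarith
  qed
  ultimately show thesis using 1 by (intro that) auto
qed

text \<open>Weak duality: for a pair in \<open>Theta\<close> the value of \<open>Lam\<close> is
  nonpositive, so the functional lies below every scaled \<open>J\<close>; by continuity it stays
  below the regularisation.\<close>

lemma rate_Upsilon_ge:
  fixes \<phi> :: "'a \<Rightarrow>\<^sub>L real"
  assumes T: "(\<zeta>, \<phi>) \<in> Theta"
  shows "ereal (\<beta> * \<zeta> + \<phi> w) \<le> rate_Upsilon M (S 1) (X 1) \<beta> w"
proof (rule tendsto_le[OF _ tendsto_rate_Upsilon])
  have K_ge: "ereal (s * \<zeta> + \<phi> v) \<le> inf_scaled_J M (S 1) (X 1) s v" for s v
    unfolding inf_scaled_J_def
  proof (rule INF_greatest)
    fix g :: real assume "g \<in> {0<..}"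
    then have g: "g > 0" by simp
    have "ereal (s / g * \<zeta> + \<phi> (v /\<^sub>R g)) \<le> J (s / g) (v /\<^sub>R g)"
    proof (rule ereal_le_real)
      fix c assume "J (s / g) (v /\<^sub>R g) \<le> ereal c"
      then show "ereal (s / g * \<zeta> + \<phi> (v /\<^sub>R g)) \<le> ereal c"
        using J_le_iff Theta_finite[OF T] Lam_nonpos[OF T] by fastforce
    qed
    then have "ereal g * ereal (s / g * \<zeta> + \<phi> (v /\<^sub>R g)) \<le> ereal g * J (s / g) (v /\<^sub>R g)"
      using g by (intro ereal_mult_left_mono) auto
    then show "ereal (s * \<zeta> + \<phi> v) \<le> ereal g * J (s / g) (v /\<^sub>R g)"
      using g by (simp add: blinfun.scaleR_right ring_distribs mult.assoc[symmetric])
  qed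
  \<comment> \<open>A Lipschitz constant of the functional, so that moving by less than \<delta> in
    each variable changes it by at most \<delta> C.\<close>
  define C where "C = \<bar>\<zeta>\<bar> + norm \<phi>"
  have "((\<lambda>\<delta>. \<beta> * \<zeta> + \<phi> w - \<delta> * C) \<longlongrightarrow> \<beta> * \<zeta> + \<phi> w - 0 * C) (at_right 0)"
    by (intro tendsto_intros)
  then show "((\<lambda>\<delta>. ereal (\<beta> * \<zeta> + \<phi> w - \<delta> * C)) \<longlongrightarrow> ereal (\<beta> * \<zeta> + \<phi> w)) (at_right 0)"
    by simp
  have "\<forall>\<^sub>F \<delta> in at_right (0::real). \<delta> > 0" by (simp add: eventually_at_right_less)
  then show "\<forall>\<^sub>F \<delta> in at_right 0. ereal (\<beta> * \<zeta> + \<phi> w - \<delta> * C) \<le>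
    (INF s\<in>{\<beta> - \<delta> <..< \<beta> + \<delta>}. INF v\<in>ball w \<delta>. inf_scaled_J M (S 1) (X 1) s v)"
  proof eventually_elim
    case (elim \<delta>)
    show ?case
    proof (intro INF_greatest)
      fix s v assume sv: "s \<in> {\<beta> - \<delta> <..< \<beta> + \<delta>}" "v \<in> ball w \<delta>"
      have "(\<beta> - s) * \<zeta> \<le> \<delta> * \<bar>\<zeta>\<bar>"
      proof -
        have "(\<beta> - s) * \<zeta> \<le> \<bar>\<beta> - s\<bar> * \<bar>\<zeta>\<bar>" by (metis abs_ge_self abs_mult)
        also have "\<dots> \<le> \<delta> * \<bar>\<zeta>\<bar>" using sv by (intro mult_right_mono) auto
        finally show ?thesis .
      qed
      moreover have "\<phi> w - \<phi> v \<le> \<delta> * norm \<phi>"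
      proof -
        have "\<phi> w - \<phi> v \<le> norm (\<phi> (w - v))" by (simp add: blinfun.diff_right)
        also have "\<dots> \<le> norm \<phi> * norm (w - v)" by (rule norm_blinfun)
        also have "\<dots> \<le> norm \<phi> * \<delta>" using sv by (intro mult_left_mono) (auto simp: dist_norm)
        finally show ?thesis by (simp add: mult.commute)
      qed
      ultimately have "\<beta> * \<zeta> + \<phi> w - \<delta> * C \<le> s * \<zeta> + \<phi> v" by (simp add: C_def algebra_simps)
      then show "ereal (\<beta> * \<zeta> + \<phi> w - \<delta> * C) \<le> inf_scaled_J M (S 1) (X 1) s v"
        using K_ge[of s v] by (metis ereal_less_eq(3) order_trans)
    qed
  qed
qed simp

text \<open>Unit time is split into \<beta> with renewals and 1 - \<beta> without; the constraint on
  \<zeta> is used on the idle part.\<close>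

lemma rate_I_ge:
  fixes \<phi> :: "'a \<Rightarrow>\<^sub>L real"
  assumes T: "(\<zeta>, \<phi>) \<in> Theta" and l: "ereal \<zeta> \<le> l" "0 \<le> l"
  shows "ereal (\<zeta> + \<phi> w) \<le> rate_I M (S 1) (X 1) l w"
proof (cases "l < \<infinity>")
  case True
  then obtain r where r: "l = ereal r" using l by (cases l) auto
  have "ereal (\<zeta> + \<phi> w) \<le> rate_Upsilon M (S 1) (X 1) \<beta> w + ereal (1 - \<beta>) * l" if "\<beta> \<in> {0..1}" for \<beta>
  proof -
    have "(1 - \<beta>) * \<zeta> \<le> (1 - \<beta>) * r" using l that by (intro mult_left_mono) (auto simp: r)
    then have "ereal (\<beta> * \<zeta> + \<phi> w) + ereal ((1 - \<beta>) * \<zeta>) \<le> rate_Upsilon M (S 1) (X 1) \<beta> w + ereal ((1 - \<beta>) * r)"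
      by (intro add_mono rate_Upsilon_ge[OF T]) simp
    then show ?thesis by (simp add: r algebra_simps)
  qed
  then show ?thesis using True unfolding rate_I_def by (simp only: if_True, intro INF_greatest)
next
  case False
  then show ?thesis using rate_Upsilon_ge[OF T, of 1 w] by (simp add: rate_I_def)
qed

text \<open>Costs below \<open>c\<close> arbitrarily close to (1, w) would, along a subsequence,
  give a limiting idle time \<open>b\<close> in [0, 1] and so a value of the rate function at most
  \<open>c\<close>. Only the scalar idle time needs compactness; the positions converge by
  assumption.\<close>

lemma cost_cone_away:
  assumes c: "ereal c < rate_I M (S 1) (X 1) l w" and l: "0 \<le> l"
  shows "\<exists>r>0. \<forall>y d. cost_cone l y d \<longrightarrow> y \<in> ball (1, w) r \<longrightarrow> c \<le> d"
proof (rule ccontr)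
  assume no: "\<not> ?thesis"
  define lr where "lr = real_of_ereal l"
  have lr: "lr \<ge> 0" using l by (simp add: lr_def real_of_ereal_pos)
  have "\<forall>n. \<exists>y d. cost_cone l y d \<and> y \<in> ball (1, w) (inverse (real (Suc n))) \<and> d < c"
    using no by (meson inverse_positive_iff_positive not_le of_nat_0_less_iff zero_less_Suc)
  then obtain y d where yd: "\<And>n. cost_cone l (y n) (d n)"
    "\<And>n. y n \<in> ball (1, w) (inverse (real (Suc n)))" "\<And>n. d n < c" by metis
  have "\<forall>n. \<exists>u. 0 \<le> u \<and> (l = \<infinity> \<longrightarrow> u = 0) \<and> u \<le> fst (y n) \<and>
    inf_scaled_J M (S 1) (X 1) (fst (y n) - u) (snd (y n)) \<le> ereal (d n - u * lr)"
    using yd(1) unfolding lr_def by (metis cost_cone_decompose prod.collapse)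
  then obtain u where u: "\<And>n. 0 \<le> u n" "\<And>n. l = \<infinity> \<Longrightarrow> u n = 0" "\<And>n. u n \<le> fst (y n)"
    "\<And>n. inf_scaled_J M (S 1) (X 1) (fst (y n) - u n) (snd (y n)) \<le> ereal (d n - u n * lr)" by metis
  have y_lim: "y \<longlonglongrightarrow> (1, w)"
  proof (rule metric_LIMSEQ_I)
    fix r :: real assume "r > 0"
    then obtain N where N: "inverse (real (Suc N)) < r" using reals_Archimedean by blast
    have "dist (y n) (1, w) < r" if "n \<ge> N" for n
    proof -
      have "dist (y n) (1, w) < inverse (real (Suc n))" using yd(2)[of n] by (simp add: dist_commute)
      also have "\<dots> \<le> inverse (real (Suc N))" using that by (simp add: le_imp_inverse_le)
      finally show ?thesis using N by simp
    qed
    then show "\<exists>N. \<forall>n\<ge>N. dist (y n) (1, w) < r" by blast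
  qed
  have fy: "(\<lambda>n. fst (y n)) \<longlonglongrightarrow> 1" and sy: "(\<lambda>n. snd (y n)) \<longlonglongrightarrow> w"
    using tendsto_fst[OF y_lim] tendsto_snd[OF y_lim] by auto
  \<comment> \<open>The idle time is at most the total time, which differs from 1 by less than
    1.\<close>
  have "u n \<in> {0..2}" for n
  proof -
    have "dist (fst (y n)) 1 \<le> dist (y n) (1, w)" using dist_fst_le[of "y n" "(1, w)"] by simp
    also have "\<dots> < inverse (real (Suc n))" using yd(2)[of n] by (simp add: dist_commute)
    also have "\<dots> \<le> 1" by (simp add: inverse_le_1_iff)
    finally show ?thesis using u(1,3)[of n] by (auto simp: dist_real_def)
  qed
  moreover have "compact {0..2::real}" by simp
  ultimately obtain b f where bf: "strict_mono f" "(u \<circ> f) \<longlonglongrightarrow> b"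
    unfolding compact_def by metis
  have b0: "0 \<le> b" using bf(2) u(1) by (intro LIMSEQ_le_const[OF bf(2)]) auto
  have fyf: "(\<lambda>n. fst (y (f n))) \<longlonglongrightarrow> 1" and syf: "(\<lambda>n. snd (y (f n))) \<longlonglongrightarrow> w"
    using LIMSEQ_subseq_LIMSEQ[OF fy bf(1)] LIMSEQ_subseq_LIMSEQ[OF sy bf(1)] by (auto simp: comp_def)
  have uf: "(\<lambda>n. u (f n)) \<longlonglongrightarrow> b" using bf(2) by (simp add: comp_def)
  have b1: "b \<le> 1" using u(3) by (intro LIMSEQ_le[OF uf fyf]) auto
  have "rate_Upsilon M (S 1) (X 1) (1 - b) w \<le> ereal (c - b * lr)"
  proof (rule rate_Upsilon_le)
    show "(\<lambda>n. fst (y (f n)) - u (f n)) \<longlonglongrightarrow> 1 - b" by (intro tendsto_diff fyf uf)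
    show "(\<lambda>n. c - u (f n) * lr) \<longlonglongrightarrow> c - b * lr" by (intro tendsto_intros uf)
    show "inf_scaled_J M (S 1) (X 1) (fst (y (f n)) - u (f n)) (snd (y (f n))) \<le> ereal (c - u (f n) * lr)" for n
      using u(4)[of "f n"] yd(3)[of "f n"] by (elim order_trans) simp
  qed (rule syf)
  moreover have "rate_I M (S 1) (X 1) l w \<le> rate_Upsilon M (S 1) (X 1) (1 - b) w + ereal (b * lr)"
  proof (cases "l < \<infinity>")
    case True
    then have "l = ereal lr" using l by (cases l) (auto simp: lr_def)
    then show ?thesis
      using True b0 b1 unfolding rate_I_def by (simp, intro INF_lower2[of "1 - b"]) auto
  next
    case False
    then have "u n = 0" for n using u(2) by auto
    then have "b = 0" using uf by (simp add: LIMSEQ_const_iff)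
    then show ?thesis using False by (simp add: rate_I_def)
  qed
  ultimately have "rate_I M (S 1) (X 1) l w \<le> ereal (c - b * lr) + ereal (b * lr)"
    by (meson add_right_mono order_trans)
  then show False using c by simp
qed

text \<open>Strong duality: costs below c' being impossible near (1, w), Hahn--Banach gives a
  functional below the cone. Lying below \<open>J\<close> puts it in \<open>Theta\<close>, and lying
  below all points delayed by idle time bounds \<zeta> by \<open>l\<close>. The intermediate c'
  makes the final inequality strict.\<close>

lemma rate_I_dual:
  assumes c: "ereal c < rate_I M (S 1) (X 1) l w" and l: "0 \<le> l"
  obtains \<zeta> and \<phi> :: "'a \<Rightarrow>\<^sub>L real" where "(\<zeta>, \<phi>) \<in> Theta" "ereal \<zeta> \<le> l" "c < \<zeta> + \<phi> w"
proof (cases "c < 0")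
  case True
  then show thesis using zero_in_Theta l by (intro that[of 0 0]) (auto simp: zero_ereal_def[symmetric])
next
  case False
  obtain c' where c': "c < c'" "ereal c' < rate_I M (S 1) (X 1) l w"
    using ereal_dense2[OF c] by auto
  obtain r where r: "r > 0" "\<And>y d. cost_cone l y d \<Longrightarrow> y \<in> ball (1, w) r \<Longrightarrow> c' \<le> d"
    using cost_cone_away[OF c'(2) l] by blast
  obtain s0 w0 c0 where J0: "J s0 w0 \<le> ereal c0" using J_finite_somewhere by blast
  obtain \<theta> where \<theta>: "bounded_linear \<theta>" "c' \<le> \<theta> (1, w)" "\<And>x d. cost_cone l x d \<Longrightarrow> \<theta> x \<le> d"
  proof (rule hahn_banach_cone[of "cost_cone l", OF cost_cone_add cost_cone_scale cost_cone_nonneg cost_cone_of_J[OF J0]])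
    show "0 \<le> c'" using False c' by simp
  qed (use r l in auto)
  obtain \<zeta> \<phi> where \<zeta>\<phi>: "\<And>z. \<theta> z = \<zeta> * fst z + blinfun_apply \<phi> (snd z)"
    using blinfun_prod_real[OF \<theta>(1)] by metis
  have "(\<zeta>, \<phi>) \<in> Theta"
  proof (rule in_Theta_of_le_J, rule ereal_le_real)
    fix s w c assume "J s w \<le> ereal c"
    from \<theta>(3)[OF cost_cone_of_J[OF this]] show "ereal (\<zeta> * s + \<phi> w) \<le> ereal c" by (simp add: \<zeta>\<phi>)
  qed
  moreover have "ereal \<zeta> \<le> l"
  proof (cases "l < \<infinity>")
    case True
    then obtain lr where lr: "l = ereal lr" using l by (cases l) auto
    have le: "\<zeta> * (s0 + u) + \<phi> w0 \<le> c0 + u * lr" if "u \<ge> 0" for u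
      using \<theta>(3)[OF cost_cone_wait[OF cost_cone_of_J[OF J0] True that]] by (simp add: \<zeta>\<phi> lr)
    have "\<zeta> \<le> lr"
    proof (rule ccontr)
      assume n: "\<not> \<zeta> \<le> lr"
      define u where "u = (\<bar>c0 - \<zeta> * s0 - \<phi> w0\<bar> + 1) / (\<zeta> - lr)"
      have "u \<ge> 0" "u * (\<zeta> - lr) = \<bar>c0 - \<zeta> * s0 - \<phi> w0\<bar> + 1" using n by (auto simp: u_def)
      with le[of u] show False by (simp add: algebra_simps)
    qed
    then show ?thesis by (simp add: lr)
  qed simp
  ultimately show thesis using \<theta>(2) c'(1) by (intro that) (auto simp: \<zeta>\<phi>)
qed

lemma lower_semicontinuous_rate_I:
  assumes l: "0 \<le> l" shows "lower_semicontinuous (rate_I M (S 1) (X 1) l)"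
  unfolding lower_semicontinuous_def
proof (intro allI impI)
  fix w c assume "c < rate_I M (S 1) (X 1) l w"
  then obtain c' where c': "c < ereal c'" "ereal c' < rate_I M (S 1) (X 1) l w"
    using ereal_dense2 by blast
  obtain \<zeta> \<phi> where T: "(\<zeta>, \<phi>) \<in> Theta" "ereal \<zeta> \<le> l" "c' < \<zeta> + \<phi> w"
    using rate_I_dual[OF c'(2) l] by blast
  have "open {y. c' < \<zeta> + \<phi> y}" by (intro open_Collect_less continuous_intros)
  then have "\<forall>\<^sub>F y in nhds w. y \<in> {y. c' < \<zeta> + \<phi> y}" using T(3) by (intro eventually_nhds_in_open) auto
  then show "\<forall>\<^sub>F y in nhds w. c < rate_I M (S 1) (X 1) l y"
  proof eventually_elim
    case (elim y)
    then have "c < ereal (\<zeta> + \<phi> y)" using c'(1) by (auto elim: less_trans)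
    then show ?case using rate_I_ge[OF T(1,2) l] by (rule less_le_trans)
  qed
qed

lemma ext_convex_rate_I:
  assumes l: "0 \<le> l" shows "ext_convex (rate_I M (S 1) (X 1) l)"
  unfolding ext_convex_def
proof (intro allI impI)
  fix x y and u v :: real assume uv: "0 \<le> u" "0 \<le> v" "u + v = 1"
  let ?I = "rate_I M (S 1) (X 1) l"
  show "?I (u *\<^sub>R x + v *\<^sub>R y) \<le> ereal u * ?I x + ereal v * ?I y"
  proof (rule ccontr)
    assume "\<not> ?thesis"
    then obtain c where c: "ereal u * ?I x + ereal v * ?I y < ereal c" "ereal c < ?I (u *\<^sub>R x + v *\<^sub>R y)"
      using ereal_dense2 by (meson not_le)
    obtain \<zeta> \<phi> where T: "(\<zeta>, \<phi>) \<in> Theta" "ereal \<zeta> \<le> l" "c < \<zeta> + \<phi> (u *\<^sub>R x + v *\<^sub>R y)"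
      using rate_I_dual[OF c(2) l] by blast
    have "\<zeta> + \<phi> (u *\<^sub>R x + v *\<^sub>R y) = (u + v) * \<zeta> + \<phi> (u *\<^sub>R x + v *\<^sub>R y)" using uv by simp
    also have "\<dots> = u * (\<zeta> + \<phi> x) + v * (\<zeta> + \<phi> y)"
      by (simp only: blinfun.add_right blinfun.scaleR_right real_scaleR_def ring_distribs)
    finally have "ereal c < ereal u * ereal (\<zeta> + \<phi> x) + ereal v * ereal (\<zeta> + \<phi> y)"
      using T(3) by simp
    also have "\<dots> \<le> ereal u * ?I x + ereal v * ?I y"
      using uv by (intro add_mono ereal_mult_left_mono rate_I_ge[OF T(1,2) l]) auto
    finally show False using c(1) by simp
  qed
qed

end


section \<open>Upper bounds\<close>

lemma ln_ext_le_iff: "ln_ext p \<le> ereal x \<longleftrightarrow> p \<le> ennreal (exp x)"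
proof (cases p)
  case (real r)
  have "ln r \<le> x \<longleftrightarrow> r \<le> exp x" if "r > 0" using that by (metis exp_le_cancel_iff exp_ln)
  with real show ?thesis by (cases "r = 0") (auto simp: ln_ext_def)
qed (simp add: ln_ext_def top_unique)

lemma scaled_ln_ext_le_iff:
  assumes "t > 0"
  shows "ereal (1 / t) * ln_ext p \<le> ereal x \<longleftrightarrow> p \<le> ennreal (exp (t * x))"
proof -
  have "ereal (1 / t) * q \<le> ereal x \<longleftrightarrow> q \<le> ereal (t * x)" for q
    using assms by (cases q) (auto simp: field_simps)
  then show ?thesis by (simp add: ln_ext_le_iff)
qed

lemma Limsup_scaled_ln_ext_le:
  fixes B :: ereal
  assumes "\<And>a. ereal a < B \<Longrightarrow> \<exists>C. \<forall>t\<ge>1. p t \<le> ennreal (C * exp (- t * a))"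
  shows "Limsup at_top (\<lambda>t::real. ereal (1 / t) * ln_ext (p t)) \<le> - B"
proof (rule ccontr)
  assume "\<not> ?thesis"
  then obtain c where c: "- B < ereal c" "ereal c < Limsup at_top (\<lambda>t::real. ereal (1 / t) * ln_ext (p t))"
    using ereal_dense2 by (meson not_le)
  from c(1) have "ereal (- c) < B" by (cases B) auto
  then obtain a where a: "- c < a" "ereal a < B" using ereal_dense2 by force
  obtain C where C: "\<And>t. t \<ge> 1 \<Longrightarrow> p t \<le> ennreal (C * exp (- t * a))" using assms[OF a(2)] by blast
  have "\<forall>\<^sub>F t in at_top. ereal (1 / t) * ln_ext (p t) \<le> ereal c"
    \<comment> \<open>For such \<open>t\<close> the constant \<open>C\<close> is at most exp (t (a +
      c)), by 1 + x \<le> exp x, so the prefactor is lost in the exponent.\<close>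
    using eventually_ge_at_top[of "max 1 (\<bar>C\<bar> / (a + c))"]
  proof eventually_elim
    case (elim t)
    then have t: "t \<ge> 1" "\<bar>C\<bar> \<le> t * (a + c)" using a by (auto simp: field_simps)
    have "C \<le> exp (t * (a + c))" using t(2) exp_ge_add_one_self[of "t * (a + c)"] by linarith
    then have "C * exp (- t * a) \<le> exp (t * (a + c)) * exp (- t * a)" by (rule mult_right_mono) simp
    also have "\<dots> = exp (t * c)" by (simp add: exp_add[symmetric] algebra_simps)
    finally have "p t \<le> ennreal (exp (t * c))" using C[OF t(1)] by (meson ennreal_leI order_trans)
    then show ?case using t(1) by (simp add: scaled_ln_ext_le_iff)
  qed
  then have "Limsup at_top (\<lambda>t::real. ereal (1 / t) * ln_ext (p t)) \<le> ereal c" by (rule Limsup_bounded)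
  with c(2) show False by simp
qed

text \<open>The limit superior controls only large arguments; before \<open>s1\<close> the constant
  exp (|\<zeta>| s1) lifts the right-hand side to at least 1.\<close>

lemma tail_bound_of_ell_s:
  assumes "prob_space M" and z: "ereal \<zeta> < ell_s M T"
  obtains C where "C \<ge> 0" "\<And>u. u \<ge> 0 \<Longrightarrow> emeasure M {\<omega>\<in>space M. u < T \<omega>} \<le> ennreal (C * exp (- \<zeta> * u))"
proof -
  let ?p = "\<lambda>s. emeasure M {\<omega>\<in>space M. s < T \<omega>}"
  have "Limsup at_top (\<lambda>s::real. ereal (1 / s) * ln_ext (?p s)) < ereal (- \<zeta>)"
    using z unfolding ell_s_def
    by (cases "Limsup at_top (\<lambda>s::real. ereal (1 / s) * ln_ext (?p s))") auto
  then have "\<forall>\<^sub>F s in at_top. ereal (1 / s) * ln_ext (?p s) < ereal (- \<zeta>)"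
    by (rule Limsup_lessD)
  then obtain s0 where s0: "\<And>s. s \<ge> s0 \<Longrightarrow> ereal (1 / s) * ln_ext (?p s) < ereal (- \<zeta>)"
    by (auto simp: eventually_at_top_linorder)
  define s1 where "s1 = max s0 1"
  define C where "C = exp (\<bar>\<zeta>\<bar> * s1)"
  have C1: "C \<ge> 1" by (simp add: C_def s1_def)
  show thesis
  proof (rule that[of C])
    fix u :: real assume u: "u \<ge> 0"
    show "?p u \<le> ennreal (C * exp (- \<zeta> * u))"
    proof (cases "u \<ge> s1")
      case True
      then have "?p u \<le> ennreal (exp (u * (- \<zeta>)))"
        using s0[of u] by (intro scaled_ln_ext_le_iff[THEN iffD1]) (auto simp: s1_def intro: less_imp_le)
      also have "\<dots> \<le> ennreal (C * exp (- \<zeta> * u))"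
        using C1 by (intro ennreal_leI) (simp add: mult.commute)
      finally show ?thesis .
    next
      case False
      have "\<zeta> * u \<le> \<bar>\<zeta>\<bar> * u" using u by (simp add: mult_right_mono)
      also have "\<dots> \<le> \<bar>\<zeta>\<bar> * s1" using False by (simp add: mult_left_mono)
      finally have "0 \<le> \<bar>\<zeta>\<bar> * s1 + - \<zeta> * u" by simp
      then have "1 \<le> exp (\<bar>\<zeta>\<bar> * s1 + - \<zeta> * u)" by simp
      also have "\<dots> = C * exp (- \<zeta> * u)" by (simp only: C_def exp_add)
      finally have "1 \<le> ennreal (C * exp (- \<zeta> * u))" by (simp add: ennreal_ge_1)
      then show ?thesis using prob_space.emeasure_le_1[OF assms(1)] order_trans by blast
    qed
  qed (use C1 in simp)
qed

text \<open>A minimum is at most any weighted geometric mean. In use, \<open>x\<close> has the right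
  exponential rate but no decay in the number of renewals, and \<open>y\<close> decays geometrically
  at a poor rate.\<close>

lemma le_powr_interpolation:
  fixes x y :: real
  assumes "0 < x" "0 < y" "0 \<le> \<eta>" "\<eta> \<le> 1" "p \<le> ennreal x" "p \<le> ennreal y"
  shows "p \<le> ennreal (x powr (1 - \<eta>) * y powr \<eta>)"
proof (cases "x \<le> y")
  case True
  have "x = x powr (1 - \<eta>) * x powr \<eta>" using assms by (simp add: powr_add[symmetric])
  also have "\<dots> \<le> x powr (1 - \<eta>) * y powr \<eta>" using True assms by (intro mult_left_mono powr_mono2) auto
  finally show ?thesis using assms(5) by (meson ennreal_leI order_trans)
next
  case False
  have "y = y powr (1 - \<eta>) * y powr \<eta>" using assms by (simp add: powr_add[symmetric])
  also have "\<dots> \<le> x powr (1 - \<eta>) * y powr \<eta>" using False assms by (intro mult_right_mono powr_mono2) auto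
  finally show ?thesis using assms(6) by (meson ennreal_leI order_trans)
qed

lemma suminf_ennreal_geometric_le:
  assumes "\<And>n. p n \<le> ennreal (c * r ^ n)" "0 \<le> c" "0 \<le> r" "r < 1"
  shows "(\<Sum>n. p n) \<le> ennreal (c / (1 - r))"
proof -
  have s: "(\<lambda>n. c * r ^ n) sums (c * (1 / (1 - r)))"
    using assms by (intro sums_mult geometric_sums) simp
  have "(\<Sum>n. p n) \<le> (\<Sum>n. ennreal (c * r ^ n))" by (intro suminf_le assms) auto
  also have "\<dots> = ennreal (\<Sum>n. c * r ^ n)"
    using assms s by (intro suminf_ennreal2) (auto simp: sums_iff)
  also have "(\<Sum>n. c * r ^ n) = c / (1 - r)" using s by (simp add: sums_iff)
  finally show ?thesis .
qed

lemma measurable_fst_borel [measurable]: "fst \<in> borel_measurable (borel :: (real \<times> 'b::{second_countable_topology, real_normed_vector}) measure)"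
  and measurable_snd_borel [measurable]: "snd \<in> borel_measurable (borel :: (real \<times> 'b::{second_countable_topology, real_normed_vector}) measure)"
  by (intro borel_measurable_continuous_onI continuous_intros)+

context renewal
begin

section \<open>The law of the reward, split by the number of renewals\<close>

abbreviation W :: "real \<Rightarrow> 'w \<Rightarrow> 'a" where
  "W \<equiv> cumulative_reward S X"

abbreviation W_prob :: "real \<Rightarrow> 'a set \<Rightarrow> ennreal" where
  "W_prob t A \<equiv> emeasure M {\<omega>\<in>space M. W t \<omega> /\<^sub>R t \<in> A}"

lemma renewal_time_Suc: "renewal_time S (Suc n) \<omega> = renewal_time S n \<omega> + S (Suc n) \<omega>"
  by (simp add: renewal_time_def)

lemma renewal_time_mono:
  assumes "\<omega> \<in> space M" "m \<le> n" shows "renewal_time S m \<omega> \<le> renewal_time S n \<omega>"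
  using assms(2)
proof (induction rule: dec_induct)
  case (step k)
  then show ?case using S_pos[OF _ assms(1), of "Suc k"] by (simp add: renewal_time_Suc)
qed simp

lemma renewal_interval_exists:
  assumes "\<omega> \<in> space M" "t \<ge> 0"
  obtains n where "renewal_time S n \<omega> \<le> t" "t < renewal_time S (Suc n) \<omega>"
proof -
  have "\<forall>\<^sub>F i in sequentially. t < renewal_time S i \<omega>"
    using renewal_time_at_top[OF assms(1)] by (simp add: filterlim_at_top_dense)
  then obtain i where i: "t < renewal_time S i \<omega>" by (auto simp: eventually_sequentially)
  define m where "m = (LEAST i. t < renewal_time S i \<omega>)"
  have m: "t < renewal_time S m \<omega>" unfolding m_def by (rule LeastI[where P = "\<lambda>i. t < renewal_time S i \<omega>", OF i])
  have "m \<noteq> 0" using m assms(2) by (auto simp: renewal_time_def intro!: gr0I)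
  then obtain n where n: "m = Suc n" using not0_implies_Suc by blast
  have "\<not> t < renewal_time S n \<omega>" 
    using not_less_Least[of n "\<lambda>i. t < renewal_time S i \<omega>"] n unfolding m_def by simp
  then show thesis using m n by (intro that[of n]) auto
qed

lemma renewal_interval_unique:
  assumes "\<omega> \<in> space M" "renewal_time S n \<omega> \<le> t" "t < renewal_time S (Suc n) \<omega>"
    "renewal_time S m \<omega> \<le> t" "t < renewal_time S (Suc m) \<omega>"
  shows "m = n"
proof (rule ccontr)
  assume "m \<noteq> n"
  then consider "Suc m \<le> n" | "Suc n \<le> m" by linarith
  then show False
    using renewal_time_mono[OF assms(1), of "Suc m" n] renewal_time_mono[OF assms(1), of "Suc n" m] assms
    by cases auto
qed

lemma renewal_indices:
  assumes "\<omega> \<in> space M" "renewal_time S n \<omega> \<le> t" "t < renewal_time S (Suc n) \<omega>"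
  shows "{i. 1 \<le> i \<and> renewal_time S i \<omega> \<le> t} = {1..n}"
proof (intro set_eqI)
  fix i
  have "renewal_time S i \<omega> \<le> t \<longleftrightarrow> i \<le> n"
    using renewal_time_mono[OF assms(1), of i n] renewal_time_mono[OF assms(1), of "Suc n" i] assms
    by (cases "i \<le> n") auto
  then show "i \<in> {i. 1 \<le> i \<and> renewal_time S i \<omega> \<le> t} \<longleftrightarrow> i \<in> {1..n}" by auto
qed

lemma W_eq_Zsum:
  assumes "\<omega> \<in> space M" "renewal_time S n \<omega> \<le> t" "t < renewal_time S (Suc n) \<omega>"
  shows "W t \<omega> = snd (Zsum n \<omega>)"
  unfolding cumulative_reward_def renewal_indices[OF assms] snd_Zsum ..

text \<open>With \<open>x\<close> the n-th partial sum and \<open>z\<close> the next step, the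
  indicators say that exactly n renewals occur up to \<open>t\<close>. As a function of
  \<open>x\<close> and \<open>z\<close> the term is ready for integrating out the last step.\<close>

definition W_term :: "real \<Rightarrow> ('a \<Rightarrow> ennreal) \<Rightarrow> real \<times> 'a \<Rightarrow> real \<times> 'a \<Rightarrow> ennreal" where
  "W_term t f x z = f (snd x) * indicator {x. fst x \<le> t} x * indicator {p. t < fst (fst p) + fst (snd p)} (x, z)"

lemma measurable_W_term:
  assumes [measurable]: "f \<in> borel_measurable borel"
  shows "(\<lambda>(x, z). W_term t f x z) \<in> borel_measurable (borel \<Otimes>\<^sub>M borel)"
proof -
  have f: "(\<lambda>p :: (real \<times> 'a) \<times> (real \<times> 'a). f (snd (fst p))) \<in> borel_measurable (borel \<Otimes>\<^sub>M borel)"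
    by (intro measurable_compose[OF measurable_fst measurable_compose[OF measurable_snd_borel assms]])
  have 1: "(\<lambda>p :: (real \<times> 'a) \<times> (real \<times> 'a). fst (fst p)) \<in> borel_measurable (borel \<Otimes>\<^sub>M borel)"
    by (intro measurable_compose[OF measurable_fst measurable_fst_borel])
  have 2: "(\<lambda>p :: (real \<times> 'a) \<times> (real \<times> 'a). fst (snd p)) \<in> borel_measurable (borel \<Otimes>\<^sub>M borel)"
    by (intro measurable_compose[OF measurable_snd measurable_fst_borel])
  have "(\<lambda>p :: (real \<times> 'a) \<times> (real \<times> 'a). f (snd (fst p)) * (if fst (fst p) \<le> t then 1 else 0) * (if t < fst (fst p) + fst (snd p) then 1 else 0))
    \<in> borel_measurable (borel \<Otimes>\<^sub>M borel)"
    using f 1 2 by measurable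
  then show ?thesis
    by (rule measurable_cong[THEN iffD1, rotated]) (auto simp: W_term_def indicator_def)
qed

lemma apply_W_eq_suminf:
  assumes "\<omega> \<in> space M" "t \<ge> 0"
  shows "f (W t \<omega>) = (\<Sum>n. W_term t f (Zsum n \<omega>) (Z (Suc n) \<omega>))"
proof -
  obtain n where n: "renewal_time S n \<omega> \<le> t" "t < renewal_time S (Suc n) \<omega>"
    using renewal_interval_exists[OF assms] by blast
  have "W_term t f (Zsum m \<omega>) (Z (Suc m) \<omega>) = 0" if "m \<notin> {n}" for m
    using renewal_interval_unique[OF assms(1) n, of m] that
    by (auto simp: W_term_def fst_Zsum Z_def indicator_def renewal_time_Suc)
  then have "(\<Sum>n. W_term t f (Zsum n \<omega>) (Z (Suc n) \<omega>)) = (\<Sum>m\<in>{n}. W_term t f (Zsum m \<omega>) (Z (Suc m) \<omega>))"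
    by (intro suminf_finite) auto
  also have "\<dots> = f (W t \<omega>)"
    using n W_eq_Zsum[OF assms(1) n] by (simp add: W_term_def fst_Zsum Z_def renewal_time_Suc)
  finally show ?thesis by simp
qed

lemma measurable_W_term_Zsum [measurable]:
  assumes [measurable]: "f \<in> borel_measurable borel"
  shows "(\<lambda>\<omega>. W_term t f (Zsum n \<omega>) (Z (Suc n) \<omega>)) \<in> borel_measurable M"
proof -
  have "(\<lambda>\<omega>. (Zsum n \<omega>, Z (Suc n) \<omega>)) \<in> measurable M (borel \<Otimes>\<^sub>M borel)"
    by (intro measurable_Pair Zsum_measurable Z_measurable) simp
  from measurable_compose[OF this measurable_W_term[OF assms]] show ?thesis by simp
qed

lemma W_measurable:
  assumes t: "t \<ge> 0" shows "W t \<in> borel_measurable M"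
proof (rule measurableI)
  fix A :: "'a set" assume A: "A \<in> sets borel"
  have "(\<lambda>\<omega>. \<Sum>n. W_term t (indicator A) (Zsum n \<omega>) (Z (Suc n) \<omega>)) \<in> borel_measurable M"
    using A by measurable
  then have "(\<lambda>\<omega>. indicator A (W t \<omega>) :: ennreal) \<in> borel_measurable M"
    using apply_W_eq_suminf[OF _ t] by (subst measurable_cong) auto
  then have "(\<lambda>\<omega>. indicator A (W t \<omega>) :: ennreal) -` {1} \<inter> space M \<in> sets M"
    by (rule measurable_sets) simp
  moreover have "(\<lambda>\<omega>. indicator A (W t \<omega>) :: ennreal) -` {1} \<inter> space M = W t -` A \<inter> space M"
    by (auto simp: indicator_def split: if_splits)
  ultimately show "W t -` A \<inter> space M \<in> sets M" by simp
qed simp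

definition tail :: "real \<Rightarrow> ennreal" where
  "tail u = emeasure M {\<omega>\<in>space M. u < S 1 \<omega>}"

lemma tail_le_1: "tail u \<le> 1"
  unfolding tail_def by (rule emeasure_le_1)

text \<open>The step in progress at \<open>t\<close> contributes no reward, so integrating it out
  leaves only the tail of its waiting time.\<close>

lemma nn_integral_W:
  assumes f: "f \<in> borel_measurable borel" and t: "t \<ge> 0"
  shows "(\<integral>\<^sup>+\<omega>. f (W t \<omega>) \<partial>M) =
    (\<Sum>n. \<integral>\<^sup>+x. f (snd x) * indicator {x. fst x \<le> t} x * tail (t - fst x) \<partial>law n)"
proof -
  have "(\<integral>\<^sup>+\<omega>. f (W t \<omega>) \<partial>M) = (\<integral>\<^sup>+\<omega>. (\<Sum>n. W_term t f (Zsum n \<omega>) (Z (Suc n) \<omega>)) \<partial>M)"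
    by (intro nn_integral_cong apply_W_eq_suminf t)
  also have "\<dots> = (\<Sum>n. \<integral>\<^sup>+\<omega>. W_term t f (Zsum n \<omega>) (Z (Suc n) \<omega>) \<partial>M)"
    using f by (intro nn_integral_suminf measurable_W_term_Zsum)
  also have "\<dots> = (\<Sum>n. \<integral>\<^sup>+x. (\<integral>\<^sup>+z. W_term t f x z \<partial>step_law) \<partial>law n)"
    by (intro suminf_cong nn_integral_Zsum_step measurable_W_term f)
  also have "\<dots> = (\<Sum>n. \<integral>\<^sup>+x. f (snd x) * indicator {x. fst x \<le> t} x * tail (t - fst x) \<partial>law n)"
  proof (intro suminf_cong nn_integral_cong)
    fix n and x :: "real \<times> 'a"
    have m: "{z :: real \<times> 'a. t < fst x + fst z} \<in> sets borel"
      by (intro borel_open open_Collect_less continuous_intros)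
    have "(\<integral>\<^sup>+z. W_term t f x z \<partial>step_law) =
      (\<integral>\<^sup>+z. f (snd x) * indicator {x. fst x \<le> t} x * indicator {z. t < fst x + fst z} z \<partial>step_law)"
      by (intro nn_integral_cong) (simp add: W_term_def indicator_def)
    also have "\<dots> = f (snd x) * indicator {x. fst x \<le> t} x * emeasure step_law {z. t < fst x + fst z}"
      using m by (intro nn_integral_cmult_indicator) simp
    also have "emeasure step_law {z. t < fst x + fst z} = tail (t - fst x)"
      using m unfolding step_law_def tail_def
      by (subst emeasure_distr[OF Z_measurable]) (auto simp: Z_def intro!: arg_cong[where f = "emeasure M"])
    finally show "(\<integral>\<^sup>+z. W_term t f x z \<partial>step_law) = f (snd x) * indicator {x. fst x \<le> t} x * tail (t - fst x)" .
  qed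
  finally show ?thesis .
qed

lemma emeasure_W:
  assumes A: "A \<in> sets borel" and t: "t \<ge> 0"
  shows "W_prob t A =
    (\<Sum>n. \<integral>\<^sup>+x. indicator {v. v /\<^sub>R t \<in> A} (snd x) * indicator {x. fst x \<le> t} x * tail (t - fst x) \<partial>law n)"
proof -
  have B: "{v. v /\<^sub>R t \<in> A} \<in> sets borel" using A by (rule sets_divideR_borel)
  note [measurable] = W_measurable[OF t] B
  have "{\<omega>\<in>space M. W t \<omega> /\<^sub>R t \<in> A} = W t -` {v. v /\<^sub>R t \<in> A} \<inter> space M" by auto
  then have m: "{\<omega>\<in>space M. W t \<omega> /\<^sub>R t \<in> A} \<in> sets M" using measurable_sets[OF W_measurable[OF t] B] by simp
  have "W_prob t A = (\<integral>\<^sup>+\<omega>. indicator {\<omega>\<in>space M. W t \<omega> /\<^sub>R t \<in> A} \<omega> \<partial>M)"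
    using m by simp
  also have "\<dots> = (\<integral>\<^sup>+\<omega>. indicator {v. v /\<^sub>R t \<in> A} (W t \<omega>) \<partial>M)"
    by (intro nn_integral_cong) (auto simp: indicator_def)
  also have "\<dots> = (\<Sum>n. \<integral>\<^sup>+x. indicator {v. v /\<^sub>R t \<in> A} (snd x) * indicator {x. fst x \<le> t} x * tail (t - fst x) \<partial>law n)"
    by (rule nn_integral_W[OF _ t]) measurable
  finally show ?thesis .
qed

text \<open>With x the n-th renewal time, the tail bound exp (- \<zeta> (t - x)) and the integrand
  combine into exp (- \<zeta> t) times the exponential weight of the pair, whose integral is the
  n-th power of \<open>mgf\<close>; the sum over n is geometric.\<close>

lemma W_chernoff:
  fixes \<phi> :: "'a \<Rightarrow>\<^sub>L real"
  assumes C: "C \<ge> 0" "\<And>u. u \<ge> 0 \<Longrightarrow> tail u \<le> ennreal (C * exp (- \<zeta> * u))"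
    and \<rho>: "mgf \<zeta> \<phi> \<le> ennreal \<rho>" "0 \<le> \<rho>" "\<rho> < 1" and t: "t \<ge> 0"
  shows "(\<integral>\<^sup>+\<omega>. ennreal (exp (\<phi> (W t \<omega>))) \<partial>M) \<le> ennreal (C / (1 - \<rho>) * exp (- \<zeta> * t))"
proof -
  have "(\<integral>\<^sup>+\<omega>. ennreal (exp (\<phi> (W t \<omega>))) \<partial>M) =
    (\<Sum>n. \<integral>\<^sup>+x. ennreal (exp (\<phi> (snd x))) * indicator {x. fst x \<le> t} x * tail (t - fst x) \<partial>law n)"
    by (rule nn_integral_W[OF _ t]) measurable
  also have "\<dots> \<le> ennreal (C * exp (- \<zeta> * t) / (1 - \<rho>))"
  proof (rule suminf_ennreal_geometric_le)
    fix n
    have "(\<integral>\<^sup>+x. ennreal (exp (\<phi> (snd x))) * indicator {x. fst x \<le> t} x * tail (t - fst x) \<partial>law n)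
      \<le> (\<integral>\<^sup>+x. ennreal (C * exp (- \<zeta> * t)) * ennreal (exp (\<zeta> * fst x + \<phi> (snd x))) \<partial>law n)"
    proof (rule nn_integral_mono)
      fix x
      show "ennreal (exp (\<phi> (snd x))) * indicator {x. fst x \<le> t} x * tail (t - fst x)
        \<le> ennreal (C * exp (- \<zeta> * t)) * ennreal (exp (\<zeta> * fst x + \<phi> (snd x)))"
      proof (cases "fst x \<le> t")
        case True
        then have "ennreal (exp (\<phi> (snd x))) * tail (t - fst x) \<le>
          ennreal (exp (\<phi> (snd x))) * ennreal (C * exp (- \<zeta> * (t - fst x)))"
          by (intro mult_left_mono C) auto
        also have "\<dots> = ennreal (C * exp (\<phi> (snd x) + - \<zeta> * (t - fst x)))"
          using C(1) by (simp only: exp_add) (simp add: ennreal_mult[symmetric] mult.left_commute)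
        also have "\<phi> (snd x) + - \<zeta> * (t - fst x) = - \<zeta> * t + (\<zeta> * fst x + \<phi> (snd x))"
          by (simp add: algebra_simps)
        also have "ennreal (C * exp \<dots>) = ennreal (C * exp (- \<zeta> * t)) * ennreal (exp (\<zeta> * fst x + \<phi> (snd x)))"
          using C(1) by (simp only: exp_add) (simp add: ennreal_mult[symmetric] mult.assoc)
        finally show ?thesis using True by simp
      qed simp
    qed
    also have "\<dots> = ennreal (C * exp (- \<zeta> * t)) * mgf \<zeta> \<phi> ^ n"
      using borel_measurable_bounded_linear[OF bounded_linear_prod_real[of \<zeta> \<phi>]]
      by (subst nn_integral_cmult) (auto simp: nn_integral_law_exp)
    also have "\<dots> \<le> ennreal (C * exp (- \<zeta> * t)) * ennreal \<rho> ^ n"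
      by (intro mult_left_mono power_mono \<rho>) auto
    also have "\<dots> = ennreal (C * exp (- \<zeta> * t) * \<rho> ^ n)"
      using C(1) \<rho> by (simp add: ennreal_mult ennreal_power)
    finally show "(\<integral>\<^sup>+x. ennreal (exp (\<phi> (snd x))) * indicator {x. fst x \<le> t} x * tail (t - fst x) \<partial>law n)
      \<le> ennreal (C * exp (- \<zeta> * t) * \<rho> ^ n)" .
  qed (use C \<rho> in auto)
  finally show ?thesis by simp
qed

section \<open>Exponential upper bounds near points, on compact sets and on convex sets\<close>

definition exp_bounded :: "'a set \<Rightarrow> real \<Rightarrow> bool" where
  "exp_bounded A a \<longleftrightarrow>
     (\<exists>C. \<forall>t\<ge>1. W_prob t A \<le> ennreal (C * exp (- t * a)))"

lemma exp_bounded_mono_Un: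
  assumes "finite F" "\<And>i. i \<in> F \<Longrightarrow> exp_bounded (U i) a" "\<And>i. i \<in> F \<Longrightarrow> U i \<in> sets borel"
    "A \<subseteq> (\<Union>i\<in>F. U i)"
  shows "exp_bounded A a"
proof -
  obtain C where C: "\<And>i t. i \<in> F \<Longrightarrow> t \<ge> 1 \<Longrightarrow>
    W_prob t (U i) \<le> ennreal (C i * exp (- t * a))"
    using assms(2) unfolding exp_bounded_def by metis
  show ?thesis unfolding exp_bounded_def
  proof (intro exI allI impI)
    fix t :: real assume t: "t \<ge> 1"
    have m: "{\<omega>\<in>space M. W t \<omega> /\<^sub>R t \<in> U i} \<in> sets M" if "i \<in> F" for i
    proof -
      have "{v. v /\<^sub>R t \<in> U i} \<in> sets borel" using assms(3)[OF that] by (rule sets_divideR_borel)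
      from measurable_sets[OF W_measurable this, of t] t show ?thesis
        by (simp add: vimage_def Int_def conj_commute)
    qed
    have "W_prob t A \<le> emeasure M (\<Union>i\<in>F. {\<omega>\<in>space M. W t \<omega> /\<^sub>R t \<in> U i})"
      using assms(1,4) m by (intro emeasure_mono) auto
    also have "\<dots> \<le> (\<Sum>i\<in>F. W_prob t (U i))"
      using assms(1) m by (intro emeasure_subadditive_finite) auto
    also have "\<dots> \<le> (\<Sum>i\<in>F. ennreal (\<bar>C i\<bar> * exp (- t * a)))"
    proof (rule sum_mono)
      fix i assume "i \<in> F"
      have "C i * exp (- t * a) \<le> \<bar>C i\<bar> * exp (- t * a)" by (simp add: mult_right_mono)
      then show "W_prob t (U i) \<le> ennreal (\<bar>C i\<bar> * exp (- t * a))"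
        using C[OF \<open>i \<in> F\<close> t] by (meson ennreal_leI order_trans)
    qed
    also have "\<dots> = ennreal ((\<Sum>i\<in>F. \<bar>C i\<bar>) * exp (- t * a))"
      by (simp add: sum_distrib_right)
    finally show "W_prob t A \<le> ennreal ((\<Sum>i\<in>F. \<bar>C i\<bar>) * exp (- t * a))" .
  qed
qed

lemma limsup_le_of_exp_bounded:
  assumes "\<And>a. ereal a < B \<Longrightarrow> exp_bounded F a"
  shows "Limsup at_top (scaled_log_prob M S X F) \<le> - B"
  unfolding scaled_log_prob_def[abs_def]
  using assms unfolding exp_bounded_def by (intro Limsup_scaled_ln_ext_le)

lemma W_markov:
  fixes \<phi> :: "'a \<Rightarrow>\<^sub>L real"
  assumes bd: "(\<integral>\<^sup>+\<omega>. ennreal (exp (\<phi> (W t \<omega>))) \<partial>M) \<le> ennreal c" and t: "t > 0"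
    and A: "A \<in> sets borel" "\<And>v. v \<in> A \<Longrightarrow> b \<le> \<phi> v" and c: "0 \<le> c"
  shows "W_prob t A \<le> ennreal (exp (- t * b) * c)"
proof -
  let ?E = "{\<omega>\<in>space M. W t \<omega> /\<^sub>R t \<in> A}"
  have "{v. v /\<^sub>R t \<in> A} \<in> sets borel" using A(1) by (rule sets_divideR_borel)
  from measurable_sets[OF W_measurable this, of t] t have m: "?E \<in> sets M"
    by (simp add: vimage_def Int_def conj_commute)
  have [measurable]: "W t \<in> borel_measurable M" using t by (intro W_measurable) simp
  have "emeasure M ?E = (\<integral>\<^sup>+\<omega>. indicator ?E \<omega> \<partial>M)" using m by simp
  also have "\<dots> \<le> (\<integral>\<^sup>+\<omega>. ennreal (exp (- t * b)) * ennreal (exp (\<phi> (W t \<omega>))) \<partial>M)"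
  proof (rule nn_integral_mono)
    fix \<omega>
    show "indicator ?E \<omega> \<le> ennreal (exp (- t * b)) * ennreal (exp (\<phi> (W t \<omega>)))"
    proof (cases "\<omega> \<in> ?E")
      case True
      then have "b \<le> \<phi> (W t \<omega> /\<^sub>R t)" using A(2) by simp
      then have "0 \<le> - t * b + \<phi> (W t \<omega>)" using t by (simp add: blinfun.scaleR_right field_simps)
      then have "1 \<le> exp (- t * b + \<phi> (W t \<omega>))" by simp
      then have "1 \<le> ennreal (exp (- t * b) * exp (\<phi> (W t \<omega>)))" by (simp only: exp_add ennreal_ge_1)
      then show ?thesis using True by (simp add: ennreal_mult)
    qed simp
  qed
  also have "\<dots> = ennreal (exp (- t * b)) * (\<integral>\<^sup>+\<omega>. ennreal (exp (\<phi> (W t \<omega>))) \<partial>M)"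
    by (rule nn_integral_cmult) measurable
  also have "\<dots> \<le> ennreal (exp (- t * b)) * ennreal c" by (intro mult_left_mono bd) simp
  also have "\<dots> = ennreal (exp (- t * b) * c)" using c by (simp add: ennreal_mult)
  finally show ?thesis .
qed

lemma mgf_less_obtain:
  assumes "mgf \<zeta> \<phi> < 1"
  obtains \<rho> where "mgf \<zeta> \<phi> \<le> ennreal \<rho>" "0 \<le> \<rho>" "\<rho> < 1"
proof -
  obtain \<rho> where \<rho>: "\<rho> \<ge> 0" "mgf \<zeta> \<phi> = ennreal \<rho>" using assms by (cases "mgf \<zeta> \<phi>") auto
  then have "\<rho> < 1" using assms by (metis ennreal_1 ennreal_less_iff)
  with \<rho> show thesis by (intro that[of \<rho>]) auto
qed

lemma exp_bounded_local:
  assumes T: "(\<zeta>, \<phi>) \<in> Theta" "ereal \<zeta> \<le> ell_s M (S 1)" and a: "a < \<zeta> + \<phi> w"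
  obtains U where "open U" "w \<in> U" "exp_bounded U a"
proof -
  \<comment> \<open>Half of the slack. Lowering \<zeta> by \<open>e\<close> makes it strictly
    smaller than \<open>ell_s\<close> and its moment strictly smaller than 1; the other half leaves
    room for a neighbourhood of \<open>w\<close>.\<close>
  define e where "e = (\<zeta> + \<phi> w - a) / 2"
  have e: "e > 0" using a by (simp add: e_def)
  have "ereal (\<zeta> - e) < ereal \<zeta>" using e by simp
  then have "ereal (\<zeta> - e) < ell_s M (S 1)" using T(2) by (rule less_le_trans)
  then obtain C where C: "C \<ge> 0" "\<And>u. u \<ge> 0 \<Longrightarrow> tail u \<le> ennreal (C * exp (- (\<zeta> - e) * u))"
    using tail_bound_of_ell_s[OF prob_space_axioms] unfolding tail_def by metis
  have "mgf (\<zeta> - e) \<phi> < 1" using mgf_strict[OF T(1)] e by simp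
  then obtain \<rho> where \<rho>: "mgf (\<zeta> - e) \<phi> \<le> ennreal \<rho>" "0 \<le> \<rho>" "\<rho> < 1" by (rule mgf_less_obtain)
  define U where "U = {v. a + e - \<zeta> < \<phi> v}"
  have "open U" unfolding U_def by (intro open_Collect_less continuous_intros)
  moreover have "w \<in> U" using e by (simp add: U_def e_def field_simps)
  moreover have "exp_bounded U a" unfolding exp_bounded_def
  proof (intro exI allI impI)
    fix t :: real assume t: "t \<ge> 1"
    have "W_prob t U \<le>
      ennreal (exp (- t * (a + e - \<zeta>)) * (C / (1 - \<rho>) * exp (- (\<zeta> - e) * t)))"
    proof (rule W_markov)
      show "(\<integral>\<^sup>+\<omega>. ennreal (exp (\<phi> (W t \<omega>))) \<partial>M) \<le> ennreal (C / (1 - \<rho>) * exp (- (\<zeta> - e) * t))"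
        using t by (intro W_chernoff C \<rho>) auto
    qed (use t C \<rho> \<open>open U\<close> in \<open>auto simp: U_def\<close>)
    also have "exp (- t * (a + e - \<zeta>)) * (C / (1 - \<rho>) * exp (- (\<zeta> - e) * t))
      = C / (1 - \<rho>) * (exp (- t * (a + e - \<zeta>)) * exp (- (\<zeta> - e) * t))" by (simp only: ac_simps)
    also have "exp (- t * (a + e - \<zeta>)) * exp (- (\<zeta> - e) * t) = exp (- t * a)"
      by (simp add: exp_add[symmetric] algebra_simps)
    finally show "W_prob t U \<le> ennreal (C / (1 - \<rho>) * exp (- t * a))" .
  qed
  ultimately show thesis by (rule that)
qed

lemma ell_s_nonneg: "0 \<le> ell_s M (S 1)"
proof -
  have "Limsup at_top (\<lambda>s::real. ereal (1 / s) * ln_ext (emeasure M {\<omega>\<in>space M. s < S 1 \<omega>})) \<le> ereal 0"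
  proof (rule Limsup_bounded)
    show "\<forall>\<^sub>F s in at_top. ereal (1 / s) * ln_ext (emeasure M {\<omega>\<in>space M. s < S 1 \<omega>}) \<le> ereal 0"
      using eventually_gt_at_top[of 0]
      by eventually_elim (subst scaled_ln_ext_le_iff, auto intro: emeasure_le_1)
  qed
  then show ?thesis by (simp add: ell_s_def ereal_0_le_uminus_iff flip: zero_ereal_def)
qed

lemma ell_s_le_ell_i: "ell_s M (S 1) \<le> ell_i M (S 1)"
  unfolding ell_s_def ell_i_def by (simp add: Liminf_le_Limsup)

lemma exp_bounded_compact:
  assumes F: "compact F" and a: "ereal a < (INF w\<in>F. rate_I_s M S X w)"
  shows "exp_bounded F a"
proof -
  have "\<exists>U. open U \<and> w \<in> U \<and> exp_bounded U a" if "w \<in> F" for w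
  proof -
    have "ereal a < rate_I M (S 1) (X 1) (ell_s M (S 1)) w"
      using a that unfolding rate_I_s_def by (meson INF_lower less_le_trans)
    then show ?thesis
      using rate_I_dual[OF _ ell_s_nonneg] exp_bounded_local by metis
  qed
  then obtain U where U: "\<And>w. w \<in> F \<Longrightarrow> open (U w)" "\<And>w. w \<in> F \<Longrightarrow> w \<in> U w" "\<And>w. w \<in> F \<Longrightarrow> exp_bounded (U w) a"
    by metis
  obtain F' where F': "F' \<subseteq> F" "finite F'" "F \<subseteq> (\<Union>w\<in>F'. U w)"
    using compactE_image[OF F, of F U] U by (metis UN_I subsetI)
  show ?thesis
    by (rule exp_bounded_mono_Un[OF F'(2) _ _ F'(3)]) (use U F' in auto)
qed

text \<open>
  The integral is supermultiplicative along multiples of \<open>t\<close>, and the finite cover costs only a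
  constant factor, which disappears on taking k-th roots.
\<close>

lemma law_compact_convex_bound:
  assumes D: "compact D" "convex D" and t: "t > 0"
    and sep: "\<And>w. w \<in> D \<Longrightarrow> \<exists>\<zeta>' \<phi>. (\<zeta>', \<phi>) \<in> Theta \<and> \<zeta>' \<le> \<zeta> \<and> a < \<zeta>' + blinfun_apply \<phi> w"
  shows "(\<integral>\<^sup>+x. ennreal (exp (\<zeta> * fst x)) * indicator {x. x /\<^sub>R t \<in> {..1::real} \<times> D} x \<partial>law n)
    \<le> ennreal (exp (- t * (a - \<zeta>)))"
proof -
  obtain z \<phi> where z: "\<And>w. w \<in> D \<Longrightarrow> (z w, \<phi> w) \<in> Theta" "\<And>w. w \<in> D \<Longrightarrow> z w \<le> \<zeta>"
    "\<And>w. w \<in> D \<Longrightarrow> a < z w + blinfun_apply (\<phi> w) w"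
    using sep by metis
  define U where "U w = {v. a < z w + blinfun_apply (\<phi> w) v}" for w
  have "open (U w)" for w unfolding U_def by (intro open_Collect_less continuous_intros)
  moreover have "w \<in> U w" if "w \<in> D" for w using z that by (simp add: U_def)
  ultimately obtain F where F: "F \<subseteq> D" "finite F" "D \<subseteq> (\<Union>w\<in>F. U w)"
    using compactE_image[OF D(1), of D U] by (metis UN_I subsetI)
  have Dm: "{..1::real} \<times> D \<in> sets borel"
    using D by (intro borel_closed closed_Times) (auto simp: compact_imp_closed)
  have bl: "bounded_linear (\<lambda>x::real \<times> 'a. \<zeta> * fst x)"
    using bounded_linear_prod_real[of \<zeta> 0] by simp
  show ?thesis
  proof (rule ennreal_le_of_power_le[where c = "real (card F)"])
    fix k :: nat assume k: "k \<ge> 1"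
    let ?kt = "real k * t"
    have kt: "?kt > 0" using k t by simp
    have term_le: "(\<integral>\<^sup>+x. ennreal (exp (?kt * (\<zeta> - a)) * exp (z w * fst x + \<phi> w (snd x))) \<partial>law (n * k))
      \<le> ennreal (exp (- t * (a - \<zeta>)) ^ k)" if "w \<in> F" for w
    proof -
      have "(\<integral>\<^sup>+x. ennreal (exp (?kt * (\<zeta> - a)) * exp (z w * fst x + \<phi> w (snd x))) \<partial>law (n * k))
        = ennreal (exp (?kt * (\<zeta> - a))) * mgf (z w) (\<phi> w) ^ (n * k)"
        using borel_measurable_bounded_linear[OF bounded_linear_prod_real[of "z w" "\<phi> w"]]
        by (simp add: ennreal_mult nn_integral_cmult nn_integral_law_exp)
      also have "\<dots> \<le> ennreal (exp (?kt * (\<zeta> - a))) * 1"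
        using z(1)[of w] that F(1) by (intro mult_left_mono power_le_one) (auto simp: Theta_def)
      also have "ennreal (exp (?kt * (\<zeta> - a))) * 1 = ennreal (exp (real k * (- t * (a - \<zeta>))))"
        by (simp add: algebra_simps)
      finally show ?thesis by (simp only: exp_of_nat_mult)
    qed
    have "(\<integral>\<^sup>+x. ennreal (exp (\<zeta> * fst x)) * indicator {x. x /\<^sub>R t \<in> {..1::real} \<times> D} x \<partial>law n) ^ k
      \<le> (\<integral>\<^sup>+x. ennreal (exp (\<zeta> * fst x)) * indicator {x. x /\<^sub>R ?kt \<in> {..1::real} \<times> D} x \<partial>law (n * k))"
      using D by (intro law_power[OF bl _ Dm t k] convex_Times) auto
    also have "\<dots> \<le> (\<integral>\<^sup>+x. (\<Sum>w\<in>F. ennreal (exp (?kt * (\<zeta> - a)) * exp (z w * fst x + \<phi> w (snd x)))) \<partial>law (n * k))"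
    proof (rule nn_integral_mono)
      fix x :: "real \<times> 'a"
      show "ennreal (exp (\<zeta> * fst x)) * indicator {x. x /\<^sub>R ?kt \<in> {..1::real} \<times> D} x
        \<le> (\<Sum>w\<in>F. ennreal (exp (?kt * (\<zeta> - a)) * exp (z w * fst x + \<phi> w (snd x))))"
      proof (cases "x /\<^sub>R ?kt \<in> {..1::real} \<times> D")
        case True
        then have fx: "fst x / ?kt \<le> 1" and sx: "snd x /\<^sub>R ?kt \<in> D"
          by (auto simp: mem_Times_iff field_simps)
        have fx': "fst x \<le> ?kt" using fx kt by (simp add: divide_le_eq)
        obtain w where w: "w \<in> F" "snd x /\<^sub>R ?kt \<in> U w" using F(3) sx by blast
        have "a < z w + \<phi> w (snd x) / ?kt"
          using w(2) by (simp add: U_def blinfun.scaleR_right field_simps)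
        then have "a - z w < \<phi> w (snd x) / ?kt" by simp
        then have 1: "?kt * (a - z w) \<le> \<phi> w (snd x)"
          using pos_less_divide_eq[OF kt, of "a - z w"] by (simp add: mult.commute)
        \<comment> \<open>Each pair has time slope at most \<zeta>, so the excess slope times the
          elapsed time is largest at the upper limit of time.\<close>
        have "(\<zeta> - z w) * fst x \<le> (\<zeta> - z w) * ?kt"
          using z(2)[of w] w(1) F(1) fx' by (intro mult_left_mono) auto
        then have "\<zeta> * fst x \<le> ?kt * (\<zeta> - a) + (z w * fst x + \<phi> w (snd x))"
          using 1 by (simp add: algebra_simps)
        then have "exp (\<zeta> * fst x) \<le> exp (?kt * (\<zeta> - a)) * exp (z w * fst x + \<phi> w (snd x))"
          by (simp only: exp_add[symmetric] exp_le_cancel_iff)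
        then have "ennreal (exp (\<zeta> * fst x)) \<le> ennreal (exp (?kt * (\<zeta> - a)) * exp (z w * fst x + \<phi> w (snd x)))"
          by (rule ennreal_leI)
        also have "\<dots> \<le> (\<Sum>w\<in>F. ennreal (exp (?kt * (\<zeta> - a)) * exp (z w * fst x + \<phi> w (snd x))))"
          using w(1) F(2) by (intro member_le_sum) auto
        finally show ?thesis using True by simp
      qed simp
    qed
    also have "\<dots> = (\<Sum>w\<in>F. \<integral>\<^sup>+x. ennreal (exp (?kt * (\<zeta> - a)) * exp (z w * fst x + \<phi> w (snd x))) \<partial>law (n * k))"
      using borel_measurable_bounded_linear[OF bounded_linear_prod_real]
      by (intro nn_integral_sum) measurable
    also have "\<dots> \<le> (\<Sum>w\<in>F. ennreal (exp (- t * (a - \<zeta>)) ^ k))" by (intro sum_mono term_le)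
    also have "\<dots> = ennreal (real (card F) * exp (- t * (a - \<zeta>)) ^ k)"
      by (simp add: ennreal_mult ennreal_of_nat_eq_real_of_nat)
    finally show "(\<integral>\<^sup>+x. ennreal (exp (\<zeta> * fst x)) * indicator {x. x /\<^sub>R t \<in> {..1::real} \<times> D} x \<partial>law n) ^ k
      \<le> ennreal (real (card F) * exp (- t * (a - \<zeta>)) ^ k)" .
  qed simp
qed

text \<open>Chebyshev for the pair (-1, 0), whose moment is below 1: many renewals before a fixed
  time are geometrically unlikely.\<close>

lemma law_time_bound:
  obtains \<rho> where "0 < \<rho>" "\<rho> < 1" "\<And>t n. emeasure (law n) {x. fst x \<le> t} \<le> ennreal (exp t * \<rho> ^ n)"
proof -
  have lt1: "mgf (- 1) 0 < 1" using mgf_strict[OF zero_in_Theta, of "- 1"] by simp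
  then obtain \<rho> where \<rho>: "mgf (- 1) 0 = ennreal \<rho>" "\<rho> \<ge> 0" by (cases "mgf (- 1) 0") auto
  have \<rho>1: "\<rho> < 1" using lt1 \<rho> by (metis ennreal_1 ennreal_less_iff)
  have \<rho>0: "\<rho> > 0" using mgf_pos[of "- 1" 0] \<rho> by simp
  show thesis
  proof (rule that[OF \<rho>0 \<rho>1])
    fix t n
    have m: "{x :: real \<times> 'a. fst x \<le> t} \<in> sets borel"
      by (intro borel_closed closed_Collect_le continuous_intros)
    have "emeasure (law n) {x. fst x \<le> t} = (\<integral>\<^sup>+x. indicator {x. fst x \<le> t} x \<partial>law n)" using m by simp
    also have "\<dots> \<le> (\<integral>\<^sup>+x. ennreal (exp t) * ennreal (exp (- 1 * fst x + blinfun_apply 0 (snd x))) \<partial>law n)"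
    proof (rule nn_integral_mono)
      fix x :: "real \<times> 'a"
      show "indicator {x. fst x \<le> t} x \<le> ennreal (exp t) * ennreal (exp (- 1 * fst x + blinfun_apply 0 (snd x)))"
        by (auto simp: indicator_def ennreal_mult[symmetric] exp_add[symmetric] ennreal_ge_1)
    qed
    also have "\<dots> = ennreal (exp t) * mgf (- 1) 0 ^ n"
      using borel_measurable_bounded_linear[OF bounded_linear_prod_real[of "- 1" 0]]
      by (subst nn_integral_cmult) (auto simp only: nn_integral_law_exp measurable_compose_rev, auto)
    also have "\<dots> = ennreal (exp t * \<rho> ^ n)" using \<rho> by (simp add: ennreal_mult ennreal_power)
    finally show "emeasure (law n) {x. fst x \<le> t} \<le> ennreal (exp t * \<rho> ^ n)" .
  qed
qed

text \<open>On a compact convex subset each term of the sum over the number of renewals has the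
  correct rate but no decay in that number; interpolation with the geometric time bound makes the
  sum converge at an arbitrarily small loss of rate. The constants do not depend on the subset, so
  inner regularity extends the bound to \<open>F\<close>.\<close>

lemma exp_bounded_convex:
  assumes F: "F \<in> sets borel"
    and hull: "\<And>C. compact C \<Longrightarrow> C \<subseteq> F \<Longrightarrow> \<exists>D. compact D \<and> convex D \<and> C \<subseteq> D \<and> D \<subseteq> F"
    and C: "C \<ge> 0" "\<And>u. u \<ge> 0 \<Longrightarrow> tail u \<le> ennreal (C * exp (- \<zeta> * u))"
    and sep: "\<And>w. w \<in> F \<Longrightarrow> \<exists>\<zeta>' \<phi>. (\<zeta>', \<phi>) \<in> Theta \<and> \<zeta>' \<le> \<zeta> \<and> a < \<zeta>' + blinfun_apply \<phi> w"
    and a': "a' < a"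
  shows "exp_bounded F a'"
proof -
  obtain \<rho> where \<rho>: "0 < \<rho>" "\<rho> < 1" "\<And>t n. emeasure (law n) {x. fst x \<le> t} \<le> ennreal (exp t * \<rho> ^ n)"
    using law_time_bound by metis
  \<comment> \<open>Interpolation with weight \<eta> replaces the rate \<open>a\<close> by a -
    \<eta> (a + 1), as the time bound has rate -1; the loss must not exceed a - a'.\<close>
  define \<eta> where "\<eta> = min 1 ((a - a') / (\<bar>a\<bar> + 1))"
  have "\<eta> \<le> (a - a') / (\<bar>a\<bar> + 1)" by (simp add: \<eta>_def)
  then have \<eta>: "0 < \<eta>" "\<eta> \<le> 1" "\<eta> * (\<bar>a\<bar> + 1) \<le> a - a'"
    using a' pos_le_divide_eq[of "\<bar>a\<bar> + 1" \<eta> "a - a'"] by (auto simp: \<eta>_def)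
  have \<eta>a: "\<eta> * (a + 1) \<le> a - a'"
    using mult_left_mono[of "a + 1" "\<bar>a\<bar> + 1" \<eta>] \<eta> by linarith
  \<comment> \<open>\<open>C\<close> may be 0, while the real powers in the interpolation call for a
    positive constant.\<close>
  define C1 where "C1 = max C 1"
  define q where "q = \<rho> powr \<eta>"
  have q: "0 < q" "q < 1" using \<rho> \<eta> powr_less_mono2[of \<eta> \<rho> 1] by (auto simp: q_def)
  define c where "c t = C1 powr (1 - \<eta>) * exp (- t * a')" for t
  have bound: "W_prob t D \<le> ennreal (c t / (1 - q))"
    if D: "compact D" "convex D" "D \<subseteq> F" and t: "t \<ge> 1" for D t
  proof -
    have Db: "D \<in> sets borel" using D by (simp add: compact_imp_closed)
    have m: "{x :: real \<times> 'a. fst x \<le> t} \<in> sets borel"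
      by (intro borel_closed closed_Collect_le continuous_intros)
    have "(\<Sum>n. \<integral>\<^sup>+x. indicator {v. v /\<^sub>R t \<in> D} (snd x) * indicator {x. fst x \<le> t} x * tail (t - fst x) \<partial>law n)
      \<le> ennreal (c t / (1 - q))"
    proof (rule suminf_ennreal_geometric_le)
      fix n
      let ?p = "\<integral>\<^sup>+x. indicator {v. v /\<^sub>R t \<in> D} (snd x) * indicator {x. fst x \<le> t} x * tail (t - fst x) \<partial>law n"
      have "?p \<le> (\<integral>\<^sup>+x. indicator {x. fst x \<le> t} x \<partial>law n)"
        using tail_le_1 by (intro nn_integral_mono) (auto simp: indicator_def)
      also have "\<dots> \<le> ennreal (exp t * \<rho> ^ n)" using m \<rho>(3)[of n t] by simp
      finally have 1: "?p \<le> ennreal (exp t * \<rho> ^ n)" .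
      have "?p \<le> (\<integral>\<^sup>+x. ennreal (C1 * exp (- \<zeta> * t)) *
        (ennreal (exp (\<zeta> * fst x)) * indicator {x. x /\<^sub>R t \<in> {..1::real} \<times> D} x) \<partial>law n)"
      proof (rule nn_integral_mono)
        fix x :: "real \<times> 'a"
        show "indicator {v. v /\<^sub>R t \<in> D} (snd x) * indicator {x. fst x \<le> t} x * tail (t - fst x)
          \<le> ennreal (C1 * exp (- \<zeta> * t)) * (ennreal (exp (\<zeta> * fst x)) * indicator {x. x /\<^sub>R t \<in> {..1::real} \<times> D} x)"
        proof (cases "snd x /\<^sub>R t \<in> D \<and> fst x \<le> t")
          case True
          then have "x /\<^sub>R t \<in> {..1::real} \<times> D" using t by (auto simp: mem_Times_iff field_simps)
          moreover have "tail (t - fst x) \<le> ennreal (C1 * exp (- \<zeta> * t)) * ennreal (exp (\<zeta> * fst x))"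
          proof -
            have "tail (t - fst x) \<le> ennreal (C * exp (- \<zeta> * (t - fst x)))" using True by (intro C) simp
            also have "\<dots> \<le> ennreal (C1 * exp (- \<zeta> * (t - fst x)))"
              by (intro ennreal_leI mult_right_mono) (auto simp: C1_def)
            also have "- \<zeta> * (t - fst x) = - \<zeta> * t + \<zeta> * fst x" by (simp add: algebra_simps)
            also have "ennreal (C1 * exp (- \<zeta> * t + \<zeta> * fst x)) = ennreal (C1 * exp (- \<zeta> * t)) * ennreal (exp (\<zeta> * fst x))"
              using C(1) by (simp only: exp_add) (simp add: C1_def ennreal_mult[symmetric] mult.assoc)
            finally show ?thesis .
          qed
          ultimately show ?thesis using True by simp
        qed auto
      qed
      also have "\<dots> = ennreal (C1 * exp (- \<zeta> * t)) *
        (\<integral>\<^sup>+x. ennreal (exp (\<zeta> * fst x)) * indicator {x. x /\<^sub>R t \<in> {..1::real} \<times> D} x \<partial>law n)"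
      proof (rule nn_integral_cmult)
        have "{..1::real} \<times> D \<in> sets borel"
          using D by (intro borel_closed closed_Times) (auto simp: compact_imp_closed)
        then have [measurable]: "{x. x /\<^sub>R t \<in> {..1::real} \<times> D} \<in> sets borel" by (rule sets_divideR_borel)
        show "(\<lambda>x. ennreal (exp (\<zeta> * fst x)) * indicator {x. x /\<^sub>R t \<in> {..1::real} \<times> D} x) \<in> borel_measurable (law n)"
          by measurable
      qed
      also have "\<dots> \<le> ennreal (C1 * exp (- \<zeta> * t)) * ennreal (exp (- t * (a - \<zeta>)))"
        using D t sep by (intro mult_left_mono law_compact_convex_bound) auto
      also have "\<dots> = ennreal (C1 * exp (- t * a))"
        by (simp add: C1_def ennreal_mult[symmetric] mult.assoc exp_add[symmetric] algebra_simps)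
      finally have 2: "?p \<le> ennreal (C1 * exp (- t * a))" .
      have "?p \<le> ennreal ((C1 * exp (- t * a)) powr (1 - \<eta>) * (exp t * \<rho> ^ n) powr \<eta>)"
        using 1 2 \<eta> \<rho> by (intro le_powr_interpolation) (auto simp: C1_def)
      also have "\<dots> \<le> ennreal (c t * q ^ n)"
      proof (rule ennreal_leI)
        have "(\<rho> ^ n) powr \<eta> = q ^ n" using \<rho> by (simp add: q_def powr_powr powr_realpow[symmetric] mult.commute)
        then have "(C1 * exp (- t * a)) powr (1 - \<eta>) * (exp t * \<rho> ^ n) powr \<eta>
          = C1 powr (1 - \<eta>) * (exp (- t * a) powr (1 - \<eta>) * exp t powr \<eta>) * q ^ n"
          using \<rho> by (simp add: powr_mult C1_def)
        also have "exp (- t * a) powr (1 - \<eta>) * exp t powr \<eta> = exp (- t * a * (1 - \<eta>) + t * \<eta>)"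
          by (simp add: powr_def exp_add[symmetric] mult.commute)
        also have "- t * a * (1 - \<eta>) + t * \<eta> = - t * (a - \<eta> * (a + 1))" by (simp add: algebra_simps)
        also have "C1 powr (1 - \<eta>) * exp (- t * (a - \<eta> * (a + 1))) * q ^ n \<le> c t * q ^ n"
        proof -
          have "- t * (a - \<eta> * (a + 1)) \<le> - t * a'"
            using mult_left_mono[of a' "a - \<eta> * (a + 1)" t] \<eta>a t by simp
          then show ?thesis unfolding c_def using q by (intro mult_right_mono mult_left_mono) auto
        qed
        finally show "(C1 * exp (- t * a)) powr (1 - \<eta>) * (exp t * \<rho> ^ n) powr \<eta> \<le> c t * q ^ n" .
      qed
      finally show "?p \<le> ennreal (c t * q ^ n)" .
    qed (use q in \<open>auto simp: c_def\<close>)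
    then show ?thesis using t by (subst emeasure_W[OF Db]) auto
  qed
  show ?thesis unfolding exp_bounded_def
  proof (intro exI allI impI)
    fix t :: real assume t: "t \<ge> 1"
    define V where "V \<omega> = W t \<omega> /\<^sub>R t" for \<omega>
    have V: "V \<in> borel_measurable M"
    proof -
      have [measurable]: "W t \<in> borel_measurable M" using t by (intro W_measurable) simp
      show ?thesis unfolding V_def[abs_def] by measurable
    qed
    have eq: "emeasure (distr M borel V) A = W_prob t A" if "A \<in> sets borel" for A
      using that by (subst emeasure_distr[OF V]) (auto simp: V_def intro!: arg_cong[where f = "emeasure M"])
    have "emeasure (distr M borel V) F = (SUP K \<in> {K. K \<subseteq> F \<and> compact K}. emeasure (distr M borel V) K)"
    proof (rule inner_regular)
      show "emeasure (distr M borel V) (space (distr M borel V)) \<noteq> \<infinity>"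
        using prob_space.emeasure_space_1[OF prob_space_distr[OF V]] by simp
    qed (use F in auto)
    also have "\<dots> \<le> ennreal (c t / (1 - q))"
    proof (rule SUP_least)
      fix K assume "K \<in> {K. K \<subseteq> F \<and> compact K}"
      then obtain D where D: "compact D" "convex D" "K \<subseteq> D" "D \<subseteq> F" using hull by blast
      have "emeasure (distr M borel V) K \<le> emeasure (distr M borel V) D"
        using D by (intro emeasure_mono) (auto simp: compact_imp_closed)
      also have "\<dots> \<le> ennreal (c t / (1 - q))"
        using bound[OF D(1,2,4) t] eq[of D] D by (simp add: compact_imp_closed)
      finally show "emeasure (distr M borel V) K \<le> ennreal (c t / (1 - q))" .
    qed
    finally have "W_prob t F \<le> ennreal (c t / (1 - q))" using eq[OF F] by simp
    then show "W_prob t F \<le> ennreal (C1 powr (1 - \<eta>) / (1 - q) * exp (- t * a'))"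
      by (simp add: c_def)
  qed
qed

end


section \<open>Lower bound for open sets\<close>

lemma le_ln_ext_iff: "ereal x \<le> ln_ext p \<longleftrightarrow> ennreal (exp x) \<le> p"
proof (cases p)
  case (real r)
  have "x \<le> ln r \<longleftrightarrow> exp x \<le> r" if "r > 0" using that by (metis exp_le_cancel_iff exp_ln)
  with real show ?thesis by (cases "r = 0") (auto simp: ln_ext_def not_le)
qed (simp add: ln_ext_def)

lemma le_scaled_ln_ext_iff:
  assumes "t > 0"
  shows "ereal x \<le> ereal (1 / t) * ln_ext p \<longleftrightarrow> ennreal (exp (t * x)) \<le> p"
proof -
  have "ereal x \<le> ereal (1 / t) * q \<longleftrightarrow> ereal (t * x) \<le> q" for q
    using assms by (cases q) (auto simp: field_simps)
  then show ?thesis by (simp add: le_ln_ext_iff)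
qed

lemma Liminf_scaled_ln_ext_ge:
  assumes "\<And>e. e > 0 \<Longrightarrow> \<forall>\<^sub>F t in at_top. ennreal (exp (- t * (c + e))) \<le> p t"
  shows "ereal (- c) \<le> Liminf at_top (\<lambda>t::real. ereal (1 / t) * ln_ext (p t))"
proof (rule ccontr)
  assume "\<not> ?thesis"
  then obtain d where d: "Liminf at_top (\<lambda>t::real. ereal (1 / t) * ln_ext (p t)) < ereal d" "ereal d < ereal (- c)"
    using ereal_dense2 by (meson not_le)
  then have "- c - d > 0" by simp
  from assms[OF this] have "\<forall>\<^sub>F t in at_top. ereal d \<le> ereal (1 / t) * ln_ext (p t)"
    using eventually_gt_at_top[of 0]
    by eventually_elim (simp add: le_scaled_ln_ext_iff)
  then have "ereal d \<le> Liminf at_top (\<lambda>t::real. ereal (1 / t) * ln_ext (p t))" by (rule Liminf_bounded)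
  with d(1) show False by simp
qed

lemma small_radius:
  fixes b1 b2 e1 e2 :: real
  assumes "0 \<le> b1" "0 \<le> b2" "0 < e1" "0 < e2" "0 < e3"
  obtains r where "0 < r" "r \<le> e3" "r * b1 \<le> e1" "r * b2 \<le> e2"
proof
  let ?r = "min e3 (min (e1 / (b1 + 1)) (e2 / (b2 + 1)))"
  show "0 < ?r" "?r \<le> e3" using assms by auto
  have "?r * b1 \<le> e1 / (b1 + 1) * (b1 + 1)" using assms by (intro mult_mono) auto
  then show "?r * b1 \<le> e1" using assms by simp
  have "?r * b2 \<le> e2 / (b2 + 1) * (b2 + 1)" using assms by (intro mult_mono) auto
  then show "?r * b2 \<le> e2" using assms by simp
qed

context renewal
begin

text \<open>Weak duality places every functional with moment at most 1 below
  \<open>rate_Upsilon\<close>, hence below \<open>A\<close> at the given point; the dual criterion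
  for achievability then applies.\<close>

lemma achievable_of_rate_Upsilon:
  assumes "rate_Upsilon M (S 1) (X 1) \<beta> w < ereal A"
  shows "achievable (\<beta>, w) A"
proof (rule achievable_of_dual)
  fix \<theta> :: "real \<times> 'a \<Rightarrow> real"
  assume \<theta>: "bounded_linear \<theta>" "(\<integral>\<^sup>+z. ennreal (exp (\<theta> z)) \<partial>step_law) \<le> 1"
  obtain \<zeta> \<phi> where eq: "\<And>z. \<theta> z = \<zeta> * fst z + blinfun_apply \<phi> (snd z)"
    using blinfun_prod_real[OF \<theta>(1)] by metis
  have "(\<zeta>, \<phi>) \<in> Theta" using \<theta>(2) by (simp add: Theta_def mgf_step_law eq)
  from rate_Upsilon_ge[OF this, of \<beta> w] have "ereal (\<beta> * \<zeta> + \<phi> w) < ereal A"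
    using assms by (rule le_less_trans)
  then show "\<theta> (\<beta>, w) < A" by (simp add: eq mult.commute)
qed

section \<open>Two ways to pass the time \<open>t\<close>: one long wait, or many short
  steps\<close>

lemma sets_W_divideR: "A \<in> sets borel \<Longrightarrow> t \<ge> 0 \<Longrightarrow> {\<omega>\<in>space M. W t \<omega> /\<^sub>R t \<in> A} \<in> sets M"
  using measurable_sets[OF W_measurable sets_divideR_borel, of t A t]
  by (simp add: vimage_def Int_def conj_commute)

text \<open>The condition on \<open>r\<close> keeps the n-th renewal before \<open>t\<close>, and
  the next waiting time exceeds whatever can be missing, so \<open>t\<close> falls into it and the
  reward is that of \<open>n\<close> steps.\<close>

lemma law_wait_le_W:
  assumes t: "t > 0" and r: "\<beta> + r \<le> 1"
  shows "emeasure (law n) {x. x /\<^sub>R t \<in> ball (\<beta>, w) r} * tail (t * (1 - \<beta> + r))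
    \<le> W_prob t (ball w r)"
proof -
  let ?A = "{x :: real \<times> 'a. x /\<^sub>R t \<in> ball (\<beta>, w) r}" and ?u = "t * (1 - \<beta> + r)"
  let ?B = "{z :: real \<times> 'a. ?u < fst z}"
  have A: "?A \<in> sets borel" by (simp add: sets_divideR_borel)
  have B: "?B \<in> sets borel" by (intro borel_open open_Collect_less continuous_intros)
  have "tail ?u = emeasure step_law ?B"
    using B unfolding step_law_def tail_def
    by (subst emeasure_distr[OF Z_measurable]) (auto simp: Z_def intro!: arg_cong[where f = "emeasure M"])
  then have "emeasure (law n) ?A * tail ?u = emeasure M {\<omega>\<in>space M. Zsum n \<omega> \<in> ?A \<and> (\<forall>i\<in>{n<..n+1}. Z i \<omega> \<in> ?B)}"
    by (subst emeasure_past_block[OF A B]) simp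
  also have "\<dots> \<le> W_prob t (ball w r)"
  proof (rule emeasure_mono)
    show "{\<omega>\<in>space M. Zsum n \<omega> \<in> ?A \<and> (\<forall>i\<in>{n<..n+1}. Z i \<omega> \<in> ?B)} \<subseteq> {\<omega>\<in>space M. W t \<omega> /\<^sub>R t \<in> ball w r}"
    proof safe
      fix \<omega> assume \<omega>: "\<omega> \<in> space M" "\<forall>i\<in>{n<..n+1}. Z i \<omega> \<in> ?B" "Zsum n \<omega> /\<^sub>R t \<in> ball (\<beta>, w) r"
      have d: "dist (\<beta>, w) (Zsum n \<omega> /\<^sub>R t) < r" using \<omega>(3) by simp
      have d1: "\<bar>\<beta> - renewal_time S n \<omega> / t\<bar> < r"
        using dist_fst_le[of "(\<beta>, w)" "Zsum n \<omega> /\<^sub>R t"] d by (simp add: fst_Zsum dist_real_def field_simps)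
      have d2: "dist w (snd (Zsum n \<omega>) /\<^sub>R t) < r"
        using dist_snd_le[of "(\<beta>, w)" "Zsum n \<omega> /\<^sub>R t"] d by simp
      have "renewal_time S n \<omega> / t \<le> 1" using d1 r by linarith
      then have 1: "renewal_time S n \<omega> \<le> t" using t by (simp add: field_simps)
      have "\<beta> - r < renewal_time S n \<omega> / t" using d1 by linarith
      then have "t * (\<beta> - r) < renewal_time S n \<omega>" using t by (simp add: field_simps)
      moreover have "?u < S (Suc n) \<omega>" using \<omega>(2) by (simp add: Z_def)
      ultimately have 2: "t < renewal_time S (Suc n) \<omega>" by (simp add: renewal_time_Suc algebra_simps)
      show "W t \<omega> /\<^sub>R t \<in> ball w r" using W_eq_Zsum[OF \<omega>(1) 1 2] d2 by simp
    qed
  qed (use t in \<open>intro sets_W_divideR; simp\<close>)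
  finally show ?thesis .
qed

text \<open>
  Time is shrunk by the factor \<open>1 + r\<close>, so that the nth renewal time does not exceed \<open>t\<close>; the next
  \<open>m\<close> waiting times then pass beyond \<open>t\<close> while their rewards stay bounded.
\<close>

lemma law_fill_le_W:
  assumes t: "t > 0" and r: "0 < r" "r \<le> 1" and a: "a > 0" and b: "b \<ge> 0" and m: "2 * r * t < real m * a"
    and e: "r * (1 + norm w) + real m * b / t \<le> e"
  shows "emeasure (law n) {x. x /\<^sub>R (t / (1 + r)) \<in> ball (1, w) r} * emeasure step_law {z. a < fst z \<and> norm (snd z) \<le> b} ^ m
    \<le> W_prob t (ball w e)"
proof -
  define t' where "t' = t / (1 + r)"
  have t': "t' > 0" "t = t' * (1 + r)" using t r by (auto simp: t'_def)
  let ?A = "{x :: real \<times> 'a. x /\<^sub>R t' \<in> ball (1, w) r}"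
  let ?B = "{z :: real \<times> 'a. a < fst z \<and> norm (snd z) \<le> b}"
  have A: "?A \<in> sets borel" by (simp add: sets_divideR_borel)
  have B: "?B \<in> sets borel"
  proof -
    have "{z :: real \<times> 'a. a < fst z} \<inter> {z. norm (snd z) \<le> b} \<in> sets borel"
      by (intro sets.Int borel_open borel_closed open_Collect_less closed_Collect_le continuous_intros)
    then show ?thesis by (simp add: Int_def)
  qed
  have "emeasure (law n) ?A * emeasure step_law ?B ^ m =
      emeasure M {\<omega>\<in>space M. Zsum n \<omega> \<in> ?A \<and> (\<forall>i\<in>{n<..n+m}. Z i \<omega> \<in> ?B)}"
    by (rule emeasure_past_block[OF A B, symmetric])
  also have "\<dots> \<le> W_prob t (ball w e)"
  proof (rule emeasure_mono)
    show "{\<omega>\<in>space M. Zsum n \<omega> \<in> ?A \<and> (\<forall>i\<in>{n<..n+m}. Z i \<omega> \<in> ?B)} \<subseteq> {\<omega>\<in>space M. W t \<omega> /\<^sub>R t \<in> ball w e}"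
    proof safe
      fix \<omega> assume \<omega>: "\<omega> \<in> space M" "\<forall>i\<in>{n<..n+m}. Z i \<omega> \<in> ?B" "Zsum n \<omega> /\<^sub>R t' \<in> ball (1, w) r"
      have d: "dist (1, w) (Zsum n \<omega> /\<^sub>R t') < r" using \<omega>(3) by simp
      have d1: "\<bar>1 - renewal_time S n \<omega> / t'\<bar> < r"
        using dist_fst_le[of "(1, w)" "Zsum n \<omega> /\<^sub>R t'"] d by (simp add: fst_Zsum dist_real_def field_simps)
      have d2: "norm (w - snd (Zsum n \<omega>) /\<^sub>R t') < r"
        using dist_snd_le[of "(1, w)" "Zsum n \<omega> /\<^sub>R t'"] d by (simp add: dist_norm)
      have "renewal_time S n \<omega> / t' < 1 + r" "1 - r < renewal_time S n \<omega> / t'" using d1 by linarith+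
      then have Tn: "renewal_time S n \<omega> \<le> t" "t' * (1 - r) < renewal_time S n \<omega>"
        using t' by (auto simp: field_simps)
      have step: "a < S i \<omega>" "norm (X i \<omega>) \<le> b" if "i \<in> {n<..n+m}" for i
        using \<omega>(2) that by (auto simp: Z_def)
      have grow: "renewal_time S n \<omega> + real j * a \<le> renewal_time S (n + j) \<omega>" if "j \<le> m" for j
        using that
      proof (induction j)
        case (Suc j)
        then show ?case using step(1)[of "Suc (n + j)"] by (simp add: renewal_time_Suc algebra_simps)
      qed simp
      have "t < renewal_time S (n + m) \<omega>"
      proof -
        \<comment> \<open>The n-th renewal comes after t' (1 - r), so less than 2 r t' of time is
          left to cross, and \<open>m\<close> waiting times longer than \<open>a\<close>
          suffice.\<close>
        have "t = t' * (1 - r) + 2 * r * t'" using t' by (simp add: algebra_simps)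
        also have "2 * r * t' \<le> 2 * r * t" using t' r by (intro mult_left_mono) auto
        finally have "t \<le> t' * (1 - r) + 2 * r * t" by simp
        then show ?thesis using grow[of m] Tn(2) m by simp
      qed
      obtain k where k: "renewal_time S k \<omega> \<le> t" "t < renewal_time S (Suc k) \<omega>"
        using renewal_interval_exists[OF \<omega>(1), of t] t by auto
      have nk: "n \<le> k"
        using renewal_time_mono[OF \<omega>(1), of "Suc k" n] k Tn by (cases "n \<le> k") auto
      have km: "k \<le> n + m"
        using renewal_time_mono[OF \<omega>(1), of "n + m" k] k \<open>t < renewal_time S (n + m) \<omega>\<close> by (cases "k \<le> n + m") auto
      have t'_le: "t' \<le> t" using t r by (simp add: t'_def field_simps)
      have split: "{1..k} = {1..n} \<union> {n<..k}" "{1..n} \<inter> {n<..k} = {}" using nk by auto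
      have "W t \<omega> = (\<Sum>i=1..k. X i \<omega>)" using W_eq_Zsum[OF \<omega>(1) k] by (simp add: snd_Zsum)
      also have "\<dots> = snd (Zsum n \<omega>) + (\<Sum>i\<in>{n<..k}. X i \<omega>)"
        unfolding split(1) by (subst sum.union_disjoint) (use split in \<open>auto simp: snd_Zsum\<close>)
      finally have W: "W t \<omega> = snd (Zsum n \<omega>) + (\<Sum>i\<in>{n<..k}. X i \<omega>)" .
      have "norm (\<Sum>i\<in>{n<..k}. X i \<omega>) \<le> real (card {n<..k}) * b"
        using step(2) km by (intro sum_norm_bound) auto
      also have "\<dots> \<le> real m * b" using km b by (intro mult_right_mono) auto
      finally have rest: "norm (\<Sum>i\<in>{n<..k}. X i \<omega>) \<le> real m * b" .
      have "t *\<^sub>R (w - W t \<omega> /\<^sub>R t) = t *\<^sub>R w - W t \<omega>" using t by (simp add: scaleR_diff_right)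
      also have "t *\<^sub>R w = t' *\<^sub>R w + (t' * r) *\<^sub>R w" by (subst t'(2)) (simp add: algebra_simps)
      also have "t' *\<^sub>R w + (t' * r) *\<^sub>R w - W t \<omega> =
        t' *\<^sub>R (w - snd (Zsum n \<omega>) /\<^sub>R t') + (t' * r) *\<^sub>R w - (\<Sum>i\<in>{n<..k}. X i \<omega>)"
        using t'(1) unfolding W by (simp add: scaleR_diff_right)
      finally have "t *\<^sub>R (w - W t \<omega> /\<^sub>R t) = t' *\<^sub>R (w - snd (Zsum n \<omega>) /\<^sub>R t') + (t' * r) *\<^sub>R w - (\<Sum>i\<in>{n<..k}. X i \<omega>)" .
      then have "t * norm (w - W t \<omega> /\<^sub>R t) = norm (t' *\<^sub>R (w - snd (Zsum n \<omega>) /\<^sub>R t') + (t' * r) *\<^sub>R w - (\<Sum>i\<in>{n<..k}. X i \<omega>))"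
        using t by (metis abs_of_pos norm_scaleR)
      also have "\<dots> \<le> norm (t' *\<^sub>R (w - snd (Zsum n \<omega>) /\<^sub>R t') + (t' * r) *\<^sub>R w) + norm (\<Sum>i\<in>{n<..k}. X i \<omega>)"
        by (rule norm_triangle_ineq4)
      also have "\<dots> \<le> t' * norm (w - snd (Zsum n \<omega>) /\<^sub>R t') + t' * r * norm w + real m * b"
      proof -
        have "norm ((t' * r) *\<^sub>R w) = t' * r * norm w" using t'(1) r by (simp add: abs_mult)
        moreover have "norm (t' *\<^sub>R (w - snd (Zsum n \<omega>) /\<^sub>R t')) = t' * norm (w - snd (Zsum n \<omega>) /\<^sub>R t')"
          using t'(1) by (simp only: norm_scaleR abs_of_pos)
        ultimately show ?thesis
          using norm_triangle_ineq[of "t' *\<^sub>R (w - snd (Zsum n \<omega>) /\<^sub>R t')" "(t' * r) *\<^sub>R w"] rest by linarith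
      qed
      also have "\<dots> < t' * r + t' * r * norm w + real m * b"
        using d2 t'(1) by simp
      also have "\<dots> = t' * (r * (1 + norm w)) + real m * b" by (simp add: algebra_simps)
      also have "\<dots> \<le> t * (r * (1 + norm w)) + real m * b"
        using t'(1) t'_le r by (intro add_right_mono mult_right_mono) auto
      also have "\<dots> = t * (r * (1 + norm w) + real m * b / t)" using t by (simp add: algebra_simps)
      also have "\<dots> \<le> t * e" using e t by (intro mult_left_mono) auto
      finally have "norm (w - W t \<omega> /\<^sub>R t) < e" using t by simp
      then show "W t \<omega> /\<^sub>R t \<in> ball w e" by (simp add: dist_norm)
    qed
  qed (use t in \<open>intro sets_W_divideR; simp\<close>)
  finally show ?thesis by (simp add: t'_def)
qed

text \<open>Waiting times are positive and rewards have finite norm, so the boxes with a = 1 / (k +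
  1) and b = k exhaust the probability space and cannot all be null.\<close>

lemma step_law_positive_box:
  obtains a b where "a > 0" "b \<ge> 0" "emeasure step_law {z. a < fst z \<and> norm (snd z) \<le> b} > 0"
proof (rule ccontr)
  assume no: "\<not> thesis"
  let ?B = "\<lambda>k::nat. {\<omega>\<in>space M. inverse (real (Suc k)) < S 1 \<omega> \<and> norm (X 1 \<omega>) \<le> real k}"
  have [measurable]: "S 1 \<in> borel_measurable M" "X 1 \<in> borel_measurable M"
    by (simp_all add: S_measurable X_measurable)
  have Bm: "?B k \<in> sets M" for k by measurable
  have "?B k \<in> null_sets M" for k
  proof -
    have "{z :: real \<times> 'a. inverse (real (Suc k)) < fst z} \<inter> {z. norm (snd z) \<le> real k} \<in> sets borel"
      by (intro sets.Int borel_open borel_closed open_Collect_less closed_Collect_le continuous_intros)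
    then have m: "{z :: real \<times> 'a. inverse (real (Suc k)) < fst z \<and> norm (snd z) \<le> real k} \<in> sets borel"
      by (simp add: Int_def)
    have "emeasure step_law {z. inverse (real (Suc k)) < fst z \<and> norm (snd z) \<le> real k} = 0"
      using no that[of "inverse (real (Suc k))" "real k"] by (auto simp: not_gr_zero[symmetric] simp del: not_gr_zero)
    moreover have "emeasure step_law {z. inverse (real (Suc k)) < fst z \<and> norm (snd z) \<le> real k} = emeasure M (?B k)"
      using m unfolding step_law_def
      by (subst emeasure_distr[OF Z_measurable]) (auto simp: Z_def intro!: arg_cong[where f = "emeasure M"])
    ultimately show ?thesis using Bm by (simp add: null_sets_def)
  qed
  then have "(\<Union>k. ?B k) \<in> null_sets M" by (intro null_sets_UN)
  moreover have "(\<Union>k. ?B k) = space M"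
  proof (intro equalityI subsetI)
    fix \<omega> assume \<omega>: "\<omega> \<in> space M"
    obtain k1 where k1: "inverse (real (Suc k1)) < S 1 \<omega>" using reals_Archimedean[OF S_pos[OF _ \<omega>]] by auto
    obtain k2 where k2: "norm (X 1 \<omega>) \<le> real k2" using real_arch_simple by blast
    have "inverse (real (Suc (max k1 k2))) \<le> inverse (real (Suc k1))" by (intro le_imp_inverse_le) auto
    then have "inverse (real (Suc (max k1 k2))) < S 1 \<omega>" using k1 by (rule le_less_trans)
    moreover have "norm (X 1 \<omega>) \<le> real (max k1 k2)" using k2 by (rule order_trans) simp
    ultimately have "\<omega> \<in> ?B (max k1 k2)" using \<omega> by blast
    then show "\<omega> \<in> (\<Union>k. ?B k)" by blast
  qed auto
  ultimately show False using emeasure_space_1 by (auto simp: null_sets_def)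
qed

text \<open>The point (\<beta>, w) is reached at exponent \<open>A\<close>, and the waiting time
  then in progress covers the remaining fraction 1 - \<beta> of time at cost \<open>l\<close> per
  unit.\<close>

lemma Liminf_wait:
  assumes ach: "achievable (\<beta>, w) A" and \<beta>: "0 \<le> \<beta>" "\<beta> < 1" and G: "open G" "w \<in> G"
    and l: "ell_i M (S 1) = ereal l"
  shows "ereal (- (A + (1 - \<beta>) * l)) \<le> Liminf at_top (scaled_log_prob M S X G)"
  unfolding scaled_log_prob_def[abs_def]
proof (rule Liminf_scaled_ln_ext_ge)
  fix e :: real assume e: "e > 0"
  obtain \<epsilon> where \<epsilon>: "\<epsilon> > 0" "ball w \<epsilon> \<subseteq> G" using G openE by blast
  have l0: "0 \<le> l" using ell_s_nonneg ell_s_le_ell_i l by (metis ereal_less_eq(5) order_trans)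
  \<comment> \<open>The factor 2 + l bounds (1 - \<beta>) + l + r, which multiplies \<open>r\<close>
    in the waiting cost (1 - \<beta> + r) (l + r).\<close>
  obtain r where r: "0 < r" "r \<le> min \<epsilon> (1 - \<beta>)" "r * (2 + l) \<le> e" "r * 0 \<le> 1"
    using small_radius[of "2 + l" 0 e 1 "min \<epsilon> (1 - \<beta>)"] l0 e \<epsilon> \<beta> by auto
  have r1: "r \<le> \<epsilon>" "\<beta> + r \<le> 1" "r \<le> 1" using r(2) \<beta> by auto
  have rate: "(1 - \<beta> + r) * (l + r) \<le> (1 - \<beta>) * l + e"
  proof -
    have "(1 - \<beta> + r) * (l + r) = (1 - \<beta>) * l + r * ((1 - \<beta>) + l + r)" by (simp add: algebra_simps)
    also have "\<dots> \<le> (1 - \<beta>) * l + r * (2 + l)"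
      using r r1 \<beta> by (intro add_left_mono mult_left_mono) auto
    finally show ?thesis using r(3) by simp
  qed
  have u: "1 - \<beta> + r > 0" using \<beta> r by simp
  have "ereal (- (l + r)) < Liminf at_top (\<lambda>s::real. ereal (1 / s) * ln_ext (emeasure M {\<omega>\<in>space M. s < S 1 \<omega>}))"
    using l r(1) unfolding ell_i_def
    by (cases "Liminf at_top (\<lambda>s::real. ereal (1 / s) * ln_ext (emeasure M {\<omega>\<in>space M. s < S 1 \<omega>}))") auto
  then have "\<forall>\<^sub>F s in at_top. ereal (- (l + r)) < ereal (1 / s) * ln_ext (emeasure M {\<omega>\<in>space M. s < S 1 \<omega>})"
    by (rule less_LiminfD)
  then have "\<forall>\<^sub>F s in at_top. ennreal (exp (s * (- (l + r)))) \<le> tail s"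
    using eventually_gt_at_top[of 0]
    by eventually_elim (auto simp: tail_def le_scaled_ln_ext_iff[symmetric] simp del: uminus_ereal.simps intro: less_imp_le)
  then obtain s0 where s0: "\<And>s. s \<ge> s0 \<Longrightarrow> ennreal (exp (s * (- (l + r)))) \<le> tail s"
    by (auto simp: eventually_at_top_linorder)
  obtain t0 where t0: "\<And>t. t \<ge> t0 \<Longrightarrow> \<exists>n. ennreal (exp (- t * A)) \<le> emeasure (law n) {x. x /\<^sub>R t \<in> ball (\<beta>, w) r}"
    using ach r(1) unfolding achievable_def by blast
  show "\<forall>\<^sub>F t in at_top. ennreal (exp (- t * (A + (1 - \<beta>) * l + e))) \<le> W_prob t G"
    using eventually_ge_at_top[of "max 1 (max t0 (s0 / (1 - \<beta> + r)))"]
  proof eventually_elim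
    case (elim t)
    then have t: "t \<ge> 1" "t \<ge> t0" "s0 \<le> t * (1 - \<beta> + r)" using u by (auto simp: field_simps)
    obtain n where n: "ennreal (exp (- t * A)) \<le> emeasure (law n) {x. x /\<^sub>R t \<in> ball (\<beta>, w) r}"
      using t0[OF t(2)] by blast
    have "t * ((1 - \<beta> + r) * (l + r)) \<le> t * ((1 - \<beta>) * l + e)"
      using rate t by (intro mult_left_mono) auto
    then have "- t * (A + (1 - \<beta>) * l + e) \<le> - t * A + t * (1 - \<beta> + r) * (- (l + r))"
      by (simp add: algebra_simps)
    then have "ennreal (exp (- t * (A + (1 - \<beta>) * l + e))) \<le> ennreal (exp (- t * A + t * (1 - \<beta> + r) * (- (l + r))))"
      by (intro ennreal_leI) simp
    also have "\<dots> = ennreal (exp (- t * A)) * ennreal (exp (t * (1 - \<beta> + r) * (- (l + r))))"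
      by (simp only: exp_add ennreal_mult exp_ge_zero)
    also have "\<dots> \<le> emeasure (law n) {x. x /\<^sub>R t \<in> ball (\<beta>, w) r} * tail (t * (1 - \<beta> + r))"
      by (intro mult_mono n s0 t) auto
    also have "\<dots> \<le> W_prob t (ball w r)"
      using t r1 by (intro law_wait_le_W) auto
    also have "\<dots> \<le> W_prob t G"
    proof (rule emeasure_mono)
      have "ball w r \<subseteq> G" using \<epsilon> r1 by (auto simp: subset_iff)
      then show "{\<omega>\<in>space M. W t \<omega> /\<^sub>R t \<in> ball w r} \<subseteq> {\<omega>\<in>space M. W t \<omega> /\<^sub>R t \<in> G}" by auto
    qed (use t G in \<open>simp add: sets_W_divideR\<close>)
    finally show ?case .
  qed
qed

text \<open>At \<beta> = 1 no long wait can be relied on, as \<open>ell_i\<close> may be infinite.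
  The time gap left by the accuracy \<open>r\<close> is filled by about 2 r t / a moderate steps,
  whose cost and displacement, relative to \<open>t\<close>, vanish with \<open>r\<close>.\<close>

lemma Liminf_fill:
  assumes ach: "achievable (1, w) A" and G: "open G" "w \<in> G"
  shows "ereal (- A) \<le> Liminf at_top (scaled_log_prob M S X G)"
  unfolding scaled_log_prob_def[abs_def]
proof (rule Liminf_scaled_ln_ext_ge)
  fix e :: real assume e: "e > 0"
  have A: "0 \<le> A" using achievable_nonneg[OF ach] .
  obtain \<epsilon> where \<epsilon>: "\<epsilon> > 0" "ball w \<epsilon> \<subseteq> G" using G openE by blast
  let ?box = "\<lambda>a b. emeasure step_law {z :: real \<times> 'a. a < fst z \<and> norm (snd z) \<le> b}"
  obtain a b where ab: "a > 0" "b \<ge> 0" "?box a b > 0" by (rule step_law_positive_box)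
  have box1: "?box a b \<le> 1" by (rule prob_space.emeasure_le_1[OF prob_space_step_law])
  then obtain p where p: "?box a b = ennreal p" "p \<ge> 0" by (cases "?box a b") (auto simp: top_unique)
  define L where "L = - ln p"
  have p0: "0 < p" "p \<le> 1" using p ab(3) box1 by (auto simp: ennreal_le_1)
  then have L: "0 \<le> L" "p = exp (- L)" by (auto simp: L_def)
  \<comment> \<open>The constraints bound displacement and cost of about 2 r t / a extra steps, each
    of log probability - L, by half of \<epsilon> and half of \<open>e\<close>. The other halves are
    kept for the additive 2 in the bound on \<open>m\<close>.\<close>
  obtain r where r: "0 < r" "r \<le> 1" "r * (1 + norm w + 2 * b / a) \<le> \<epsilon> / 2" "r * (2 * L / a) \<le> e / 2"
    using small_radius[of "1 + norm w + 2 * b / a" "2 * L / a" "\<epsilon> / 2" "e / 2" 1] ab L e \<epsilon> by auto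
  obtain t0 where t0: "\<And>t. t \<ge> t0 \<Longrightarrow> \<exists>n. ennreal (exp (- t * A)) \<le> emeasure (law n) {x. x /\<^sub>R t \<in> ball (1, w) r}"
    using ach r(1) unfolding achievable_def by blast
  show "\<forall>\<^sub>F t in at_top. ennreal (exp (- t * (A + e))) \<le> W_prob t G"
    using eventually_ge_at_top[of "max 1 (max (t0 * (1 + r)) (max (4 * L / e) (4 * b / \<epsilon>)))"]
  proof eventually_elim
    case (elim t)
    then have t: "t \<ge> 1" "t0 \<le> t / (1 + r)" "2 * L \<le> t * (e / 2)" "2 * b / t \<le> \<epsilon> / 2"
      using r e \<epsilon> by (auto simp: field_simps)
    obtain n where n: "ennreal (exp (- (t / (1 + r)) * A)) \<le> emeasure (law n) {x. x /\<^sub>R (t / (1 + r)) \<in> ball (1, w) r}"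
      using t0[OF t(2)] by blast
    define m where "m = nat \<lfloor>2 * r * t / a\<rfloor> + 1"
    have "0 \<le> 2 * r * t / a" using r t ab by simp
    then have m: "2 * r * t / a < real m" "real m \<le> 2 * r * t / a + 2"
      unfolding m_def by (simp_all add: of_nat_nat) linarith+
    have "r * (1 + norm w) + real m * b / t \<le> r * (1 + norm w) + (2 * r * t / a + 2) * b / t"
      using m(2) ab t by (intro add_left_mono divide_right_mono mult_right_mono) auto
    also have "\<dots> = r * (1 + norm w + 2 * b / a) + 2 * b / t" using t by (simp add: field_simps)
    also have "\<dots> \<le> \<epsilon>" using r(3) t(4) by linarith
    finally have dist: "r * (1 + norm w) + real m * b / t \<le> \<epsilon>" .
    have "real m * L \<le> (2 * r * t / a + 2) * L" using m(2) L by (intro mult_right_mono) auto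
    also have "\<dots> = t * (r * (2 * L / a)) + 2 * L" by (simp add: field_simps)
    also have "\<dots> \<le> t * (e / 2) + t * (e / 2)" using r(4) t by (intro add_mono mult_left_mono) auto
    finally have mL: "real m * L \<le> t * e" by (simp add: algebra_simps)
    have "t / (1 + r) * A \<le> t * A" using t r A by (intro mult_right_mono) (auto simp: field_simps)
    then have "- t * (A + e) \<le> - (t / (1 + r)) * A + real m * (- L)"
      using mL by (simp add: algebra_simps)
    then have "ennreal (exp (- t * (A + e))) \<le> ennreal (exp (- (t / (1 + r)) * A + real m * (- L)))"
      by (intro ennreal_leI) simp
    also have "\<dots> = ennreal (exp (- (t / (1 + r)) * A)) * ennreal (exp (- L)) ^ m"
      by (simp only: exp_add ennreal_mult exp_ge_zero exp_of_nat_mult ennreal_power zero_le_power)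
    also have "\<dots> \<le> emeasure (law n) {x. x /\<^sub>R (t / (1 + r)) \<in> ball (1, w) r} * ?box a b ^ m"
      using n p L by (intro mult_mono) auto
    also have "\<dots> \<le> W_prob t (ball w \<epsilon>)"
      using t r ab m(1) dist by (intro law_fill_le_W) (auto simp: field_simps)
    also have "\<dots> \<le> W_prob t G"
      using \<epsilon>(2) t G by (intro emeasure_mono sets_W_divideR) auto
    finally show ?case .
  qed
qed

lemma Liminf_scaled_log_prob_ge:
  assumes G: "open G"
  shows "- (INF w\<in>G. rate_I_i M S X w) \<le> Liminf at_top (scaled_log_prob M S X G)"
proof -
  let ?L = "Liminf at_top (scaled_log_prob M S X G)"
  have key: "ereal (- c) \<le> ?L" if w: "w \<in> G" and c: "rate_I_i M S X w < ereal c" for w c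
  proof (cases "ell_i M (S 1) < \<infinity>")
    case True
    moreover have "0 \<le> ell_i M (S 1)" using ell_s_nonneg ell_s_le_ell_i order_trans by blast
    ultimately obtain l where l: "ell_i M (S 1) = ereal l" by (cases "ell_i M (S 1)") auto
    from c obtain \<beta> where \<beta>: "0 \<le> \<beta>" "\<beta> \<le> 1"
      "rate_Upsilon M (S 1) (X 1) \<beta> w + ereal ((1 - \<beta>) * l) < ereal c"
      unfolding rate_I_i_def rate_I_def l by (auto simp: INF_less_iff)
    then have "rate_Upsilon M (S 1) (X 1) \<beta> w < ereal (c - (1 - \<beta>) * l)"
      by (cases "rate_Upsilon M (S 1) (X 1) \<beta> w") auto
    then have ach: "achievable (\<beta>, w) (c - (1 - \<beta>) * l)" by (rule achievable_of_rate_Upsilon)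
    show ?thesis
    proof (cases "\<beta> < 1")
      case True
      from Liminf_wait[OF ach \<beta>(1) this G w l] show ?thesis by simp
    next
      case False
      then have "achievable (1, w) c" using ach \<beta> by (cases "\<beta> = 1") auto
      then show ?thesis using G w by (rule Liminf_fill)
    qed
  next
    case False
    then have "rate_Upsilon M (S 1) (X 1) 1 w < ereal c" using c by (simp add: rate_I_i_def rate_I_def)
    from Liminf_fill[OF achievable_of_rate_Upsilon[OF this] G w] show ?thesis .
  qed
  have "- ?L \<le> (INF w\<in>G. rate_I_i M S X w)"
  proof (rule INF_greatest, rule ccontr)
    fix w assume w: "w \<in> G" "\<not> - ?L \<le> rate_I_i M S X w"
    then obtain c where c: "rate_I_i M S X w < ereal c" "ereal c < - ?L"
      using ereal_dense2 by (meson not_le)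
    from key[OF w(1) c(1)] c(2) show False by (cases ?L) auto
  qed
  then show ?thesis by (simp add: ereal_uminus_le_reorder)
qed

end


section \<open>Exponential tightness\<close>

lemma closed_level_set:
  assumes "lower_semicontinuous f" shows "closed {x. f x \<le> c}"
proof -
  have "open {x. c < f x}"
    unfolding open_subopen[of "{x. c < f x}"]
  proof safe
    fix x assume "c < f x"
    then have "\<forall>\<^sub>F y in nhds x. c < f y" using assms unfolding lower_semicontinuous_def by blast
    then show "\<exists>T. open T \<and> x \<in> T \<and> T \<subseteq> {x. c < f x}" by (auto simp: eventually_nhds)
  qed
  then show ?thesis by (simp add: closed_def Compl_eq not_le)
qed

text \<open>At most \<open>c\<close> summands, each weighted by 1 / c, are completed to a convex
  combination with the help of 0, which belongs to \<open>K\<close>.\<close>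

lemma sum_divide_mem_convex:
  fixes K :: "'a::real_vector set"
  assumes K: "convex K" "0 \<in> K" and I: "finite I" "\<And>i. i \<in> I \<Longrightarrow> x i \<in> K" and c: "real (card I) \<le> c" "0 < c"
  shows "(\<Sum>i\<in>I. x i) /\<^sub>R c \<in> K"
proof -
  \<comment> \<open>The index \<open>None\<close> carries the vector 0 with the missing
    weight.\<close>
  have "(\<Sum>i\<in>insert None (Some ` I). (case i of None \<Rightarrow> 1 - real (card I) / c | Some i \<Rightarrow> 1 / c) *\<^sub>R
      (case i of None \<Rightarrow> 0 | Some i \<Rightarrow> x i)) \<in> K"
    using assms by (intro convex_sum) (auto simp: sum.reindex field_simps)
  also have "(\<Sum>i\<in>insert None (Some ` I). (case i of None \<Rightarrow> 1 - real (card I) / c | Some i \<Rightarrow> 1 / c) *\<^sub>R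
      (case i of None \<Rightarrow> 0 | Some i \<Rightarrow> x i)) = (\<Sum>i\<in>I. x i) /\<^sub>R c"
    using I(1) by (simp add: sum.reindex scaleR_sum_right divide_inverse)
  finally show ?thesis .
qed

text \<open>The intersection inherits from each thickening a finite net up to its radius, and the
  radii tend to 0. It is closed because the sum of a compact and a closed set is closed.\<close>

lemma compact_Inter_thickened:
  fixes C :: "nat \<Rightarrow> 'a::banach set"
  assumes C: "\<And>j. compact (C j)" and r: "\<And>j. 0 < r j" "r \<longlonglongrightarrow> 0"
  shows "compact (\<Inter>j. \<Union>x\<in>C j. cball x (r j))"
  unfolding compact_eq_totally_bounded complete_eq_closed
proof (intro conjI allI impI)
  have eq: "(\<Union>x\<in>C j. cball x (r j)) = (\<Union>x\<in>C j. \<Union>y\<in>cball 0 (r j). {x + y})" for j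
  proof safe
    fix x y assume "x \<in> C j" "y \<in> cball x (r j)"
    then show "y \<in> (\<Union>x\<in>C j. \<Union>y\<in>cball 0 (r j). {x + y})"
      by (intro UN_I[of x] UN_I[of "y - x"]) (auto simp: dist_norm norm_minus_commute)
  next
    fix x y :: 'a assume "x \<in> C j" "y \<in> cball 0 (r j)"
    then show "x + y \<in> (\<Union>x\<in>C j. cball x (r j))" by (intro UN_I[of x]) (auto simp: dist_norm)
  qed
  show "closed (\<Inter>j. \<Union>x\<in>C j. cball x (r j))"
    unfolding eq by (intro closed_INT ballI compact_closed_sums C closed_cball)
  fix e :: real assume e: "e > 0"
  obtain j where j: "r j < e / 2" using order_tendstoD(2)[OF r(2), of "e / 2"] e by (auto simp: eventually_sequentially)
  obtain k where k: "finite k" "C j \<subseteq> (\<Union>x\<in>k. ball x (e / 2))"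
    using C[of j] e unfolding compact_eq_totally_bounded by (meson half_gt_zero)
  have "(\<Inter>j. \<Union>x\<in>C j. cball x (r j)) \<subseteq> (\<Union>x\<in>k. ball x e)"
  proof
    fix y assume "y \<in> (\<Inter>j. \<Union>x\<in>C j. cball x (r j))"
    then obtain x where x: "x \<in> C j" "dist x y \<le> r j" by auto
    obtain z where z: "z \<in> k" "dist z x < e / 2" using k x by auto
    have "dist z y < e" using dist_triangle[of z y x] x z j by linarith
    then show "y \<in> (\<Union>x\<in>k. ball x e)" using z by auto
  qed
  then show "\<exists>k. finite k \<and> (\<Inter>j. \<Union>x\<in>C j. cball x (r j)) \<subseteq> (\<Union>x\<in>k. ball x e)" using k by blast
qed

context renewal
begin

text \<open>Lets the exponential Chebyshev bound, which concerns linear functionals of the reward,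
  act on sums of nonlinear functions of the single rewards, such as their norms.\<close>

lemma renewal_compose:
  fixes g :: "'a \<Rightarrow> 'b::{banach, second_countable_topology}"
  assumes g: "g \<in> borel_measurable borel"
  shows "renewal M S (\<lambda>i \<omega>. g (X i \<omega>))"
proof
  let ?h = "\<lambda>z::real \<times> 'a. (fst z, g (snd z))"
  have h: "?h \<in> measurable borel borel"
  proof -
    have "?h \<in> measurable borel (borel \<Otimes>\<^sub>M borel)"
      by (intro measurable_Pair measurable_fst_borel measurable_compose[OF measurable_snd_borel g])
    then show ?thesis by (simp only: borel_prod)
  qed
  have "indep_vars (\<lambda>_. borel) (\<lambda>i \<omega>. ?h (Z i \<omega>)) {1..}"
    using indep_vars_compose2[OF indep_Z, of "\<lambda>_. ?h" "\<lambda>_. borel"] h by auto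
  then have 1: "indep_vars (\<lambda>_. borel) (\<lambda>i \<omega>. (S i \<omega>, g (X i \<omega>))) {1..}" by (simp add: Z_def)
  have "distr M borel (\<lambda>\<omega>. ?h (Z i \<omega>)) = distr step_law borel ?h" if "i \<ge> 1" for i
    using distr_distr[OF h Z_measurable[OF that]] by (simp add: distr_Z[OF that] comp_def)
  then have 2: "distr M borel (\<lambda>\<omega>. (S i \<omega>, g (X i \<omega>))) = distr M borel (\<lambda>\<omega>. (S 1 \<omega>, g (X 1 \<omega>)))" if "i \<ge> 1" for i
    using that by (simp only: Z_def fst_conv snd_conv order_refl)
  show "renewal_reward M S (\<lambda>i \<omega>. g (X i \<omega>))"
    unfolding renewal_reward_def
    using 1 2 prob_space_axioms S_pos renewal_time_at_top by blast
qed

text \<open>The real-valued process is treated with the identity as functional. As \<zeta> \<le> 0,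
  the trivial tail bound 1 is already at most exp (- \<zeta> u), so the constant in the Chebyshev
  bound can be taken to be 1.\<close>

lemma additive_functional_tail:
  fixes g :: "'a \<Rightarrow> real"
  assumes g: "g \<in> borel_measurable borel" and \<zeta>: "\<zeta> \<le> 0"
    and \<rho>: "(\<integral>\<^sup>+\<omega>. ennreal (exp (\<zeta> * S 1 \<omega> + g (X 1 \<omega>))) \<partial>M) \<le> ennreal \<rho>" "0 \<le> \<rho>" "\<rho> < 1"
    and t: "t > 0"
  shows "emeasure M {\<omega>\<in>space M. t * b \<le> cumulative_reward S (\<lambda>i \<omega>. g (X i \<omega>)) t \<omega>}
    \<le> ennreal (1 / (1 - \<rho>) * exp (- t * (b + \<zeta>)))"
    and "{\<omega>\<in>space M. t * b \<le> cumulative_reward S (\<lambda>i \<omega>. g (X i \<omega>)) t \<omega>} \<in> sets M"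
proof -
  interpret R: renewal M S "\<lambda>i \<omega>. g (X i \<omega>)" by (rule renewal_compose[OF g])
  have eq: "{\<omega>\<in>space M. t * b \<le> R.W t \<omega>} = {\<omega>\<in>space M. R.W t \<omega> /\<^sub>R t \<in> {b..}}"
    using t by (auto simp: field_simps)
  show "{\<omega>\<in>space M. t * b \<le> R.W t \<omega>} \<in> sets M"
    unfolding eq using t by (intro R.sets_W_divideR) auto
  have "(\<integral>\<^sup>+\<omega>. ennreal (exp (blinfun_apply id_blinfun (R.W t \<omega>))) \<partial>M) \<le> ennreal (1 / (1 - \<rho>) * exp (- \<zeta> * t))"
  proof (rule R.W_chernoff)
    show "R.tail u \<le> ennreal (1 * exp (- \<zeta> * u))" if "u \<ge> 0" for u
    proof -
      have "1 \<le> exp (- \<zeta> * u)" using \<zeta> that by (simp add: mult_nonpos_nonneg)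
      then have "1 \<le> ennreal (1 * exp (- \<zeta> * u))" by (simp add: ennreal_ge_1)
      then show ?thesis using R.tail_le_1 order_trans by blast
    qed
    show "R.mgf \<zeta> id_blinfun \<le> ennreal \<rho>" using \<rho>(1) by (simp add: R.mgf_def mgf_pair_def)
  qed (use \<rho> t in auto)
  from R.W_markov[OF this t, of "{b..}" b]
  have "emeasure M {\<omega>\<in>space M. R.W t \<omega> /\<^sub>R t \<in> {b..}} \<le> ennreal (exp (- t * b) * (1 / (1 - \<rho>) * exp (- \<zeta> * t)))"
    using \<rho> by auto
  also have "exp (- t * b) * (1 / (1 - \<rho>) * exp (- \<zeta> * t)) = 1 / (1 - \<rho>) * (exp (- t * b) * exp (- \<zeta> * t))"
    by (simp only: ac_simps)
  also have "exp (- t * b) * exp (- \<zeta> * t) = exp (- t * (b + \<zeta>))"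
    by (simp add: exp_add[symmetric] algebra_simps)
  finally show "emeasure M {\<omega>\<in>space M. t * b \<le> R.W t \<omega>} \<le> ennreal (1 / (1 - \<rho>) * exp (- t * (b + \<zeta>)))"
    unfolding eq .
qed

definition exp_tight :: bool where
  "exp_tight \<longleftrightarrow> (\<forall>L. \<exists>K. compact K \<and> exp_bounded (- K) L)"

lemma exp_bounded_Un:
  assumes "exp_bounded A a" "exp_bounded B a" "A \<in> sets borel" "B \<in> sets borel" "F \<subseteq> A \<union> B"
  shows "exp_bounded F a"
proof (rule exp_bounded_mono_Un[of "UNIV :: bool set" "\<lambda>b. if b then A else B"])
  show "F \<subseteq> (\<Union>b\<in>UNIV. if b then A else B)" using assms(5) by (auto simp: UNIV_bool)
qed (use assms in auto)

lemma limsup_closed_of_exp_tight: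
  assumes "exp_tight" "closed F"
  shows "Limsup at_top (scaled_log_prob M S X F) \<le> - (INF w\<in>F. rate_I_s M S X w)"
proof (rule limsup_le_of_exp_bounded)
  fix a assume a: "ereal a < (INF w\<in>F. rate_I_s M S X w)"
  obtain K where K: "compact K" "exp_bounded (- K) a" using assms(1) unfolding exp_tight_def by blast
  have FK: "compact (F \<inter> K)" using assms(2) K(1) by (rule closed_Int_compact)
  have "(INF w\<in>F. rate_I_s M S X w) \<le> (INF w\<in>F \<inter> K. rate_I_s M S X w)" by (rule INF_superset_mono) auto
  then have "exp_bounded (F \<inter> K) a" using a FK by (intro exp_bounded_compact) auto
  then show "exp_bounded F a"
  proof (rule exp_bounded_Un[OF _ K(2)])
    show "F \<inter> K \<in> sets borel" using FK by (intro borel_closed compact_imp_closed)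
    show "- K \<in> sets borel" using compact_imp_closed[OF K(1)] by (intro borel_open) auto
  qed auto
qed

text \<open>The lower bound on the open complement of \<open>K\<close> has to be compatible with the
  exponential upper bound there.\<close>

lemma rate_I_i_large_of_exp_bounded:
  assumes K: "closed K" "exp_bounded (- K) L" and w: "w \<notin> K"
  shows "ereal L \<le> rate_I_i M S X w"
proof -
  have "- (INF w\<in>- K. rate_I_i M S X w) \<le> Liminf at_top (scaled_log_prob M S X (- K))"
    using K(1) by (intro Liminf_scaled_log_prob_ge) auto
  also have "\<dots> \<le> Limsup at_top (scaled_log_prob M S X (- K))" by (rule Liminf_le_Limsup) simp
  also have "\<dots> \<le> - ereal L"
  proof (rule limsup_le_of_exp_bounded)
    fix a assume a: "ereal a < ereal L"
    obtain C where C: "\<And>t. t \<ge> 1 \<Longrightarrow> W_prob t (- K) \<le> ennreal (C * exp (- t * L))"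
      using K(2) unfolding exp_bounded_def by blast
    show "exp_bounded (- K) a" unfolding exp_bounded_def
    proof (intro exI allI impI)
      fix t :: real assume t: "t \<ge> 1"
      have "C * exp (- t * L) \<le> \<bar>C\<bar> * exp (- t * a)" using a t by (intro mult_mono) auto
      then show "W_prob t (- K) \<le> ennreal (\<bar>C\<bar> * exp (- t * a))"
        using C[OF t] by (meson ennreal_leI order_trans)
    qed
  qed
  finally have "ereal L \<le> (INF w\<in>- K. rate_I_i M S X w)" by (simp only: ereal_minus_le_minus)
  also have "\<dots> \<le> rate_I_i M S X w" using w by (intro INF_lower) simp
  finally show ?thesis .
qed

lemma limsup_convex:
  assumes F: "F \<in> sets borel" "(open F \<and> convex F) \<or> (closed F \<and> convex F) \<or> (convex F \<and> finite_dim_type TYPE('a))"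
    and fin: "ell_s M (S 1) < \<infinity> \<or> rate_I_s M S X 0 < \<infinity>"
  shows "Limsup at_top (scaled_log_prob M S X F) \<le> - (INF w\<in>F. rate_I_s M S X w)"
proof (rule limsup_le_of_exp_bounded)
  fix a assume a: "ereal a < (INF w\<in>F. rate_I_s M S X w)"
  have hull: "\<exists>D. compact D \<and> convex D \<and> C \<subseteq> D \<and> D \<subseteq> F" if C: "compact C" "C \<subseteq> F" for C
    using F(2)
  proof (elim disjE conjE)
    assume "open F" "convex F"
    then show ?thesis using C compact_closure_convex_hull[OF C(1)] closure_convex_hull_subset_open[OF C]
        hull_subset[of C convex] closure_subset[of "convex hull C"]
      by (intro exI[of _ "closure (convex hull C)"]) (auto simp: convex_closure)
  next
    assume "closed F" "convex F"
    then have "closure (convex hull C) \<subseteq> F" using C by (intro closure_minimal hull_minimal)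
    then show ?thesis using C compact_closure_convex_hull[OF C(1)]
        hull_subset[of C convex] closure_subset[of "convex hull C"]
      by (intro exI[of _ "closure (convex hull C)"]) (auto simp: convex_closure)
  next
    assume "convex F" "finite_dim_type TYPE('a)"
    then show ?thesis using C compact_convex_hull_finite_dim[OF _ C(1)] hull_subset[of C convex] hull_minimal[of C F convex]
      by (intro exI[of _ "convex hull C"]) auto
  qed
  obtain a2 where a2: "a < a2" "ereal a2 < (INF w\<in>F. rate_I_s M S X w)" using ereal_dense2[OF a] by auto
  have dual: "\<exists>\<zeta>' \<phi>. (\<zeta>', \<phi>) \<in> Theta \<and> ereal \<zeta>' \<le> ell_s M (S 1) \<and> a2 < \<zeta>' + blinfun_apply \<phi> w" if "w \<in> F" for w
  proof -
    have "ereal a2 < rate_I M (S 1) (X 1) (ell_s M (S 1)) w"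
      using a2(2) that unfolding rate_I_s_def by (meson INF_lower less_le_trans)
    then show ?thesis using rate_I_dual[OF _ ell_s_nonneg] by metis
  qed
  show "exp_bounded F a"
  proof (cases "ell_s M (S 1) < \<infinity>")
    case True
    then obtain l where l: "ell_s M (S 1) = ereal l" using ell_s_nonneg by (cases "ell_s M (S 1)") auto
    \<comment> \<open>The pairs of all points of \<open>F\<close> have \<zeta> at most
      \<open>l\<close>. Shifting them down by \<open>e\<close> keeps them in \<open>Theta\<close>
      and brings the common bound strictly below \<open>ell_s\<close>, as the tail bound
      requires.\<close>
    define e where "e = (a2 - a) / 2"
    have e: "e > 0" "a < a2 - e" using a2 by (auto simp: e_def field_simps)
    have "ereal (l - e) < ell_s M (S 1)" using e l by simp
    then obtain C where C: "C \<ge> 0" "\<And>u. u \<ge> 0 \<Longrightarrow> tail u \<le> ennreal (C * exp (- (l - e) * u))"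
      using tail_bound_of_ell_s[OF prob_space_axioms] unfolding tail_def by metis
    show ?thesis
    proof (rule exp_bounded_convex[OF F(1) hull C _ e(2)])
      fix w assume "w \<in> F"
      then obtain \<zeta>' \<phi> where T: "(\<zeta>', \<phi>) \<in> Theta" "\<zeta>' \<le> l" "a2 < \<zeta>' + blinfun_apply \<phi> w"
        using dual l by fastforce
      have "(\<zeta>' - e, \<phi>) \<in> Theta" using Theta_mono[OF T(1), of "\<zeta>' - e"] e by simp
      then show "\<exists>\<zeta>' \<phi>. (\<zeta>', \<phi>) \<in> Theta \<and> \<zeta>' \<le> l - e \<and> a2 - e < \<zeta>' + blinfun_apply \<phi> w"
        using T by (intro exI[of _ "\<zeta>' - e"] exI[of _ \<phi>]) auto
    qed
  next
    case False
    then have l: "ell_s M (S 1) = \<infinity>" by simp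
    obtain b where b: "rate_I_s M S X 0 \<le> ereal b"
      using fin False by (cases "rate_I_s M S X 0") auto
    have "ereal b < ell_s M (S 1)" using l by simp
    then obtain C where C: "C \<ge> 0" "\<And>u. u \<ge> 0 \<Longrightarrow> tail u \<le> ennreal (C * exp (- b * u))"
      using tail_bound_of_ell_s[OF prob_space_axioms] unfolding tail_def by metis
    show ?thesis
    proof (rule exp_bounded_convex[OF F(1) hull C _ a2(1)])
      fix w assume "w \<in> F"
      then obtain \<zeta>' \<phi> where T: "(\<zeta>', \<phi>) \<in> Theta" "ereal \<zeta>' \<le> ell_s M (S 1)" "a2 < \<zeta>' + blinfun_apply \<phi> w"
        using dual by blast
      \<comment> \<open>Weak duality at the origin: the functional part vanishes there, so the
        finite value of the rate function bounds \<zeta>' for all separating pairs.\<close>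
      have "ereal (\<zeta>' + blinfun_apply \<phi> 0) \<le> rate_I_s M S X 0"
        unfolding rate_I_s_def by (rule rate_I_ge[OF T(1,2) ell_s_nonneg])
      then have "ereal (\<zeta>' + blinfun_apply \<phi> 0) \<le> ereal b" using b by (rule order_trans)
      then have "\<zeta>' \<le> b" by simp
      then show "\<exists>\<zeta>' \<phi>. (\<zeta>', \<phi>) \<in> Theta \<and> \<zeta>' \<le> b \<and> a2 < \<zeta>' + blinfun_apply \<phi> w" using T by blast
    qed
  qed
qed

text \<open>Since the waiting time is positive, the integrand tends to 0 as \<zeta> decreases, and
  dominated convergence makes the moment small; 1/2 stands for any ratio below 1 in the geometric
  sums.\<close>

lemma exp_moment_small:
  assumes fin: "(\<integral>\<^sup>+\<omega>. ennreal (exp (\<zeta> * S 1 \<omega> + \<sigma> * norm (X 1 \<omega>))) \<partial>M) < \<infinity>"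
  obtains \<zeta>' where "\<zeta>' \<le> 0" "(\<integral>\<^sup>+\<omega>. ennreal (exp (\<zeta>' * S 1 \<omega> + \<sigma> * norm (X 1 \<omega>))) \<partial>M) \<le> ennreal (1/2)"
proof -
  have [measurable]: "S 1 \<in> borel_measurable M" "X 1 \<in> borel_measurable M"
    by (simp_all add: S_measurable X_measurable)
  let ?u = "\<lambda>n::nat. \<lambda>\<omega>. ennreal (exp ((\<zeta> - real n) * S 1 \<omega> + \<sigma> * norm (X 1 \<omega>)))"
  have "(\<lambda>n. \<integral>\<^sup>+\<omega>. ?u n \<omega> \<partial>M) \<longlonglongrightarrow> (\<integral>\<^sup>+\<omega>. 0 \<partial>M)"
  proof (rule nn_integral_dominated_convergence[where w = "?u 0"])
    show "AE \<omega> in M. ?u n \<omega> \<le> ?u 0 \<omega>" for n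
    proof (rule AE_I2)
      fix \<omega> assume "\<omega> \<in> space M"
      then have "(\<zeta> - real n) * S 1 \<omega> \<le> \<zeta> * S 1 \<omega>" using S_pos[of 1 \<omega>] by (intro mult_right_mono) auto
      then show "?u n \<omega> \<le> ?u 0 \<omega>" by (intro ennreal_leI) simp
    qed
    show "(\<integral>\<^sup>+\<omega>. ?u 0 \<omega> \<partial>M) < \<infinity>" using fin by simp
    show "AE \<omega> in M. (\<lambda>n. ?u n \<omega>) \<longlonglongrightarrow> 0"
    proof (rule AE_I2)
      fix \<omega> assume "\<omega> \<in> space M"
      then have s: "S 1 \<omega> > 0" using S_pos[of 1 \<omega>] by simp
      have "(\<lambda>n. exp (- S 1 \<omega>) ^ n) \<longlonglongrightarrow> 0" using s by (intro LIMSEQ_power_zero) simp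
      then have "(\<lambda>n. exp (\<zeta> * S 1 \<omega> + \<sigma> * norm (X 1 \<omega>)) * exp (- S 1 \<omega>) ^ n) \<longlonglongrightarrow>
          exp (\<zeta> * S 1 \<omega> + \<sigma> * norm (X 1 \<omega>)) * 0" by (intro tendsto_mult tendsto_const)
      moreover have eq: "exp (\<zeta> * S 1 \<omega> + \<sigma> * norm (X 1 \<omega>)) * exp (- S 1 \<omega>) ^ n =
          exp ((\<zeta> - real n) * S 1 \<omega> + \<sigma> * norm (X 1 \<omega>))" for n
        by (simp add: exp_of_nat_mult[symmetric] exp_add[symmetric] algebra_simps)
      ultimately have "(\<lambda>n. exp ((\<zeta> - real n) * S 1 \<omega> + \<sigma> * norm (X 1 \<omega>))) \<longlonglongrightarrow> 0"
        by (simp only: eq mult_zero_right)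
      from tendsto_ennrealI[OF this] show "(\<lambda>n. ?u n \<omega>) \<longlonglongrightarrow> 0" by simp
    qed
  qed measurable
  then have "(\<lambda>n. \<integral>\<^sup>+\<omega>. ?u n \<omega> \<partial>M) \<longlonglongrightarrow> 0" by simp
  then have "\<forall>\<^sub>F n in sequentially. (\<integral>\<^sup>+\<omega>. ?u n \<omega> \<partial>M) < ennreal (1/2)"
    by (rule order_tendstoD) (use ennreal_lessI[of "1/2" 0] in simp)
  moreover obtain m :: nat where "\<zeta> \<le> real m" using real_arch_simple by blast
  then have "\<forall>\<^sub>F n in sequentially. \<zeta> - real n \<le> 0"
    by (intro eventually_sequentiallyI[of m]) simp
  ultimately have "\<forall>\<^sub>F n in sequentially. (\<integral>\<^sup>+\<omega>. ?u n \<omega> \<partial>M) < ennreal (1/2) \<and> \<zeta> - real n \<le> 0"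
    by (rule eventually_conj)
  then obtain n where "(\<integral>\<^sup>+\<omega>. ?u n \<omega> \<partial>M) < ennreal (1/2)" "\<zeta> - real n \<le> 0"
    by (auto simp: eventually_sequentially)
  then show thesis by (intro that[of "\<zeta> - real n"]) (auto intro: less_imp_le)
qed

section \<open>Tightness and compact level sets in finite dimension\<close>

lemma norm_W_le: "norm (W t \<omega>) \<le> cumulative_reward S (\<lambda>i \<omega>. norm (X i \<omega>)) t \<omega>"
  unfolding cumulative_reward_def by (rule norm_sum)

lemma exp_tight_finite_dim:
  assumes fd: "finite_dim_type TYPE('a)" and \<sigma>: "\<sigma> > 0" "\<zeta> \<le> 0"
    and mom: "(\<integral>\<^sup>+\<omega>. ennreal (exp (\<zeta> * S 1 \<omega> + \<sigma> * norm (X 1 \<omega>))) \<partial>M) \<le> ennreal (1/2)"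
  shows exp_tight
  unfolding exp_tight_def
proof
  fix L :: real
  \<comment> \<open>Makes \<sigma> R + \<zeta> equal to |L|, the rate in the tail bound for the sum
    of the norms.\<close>
  define R where "R = (\<bar>L\<bar> - \<zeta>) / \<sigma>"
  have K: "compact (cball (0::'a) R)" by (rule finite_dim_compact[OF fd]) auto
  have "exp_bounded (- cball 0 R) L" unfolding exp_bounded_def
  proof (intro exI allI impI)
    fix t :: real assume t: "t \<ge> 1"
    have g: "(\<lambda>x::'a. \<sigma> * norm x) \<in> borel_measurable borel" by measurable
    let ?E = "{\<omega>\<in>space M. t * (\<sigma> * R) \<le> cumulative_reward S (\<lambda>i \<omega>. \<sigma> * norm (X i \<omega>)) t \<omega>}"
    have "W_prob t (- cball 0 R) \<le> emeasure M ?E"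
    proof (rule emeasure_mono)
      show "?E \<in> sets M" using t by (intro additive_functional_tail(2)[OF g \<sigma>(2) mom]) auto
      show "{\<omega>\<in>space M. W t \<omega> /\<^sub>R t \<in> - cball 0 R} \<subseteq> ?E"
      proof safe
        fix \<omega> assume "W t \<omega> /\<^sub>R t \<notin> cball 0 R"
        then have "t * R \<le> norm (W t \<omega>)" using t by (simp add: field_simps)
        also have "\<dots> \<le> cumulative_reward S (\<lambda>i \<omega>. norm (X i \<omega>)) t \<omega>" by (rule norm_W_le)
        finally have "\<sigma> * (t * R) \<le> \<sigma> * cumulative_reward S (\<lambda>i \<omega>. norm (X i \<omega>)) t \<omega>"
          using \<sigma> by (intro mult_left_mono) auto
        then show "t * (\<sigma> * R) \<le> cumulative_reward S (\<lambda>i \<omega>. \<sigma> * norm (X i \<omega>)) t \<omega>"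
          by (simp add: cumulative_reward_def sum_distrib_left mult.left_commute)
      qed
    qed
    also have "\<dots> \<le> ennreal (1 / (1 - 1/2) * exp (- t * (\<sigma> * R + \<zeta>)))"
      using t by (intro additive_functional_tail(1)[OF g \<sigma>(2) mom]) auto
    also have "\<dots> \<le> ennreal (2 * exp (- t * L))"
    proof (rule ennreal_leI)
      have "\<sigma> * R + \<zeta> = \<bar>L\<bar>" using \<sigma> by (simp add: R_def)
      moreover have "t * L \<le> t * \<bar>L\<bar>" using t by (intro mult_left_mono) auto
      ultimately show "1 / (1 - 1/2) * exp (- t * (\<sigma> * R + \<zeta>)) \<le> 2 * exp (- t * L)" by simp
    qed
    finally show "W_prob t (- cball 0 R) \<le> ennreal (2 * exp (- t * L))" .
  qed
  with K show "\<exists>K. compact K \<and> exp_bounded (- K) L" by blast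
qed

text \<open>A norming functional for \<open>w\<close>, scaled by \<sigma>, has a moment at most that
  of the norm and so belongs to \<open>Theta\<close> together with \<zeta>. Hence the rate function
  is at least \<zeta> + \<sigma> \<open>norm w\<close>, and its level sets are bounded.\<close>

lemma compact_level_sets_finite_dim:
  assumes fd: "finite_dim_type TYPE('a)" and \<sigma>: "\<sigma> > 0" "\<zeta> \<le> 0" and l: "0 \<le> l"
    and mom: "(\<integral>\<^sup>+\<omega>. ennreal (exp (\<zeta> * S 1 \<omega> + \<sigma> * norm (X 1 \<omega>))) \<partial>M) \<le> ennreal (1/2)"
  shows "compact_level_sets (rate_I M (S 1) (X 1) l)"
  unfolding compact_level_sets_def
proof
  fix c :: real
  have "norm w \<le> (c - \<zeta>) / \<sigma>" if "rate_I M (S 1) (X 1) l w \<le> ereal c" for w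
  proof -
    obtain f :: "'a \<Rightarrow>\<^sub>L real" where f: "norm w \<le> f w" "\<And>y. f y \<le> norm y"
      using norming_functional[of w] by blast
    have "mgf \<zeta> (\<sigma> *\<^sub>R f) \<le> (\<integral>\<^sup>+\<omega>. ennreal (exp (\<zeta> * S 1 \<omega> + \<sigma> * norm (X 1 \<omega>))) \<partial>M)"
      unfolding mgf_def mgf_pair_def
      using f(2) \<sigma> by (intro nn_integral_mono ennreal_leI) (simp add: blinfun.scaleR_left)
    also have "\<dots> \<le> ennreal (1/2)" by (rule mom)
    also have "\<dots> \<le> ennreal 1" by (rule ennreal_leI) simp
    finally have "(\<zeta>, \<sigma> *\<^sub>R f) \<in> Theta" by (simp add: Theta_def)
    moreover have "ereal \<zeta> \<le> l"
    proof (rule order_trans[OF _ l])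
      show "ereal \<zeta> \<le> 0" using \<sigma>(2) by simp
    qed
    ultimately have "ereal (\<zeta> + (\<sigma> *\<^sub>R f) w) \<le> ereal c"
      by (intro order_trans[OF rate_I_ge[OF _ _ l] that])
    then have "\<zeta> + \<sigma> * f w \<le> c" by (simp add: blinfun.scaleR_left)
    moreover have "\<sigma> * norm w \<le> \<sigma> * f w" using f(1) \<sigma> by simp
    ultimately have "\<sigma> * norm w \<le> c - \<zeta>" by linarith
    then show ?thesis using \<sigma> by (simp add: pos_le_divide_eq mult.commute)
  qed
  then have "bounded {w. rate_I M (S 1) (X 1) l w \<le> ereal c}" by (auto simp: bounded_iff)
  then show "compact {w. rate_I M (S 1) (X 1) l w \<le> ereal c}"
    by (intro finite_dim_compact[OF fd] closed_level_set lower_semicontinuous_rate_I l)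
qed

section \<open>Tightness under all exponential moments\<close>

lemma ell_s_infinite:
  assumes mom: "\<And>\<sigma>. \<sigma> > 0 \<Longrightarrow> (\<integral>\<^sup>+\<omega>. ennreal (exp (\<sigma> * S 1 \<omega> + \<sigma> * norm (X 1 \<omega>))) \<partial>M) < \<infinity>"
  shows "ell_s M (S 1) = \<infinity>"
proof -
  have [measurable]: "S 1 \<in> borel_measurable M" "X 1 \<in> borel_measurable M"
    by (simp_all add: S_measurable X_measurable)
  have "ereal \<sigma> \<le> ell_s M (S 1)" if \<sigma>: "\<sigma> > 0" for \<sigma>
  proof -
    let ?m = "\<integral>\<^sup>+\<omega>. ennreal (exp (\<sigma> * S 1 \<omega> + \<sigma> * norm (X 1 \<omega>))) \<partial>M"
    obtain C where C: "?m = ennreal C" "C \<ge> 0" using mom[OF \<sigma>] by (cases ?m) auto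
    have "Limsup at_top (\<lambda>s::real. ereal (1 / s) * ln_ext (emeasure M {\<omega>\<in>space M. s < S 1 \<omega>})) \<le> - ereal \<sigma>"
    proof (rule Limsup_scaled_ln_ext_le, intro exI allI impI)
      fix a t :: real assume a: "ereal a < ereal \<sigma>" and t: "t \<ge> 1"
      have "emeasure M {\<omega>\<in>space M. t < S 1 \<omega>} = (\<integral>\<^sup>+\<omega>. indicator {\<omega>\<in>space M. t < S 1 \<omega>} \<omega> \<partial>M)"
        by (rule nn_integral_indicator[symmetric]) measurable
      also have "\<dots> \<le> (\<integral>\<^sup>+\<omega>. ennreal (exp (- t * a)) * ennreal (exp (\<sigma> * S 1 \<omega> + \<sigma> * norm (X 1 \<omega>))) \<partial>M)"
      proof (rule nn_integral_mono)
        fix \<omega>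
        show "indicator {\<omega>\<in>space M. t < S 1 \<omega>} \<omega> \<le> ennreal (exp (- t * a)) * ennreal (exp (\<sigma> * S 1 \<omega> + \<sigma> * norm (X 1 \<omega>)))"
        proof (cases "t < S 1 \<omega>")
          case True
          have "t * a \<le> t * \<sigma>" using a t by (intro mult_left_mono) auto
          also have "\<dots> \<le> S 1 \<omega> * \<sigma>" using True \<sigma> by (intro mult_right_mono) auto
          finally have "0 \<le> - t * a + (\<sigma> * S 1 \<omega> + \<sigma> * norm (X 1 \<omega>))" using \<sigma> by (simp add: mult.commute add_increasing2)
          then have "1 \<le> exp (- t * a + (\<sigma> * S 1 \<omega> + \<sigma> * norm (X 1 \<omega>)))" by simp
          then have "1 \<le> ennreal (exp (- t * a) * exp (\<sigma> * S 1 \<omega> + \<sigma> * norm (X 1 \<omega>)))"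
            by (simp only: exp_add[of "- t * a"] ennreal_ge_1)
          then show ?thesis by (auto simp: indicator_def ennreal_mult)
        qed simp
      qed
      also have "\<dots> = ennreal (exp (- t * a)) * ?m" by (rule nn_integral_cmult) measurable
      also have "\<dots> = ennreal (C * exp (- t * a))" using C by (simp add: ennreal_mult mult.commute)
      finally show "emeasure M {\<omega>\<in>space M. t < S 1 \<omega>} \<le> ennreal (C * exp (- t * a))" .
    qed
    then have "- (- ereal \<sigma>) \<le> - Limsup at_top (\<lambda>s::real. ereal (1 / s) * ln_ext (emeasure M {\<omega>\<in>space M. s < S 1 \<omega>}))"
      by (simp only: ereal_minus_le_minus)
    then show ?thesis unfolding ell_s_def by simp
  qed
  then have le: "ereal (\<bar>r\<bar> + 1) \<le> ell_s M (S 1)" for r by simp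
  have "ell_s M (S 1) \<noteq> ereal r" for r using le[of r] by auto
  then show ?thesis using ell_s_nonneg by (cases "ell_s M (S 1)") auto
qed

text \<open>Dominated convergence along an exhaustion by compact convex sets. The weight
  \<open>f\<close> will be an exponential of the norm, so rewards outside \<open>K\<close> are
  negligible even after exponential weighting.\<close>

lemma compact_convex_small_remainder:
  assumes f: "f \<in> borel_measurable borel" "(\<integral>\<^sup>+\<omega>. f (X 1 \<omega>) \<partial>M) < \<infinity>" and e: "e > 0"
  obtains K :: "'a set" where "compact K" "convex K" "0 \<in> K"
    "(\<integral>\<^sup>+\<omega>. f (X 1 \<omega>) * indicator (- K) (X 1 \<omega>) \<partial>M) \<le> ennreal e"
proof -
  have X1 [measurable]: "X 1 \<in> borel_measurable M" by (simp add: X_measurable)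
  note [measurable] = f(1)
  obtain K :: "nat \<Rightarrow> 'a set" where K: "\<And>m. compact (K m)" "\<And>m. convex (K m)" "\<And>m. 0 \<in> K m" "incseq K"
    "AE x in distr M borel (X 1). \<exists>m. x \<in> K m"
  proof (rule compact_convex_exhaustion[of "distr M borel (X 1)"])
    show "emeasure (distr M borel (X 1)) (space (distr M borel (X 1))) \<noteq> \<infinity>"
      using prob_space.emeasure_space_1[OF prob_space_distr[OF X1]] by simp
  qed auto
  have Kb [measurable]: "K m \<in> sets borel" for m using K(1) by (simp add: compact_imp_closed)
  have "(\<lambda>m. \<integral>\<^sup>+x. f x * indicator (- K m) x \<partial>distr M borel (X 1)) \<longlonglongrightarrow> (\<integral>\<^sup>+x. 0 \<partial>distr M borel (X 1))"
  proof (rule nn_integral_dominated_convergence[where w = f])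
    show "AE x in distr M borel (X 1). f x * indicator (- K m) x \<le> f x" for m
      by (auto simp: indicator_def)
    show "(\<integral>\<^sup>+x. f x \<partial>distr M borel (X 1)) < \<infinity>" by (subst nn_integral_distr[OF X1]) (use f in auto)
    show "AE x in distr M borel (X 1). (\<lambda>m. f x * indicator (- K m) x) \<longlonglongrightarrow> 0"
      using K(5)
    proof eventually_elim
      case (elim x)
      then obtain m where m: "x \<in> K m" by blast
      have "\<forall>\<^sub>F k in sequentially. f x * indicator (- K k) x = 0"
        using eventually_ge_at_top[of m]
      proof eventually_elim
        case (elim k)
        then have "x \<in> K k" using m K(4) by (auto simp: incseq_def)
        then show ?case by simp
      qed
      then show ?case by (simp add: tendsto_eventually)
    qed
  qed measurable
  then have "(\<lambda>m. \<integral>\<^sup>+x. f x * indicator (- K m) x \<partial>distr M borel (X 1)) \<longlonglongrightarrow> 0" by simp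
  then have "\<forall>\<^sub>F m in sequentially. (\<integral>\<^sup>+x. f x * indicator (- K m) x \<partial>distr M borel (X 1)) < ennreal e"
    by (rule order_tendstoD) (use e in simp)
  then obtain m where "(\<integral>\<^sup>+x. f x * indicator (- K m) x \<partial>distr M borel (X 1)) < ennreal e"
    by (auto simp: eventually_sequentially)
  then have "(\<integral>\<^sup>+\<omega>. f (X 1 \<omega>) * indicator (- K m) (X 1 \<omega>) \<partial>M) \<le> ennreal e"
    by (subst (asm) nn_integral_distr[OF X1]) auto
  with K show thesis by (intro that)
qed

end


context renewal
begin

text \<open>
  Rewards outside a large compact convex set \<open>K j\<close> contribute at most \<open>t / Suc j\<close> to the cumulative
  reward, up to probability of order \<open>exp (- t * (L + j))\<close>; the remaining ones contribute a vector in
  a multiple of \<open>K j\<close>.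
\<close>

lemma exp_tight_of_all_moments:
  assumes mom: "\<And>\<sigma>. \<sigma> > 0 \<Longrightarrow> (\<integral>\<^sup>+\<omega>. ennreal (exp (\<sigma> * S 1 \<omega> + \<sigma> * norm (X 1 \<omega>))) \<partial>M) < \<infinity>"
  shows exp_tight
  unfolding exp_tight_def
proof
  fix L :: real
  have [measurable]: "S 1 \<in> borel_measurable M" "X 1 \<in> borel_measurable M"
    by (simp_all add: S_measurable X_measurable)
  have lt1: "mgf (- 1) 0 < 1" using mgf_strict[OF zero_in_Theta, of "- 1"] by simp
  obtain \<rho>0 where \<rho>0: "mgf (- 1) 0 = ennreal \<rho>0" "0 \<le> \<rho>0" using lt1 by (cases "mgf (- 1) 0") auto
  have \<rho>01: "\<rho>0 < 1" using lt1 \<rho>0 by (metis ennreal_1 ennreal_less_iff)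
  have \<rho>0pos: "\<rho>0 > 0" using mgf_pos[of "- 1" 0] \<rho>0 by simp
  have int0: "(\<integral>\<^sup>+\<omega>. ennreal (exp (- 1 * S 1 \<omega>)) \<partial>M) = ennreal \<rho>0"
    using \<rho>0(1) by (simp add: mgf_def mgf_pair_def)
  \<comment> \<open>Strictly between \<rho>0 and 1; the gap \<rho> - \<rho>0 is spent in one
    estimate on rewards outside \<open>K j\<close>, in another on a constant reward.\<close>
  define \<rho> where "\<rho> = (1 + \<rho>0) / 2"
  have \<rho>: "\<rho>0 < \<rho>" "\<rho> < 1" "0 \<le> \<rho>" using \<rho>01 \<rho>0 by (auto simp: \<rho>_def)
  \<comment> \<open>With constant reward \<kappa> the process counts renewals, and the moment
    \<rho>0 is raised exactly to \<rho>.\<close>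
  define \<kappa> where "\<kappa> = ln (\<rho> / \<rho>0)"
  have \<kappa>: "\<kappa> > 0" "exp \<kappa> * \<rho>0 = \<rho>" using \<rho> \<rho>0pos by (auto simp: \<kappa>_def)
  \<comment> \<open>Off the exceptional event \<open>E0\<close> for the count, at most t R renewals
    occur.\<close>
  define R where "R = (\<bar>L\<bar> + 1) / \<kappa>"
  have R: "R > 0" using \<kappa> by (simp add: R_def)
  \<comment> \<open>The factor \<open>Suc j\<close> turns the bound on the weighted sum of norms
    into t / \<open>Suc j\<close>; the other factor is the threshold of the j-th exceptional event
    and makes these events summable over \<open>j\<close>.\<close>
  define h where "h j = real (Suc j) * (\<bar>L\<bar> + 1 + real j)" for j
  have h: "h j > 0" for j by (simp add: h_def)
  have hfin: "(\<integral>\<^sup>+\<omega>. ennreal (exp (h j * norm (X 1 \<omega>))) \<partial>M) < \<infinity>" for j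
  proof (rule le_less_trans[OF _ mom[OF h[of j]]], intro nn_integral_mono ennreal_leI)
    fix \<omega> assume "\<omega> \<in> space M"
    then show "exp (h j * norm (X 1 \<omega>)) \<le> exp (h j * S 1 \<omega> + h j * norm (X 1 \<omega>))"
      using S_pos[of 1 \<omega>] h[of j] by simp
  qed
  have "\<exists>K. compact K \<and> convex K \<and> 0 \<in> K \<and>
    (\<integral>\<^sup>+\<omega>. ennreal (exp (h j * norm (X 1 \<omega>))) * indicator (- K) (X 1 \<omega>) \<partial>M) \<le> ennreal (\<rho> - \<rho>0)" for j
  proof (rule compact_convex_small_remainder[of "\<lambda>x. ennreal (exp (h j * norm x))" "\<rho> - \<rho>0"])
    show "(\<lambda>x::'a. ennreal (exp (h j * norm x))) \<in> borel_measurable borel" by measurable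
  qed (use hfin \<rho> in auto)
  then obtain K where K: "\<And>j. compact (K j)" "\<And>j. convex (K j)" "\<And>j. 0 \<in> K j"
    "\<And>j. (\<integral>\<^sup>+\<omega>. ennreal (exp (h j * norm (X 1 \<omega>))) * indicator (- K j) (X 1 \<omega>) \<partial>M) \<le> ennreal (\<rho> - \<rho>0)"
    by metis
  have Kb [measurable]: "K j \<in> sets borel" for j using K(1) by (simp add: compact_imp_closed)
  define g where "g j x = h j * norm x * indicator (- K j) x" for j and x :: 'a
  have gm: "g j \<in> borel_measurable borel" for j unfolding g_def by measurable
  note [measurable] = gm
  have gint: "(\<integral>\<^sup>+\<omega>. ennreal (exp (- 1 * S 1 \<omega> + g j (X 1 \<omega>))) \<partial>M) \<le> ennreal \<rho>" for j
  proof -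
    have "(\<integral>\<^sup>+\<omega>. ennreal (exp (- 1 * S 1 \<omega> + g j (X 1 \<omega>))) \<partial>M) \<le>
      (\<integral>\<^sup>+\<omega>. ennreal (exp (- 1 * S 1 \<omega>)) + ennreal (exp (h j * norm (X 1 \<omega>))) * indicator (- K j) (X 1 \<omega>) \<partial>M)"
    proof (rule nn_integral_mono)
      fix \<omega> assume "\<omega> \<in> space M"
      then have "S 1 \<omega> > 0" using S_pos[of 1 \<omega>] by simp
      then have "exp (- 1 * S 1 \<omega> + h j * norm (X 1 \<omega>)) \<le> exp (h j * norm (X 1 \<omega>))" by simp
      then have "ennreal (exp (- 1 * S 1 \<omega> + h j * norm (X 1 \<omega>))) \<le>
          ennreal (exp (- 1 * S 1 \<omega>)) + ennreal (exp (h j * norm (X 1 \<omega>)))"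
        by (intro add_increasing ennreal_leI) auto
      then show "ennreal (exp (- 1 * S 1 \<omega> + g j (X 1 \<omega>))) \<le>
          ennreal (exp (- 1 * S 1 \<omega>)) + ennreal (exp (h j * norm (X 1 \<omega>))) * indicator (- K j) (X 1 \<omega>)"
        by (cases "X 1 \<omega> \<in> K j") (simp_all add: g_def)
    qed
    also have "\<dots> = ennreal \<rho>0 + (\<integral>\<^sup>+\<omega>. ennreal (exp (h j * norm (X 1 \<omega>))) * indicator (- K j) (X 1 \<omega>) \<partial>M)"
      unfolding int0[symmetric] by (rule nn_integral_add) measurable
    also have "\<dots> \<le> ennreal \<rho>0 + ennreal (\<rho> - \<rho>0)" by (intro add_left_mono K)
    also have "\<dots> = ennreal \<rho>" using \<rho> \<rho>0 by (simp add: ennreal_plus[symmetric] del: ennreal_plus)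
    finally show ?thesis .
  qed
  have cint: "(\<integral>\<^sup>+\<omega>. ennreal (exp (- 1 * S 1 \<omega> + \<kappa>)) \<partial>M) \<le> ennreal \<rho>"
  proof -
    have "(\<integral>\<^sup>+\<omega>. ennreal (exp (- 1 * S 1 \<omega> + \<kappa>)) \<partial>M) = (\<integral>\<^sup>+\<omega>. ennreal (exp \<kappa>) * ennreal (exp (- 1 * S 1 \<omega>)) \<partial>M)"
      by (intro nn_integral_cong) (simp add: ennreal_mult[symmetric] exp_add[symmetric])
    also have "\<dots> = ennreal (exp \<kappa>) * ennreal \<rho>0"
      unfolding int0[symmetric] by (rule nn_integral_cmult) measurable
    also have "\<dots> = ennreal \<rho>" using \<kappa> \<rho>0 by (simp add: ennreal_mult[symmetric])
    finally show ?thesis by simp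
  qed
  define Q where "Q = (\<Inter>j. \<Union>x\<in>(\<lambda>x. R *\<^sub>R x) ` K j. cball x (1 / real (Suc j)))"
  have Q: "compact Q" unfolding Q_def
  proof (rule compact_Inter_thickened)
    show "(\<lambda>j. 1 / real (Suc j)) \<longlonglongrightarrow> 0" using LIMSEQ_inverse_real_of_nat by (simp add: inverse_eq_divide)
  qed (auto intro: compact_scaling K)
  define C where "C = 1 / (1 - \<rho>)"
  have C: "C > 0" using \<rho> by (simp add: C_def)
  have "exp_bounded (- Q) L" unfolding exp_bounded_def
  proof (intro exI allI impI)
    fix t :: real assume t: "t \<ge> 1"
    have t0: "t > 0" using t by simp
    define E0 where "E0 = {\<omega>\<in>space M. t * (\<bar>L\<bar> + 1) \<le> cumulative_reward S (\<lambda>i \<omega>. \<kappa>) t \<omega>}"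
    define E where "E j = {\<omega>\<in>space M. t * (\<bar>L\<bar> + 1 + real j) \<le> cumulative_reward S (\<lambda>i \<omega>. g j (X i \<omega>)) t \<omega>}" for j
    \<comment> \<open>The rates are one less than the thresholds because the moments are taken at
      \<zeta> = -1; the summand 1 in the thresholds compensates.\<close>
    have E0: "emeasure M E0 \<le> ennreal (C * exp (- t * (\<bar>L\<bar> + 1 + - 1)))" "E0 \<in> sets M"
      unfolding E0_def C_def
      by (intro additive_functional_tail[of "\<lambda>_. \<kappa>", OF _ _ cint \<rho>(3,2) t0], simp, simp)+
    have E: "emeasure M (E j) \<le> ennreal (C * exp (- t * (\<bar>L\<bar> + 1 + real j + - 1)))" "E j \<in> sets M" for j
      unfolding E_def C_def
      by (intro additive_functional_tail[OF gm _ gint \<rho>(3,2) t0], simp)+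
    have sub: "{\<omega>\<in>space M. W t \<omega> /\<^sub>R t \<in> - Q} \<subseteq> E0 \<union> (\<Union>j. E j)"
    proof (rule subsetI, rule ccontr)
      fix \<omega> assume \<omega>: "\<omega> \<in> {\<omega>\<in>space M. W t \<omega> /\<^sub>R t \<in> - Q}" "\<omega> \<notin> E0 \<union> (\<Union>j. E j)"
      then have sp: "\<omega> \<in> space M" by simp
      obtain n where n: "renewal_time S n \<omega> \<le> t" "t < renewal_time S (Suc n) \<omega>"
        using renewal_interval_exists[OF sp, of t] t by auto
      have cum: "cumulative_reward S Y t \<omega> = (\<Sum>i=1..n. Y i \<omega>)" for Y :: "nat \<Rightarrow> 'w \<Rightarrow> 'b::real_normed_vector"
        unfolding cumulative_reward_def renewal_indices[OF sp n] ..
      have "cumulative_reward S (\<lambda>i \<omega>. \<kappa>) t \<omega> < t * (\<bar>L\<bar> + 1)" using \<omega>(2) sp by (simp add: E0_def not_le)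
      then have "real n * \<kappa> < t * (\<bar>L\<bar> + 1)" by (simp add: cumulative_reward_def renewal_indices[OF sp n, simplified])
      then have nR: "real n \<le> t * R" using \<kappa> by (simp add: R_def field_simps)
      have "W t \<omega> /\<^sub>R t \<in> (\<Union>x\<in>(\<lambda>x. R *\<^sub>R x) ` K j. cball x (1 / real (Suc j)))" for j
      proof -
        define I where "I = {i \<in> {1..n}. X i \<omega> \<in> K j}"
        define N where "N = {i \<in> {1..n}. X i \<omega> \<notin> K j}"
        have IN: "{1..n} = I \<union> N" "I \<inter> N = {}" "finite I" "finite N" by (auto simp: I_def N_def)
        have "card I \<le> card {1..n}" by (intro card_mono) (auto simp: I_def)
        then have "real (card I) \<le> t * R" using nR by simp
        then have "(\<Sum>i\<in>I. X i \<omega>) /\<^sub>R (t * R) \<in> K j"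
          using R t by (intro sum_divide_mem_convex K IN) (auto simp: I_def)
        then have x: "(\<Sum>i\<in>I. X i \<omega>) /\<^sub>R t \<in> (\<lambda>x. R *\<^sub>R x) ` K j"
          using R by (intro image_eqI[where x = "(\<Sum>i\<in>I. X i \<omega>) /\<^sub>R (t * R)"]) auto
        have "cumulative_reward S (\<lambda>i \<omega>. g j (X i \<omega>)) t \<omega> < t * (\<bar>L\<bar> + 1 + real j)"
          using \<omega>(2) sp by (auto simp: E_def not_le)
        moreover have "cumulative_reward S (\<lambda>i \<omega>. g j (X i \<omega>)) t \<omega> = (\<Sum>i\<in>I. g j (X i \<omega>)) + (\<Sum>i\<in>N. g j (X i \<omega>))"
          unfolding cumulative_reward_def renewal_indices[OF sp n] unfolding IN(1) by (rule sum.union_disjoint) (use IN in auto)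
        moreover have "(\<Sum>i\<in>I. g j (X i \<omega>)) = 0" by (intro sum.neutral) (auto simp: g_def I_def)
        moreover have "(\<Sum>i\<in>N. g j (X i \<omega>)) = h j * (\<Sum>i\<in>N. norm (X i \<omega>))"
          by (simp add: g_def N_def sum_distrib_left)
        ultimately have "h j * (\<Sum>i\<in>N. norm (X i \<omega>)) < t * (\<bar>L\<bar> + 1 + real j)" by simp
        then have "(\<bar>L\<bar> + 1 + real j) * (real (Suc j) * (\<Sum>i\<in>N. norm (X i \<omega>))) < (\<bar>L\<bar> + 1 + real j) * t"
          by (simp add: h_def algebra_simps)
        then have "real (Suc j) * (\<Sum>i\<in>N. norm (X i \<omega>)) < t"
          by (rule mult_less_cancel_left_pos[THEN iffD1, rotated]) simp
        then have "(\<Sum>i\<in>N. norm (X i \<omega>)) / t \<le> 1 / real (Suc j)"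
          using t by (simp add: field_simps)
        moreover have "norm ((\<Sum>i\<in>N. X i \<omega>) /\<^sub>R t) \<le> (\<Sum>i\<in>N. norm (X i \<omega>)) / t"
          using norm_sum[of "\<lambda>i. X i \<omega>" N] t by (simp add: divide_inverse mult.commute mult_left_mono)
        ultimately have y: "norm ((\<Sum>i\<in>N. X i \<omega>) /\<^sub>R t) \<le> 1 / real (Suc j)" by linarith
        have "W t \<omega> = (\<Sum>i\<in>I. X i \<omega>) + (\<Sum>i\<in>N. X i \<omega>)"
          unfolding cumulative_reward_def renewal_indices[OF sp n] unfolding IN(1) by (rule sum.union_disjoint) (use IN in auto)
        then have "dist ((\<Sum>i\<in>I. X i \<omega>) /\<^sub>R t) (W t \<omega> /\<^sub>R t) = norm ((\<Sum>i\<in>N. X i \<omega>) /\<^sub>R t)"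
          by (simp add: dist_norm scaleR_add_right)
        then have "W t \<omega> /\<^sub>R t \<in> cball ((\<Sum>i\<in>I. X i \<omega>) /\<^sub>R t) (1 / real (Suc j))" using y by simp
        then show ?thesis using x by blast
      qed
      then have "W t \<omega> /\<^sub>R t \<in> Q" unfolding Q_def by blast
      then show False using \<omega>(1) by simp
    qed
    have UE: "(\<Union>j. E j) \<in> sets M" using E(2) by auto
    have "W_prob t (- Q) \<le> emeasure M (E0 \<union> (\<Union>j. E j))"
      using sub E0(2) UE by (intro emeasure_mono) auto
    also have "\<dots> \<le> emeasure M E0 + emeasure M (\<Union>j. E j)"
      using E0(2) UE by (intro emeasure_subadditive)
    also have "\<dots> \<le> ennreal (C * exp (- t * L)) + ennreal (C * exp (- t * L) / (1 - exp (- 1)))"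
    proof (rule add_mono)
      have le: "t * L \<le> t * \<bar>L\<bar>" using t by (intro mult_left_mono) auto
      then have "C * exp (- t * (\<bar>L\<bar> + 1 + - 1)) \<le> C * exp (- t * L)" using C by simp
      then show "emeasure M E0 \<le> ennreal (C * exp (- t * L))" using E0(1) by (meson ennreal_leI order_trans)
      have "emeasure M (\<Union>j. E j) \<le> (\<Sum>j. emeasure M (E j))"
        using E(2) by (intro emeasure_subadditive_countably) auto
      also have "\<dots> \<le> ennreal (C * exp (- t * L) / (1 - exp (- 1)))"
      proof (rule suminf_ennreal_geometric_le)
        fix j
        \<comment> \<open>As t \<ge> 1, the bounds for \<open>E j\<close> carry the factor exp (-
          j), whatever \<open>t\<close> is, and the series over \<open>j\<close> is
          geometric.\<close>
        have "real j \<le> t * real j" using t mult_right_mono[of 1 t "real j"] by simp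
        then have "- t * (\<bar>L\<bar> + 1 + real j + - 1) \<le> - t * L + real j * (- 1)"
          using le by (simp add: algebra_simps)
        then have "C * exp (- t * (\<bar>L\<bar> + 1 + real j + - 1)) \<le> C * exp (- t * L + real j * (- 1))"
          using C by simp
        also have "\<dots> = C * exp (- t * L) * exp (- 1) ^ j" by (simp only: exp_add exp_of_nat_mult mult.assoc)
        finally show "emeasure M (E j) \<le> ennreal (C * exp (- t * L) * exp (- 1) ^ j)"
          using E(1)[of j] by (meson ennreal_leI order_trans)
      qed (use C in auto)
      finally show "emeasure M (\<Union>j. E j) \<le> ennreal (C * exp (- t * L) / (1 - exp (- 1)))" .
    qed
    also have "\<dots> = ennreal (C * exp (- t * L) + C * exp (- t * L) / (1 - exp (- 1)))"
      using C by (simp add: ennreal_plus)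
    also have "C * exp (- t * L) + C * exp (- t * L) / (1 - exp (- 1)) = C * (1 + 1 / (1 - exp (- 1))) * exp (- t * L)"
      by (simp add: algebra_simps)
    finally show "W_prob t (- Q) \<le>
      ennreal (C * (1 + 1 / (1 - exp (- 1))) * exp (- t * L))" .
  qed
  with Q show "\<exists>K. compact K \<and> exp_bounded (- K) L" by blast
qed

lemma compact_level_sets_of_exp_tight:
  assumes exp_tight
  shows "compact_level_sets (rate_I_i M S X)"
  unfolding compact_level_sets_def
proof
  fix c :: real
  \<comment> \<open>The extra 1 makes the rate function exceed \<open>c\<close> strictly outside
    \<open>K\<close>.\<close>
  obtain K where K: "compact K" "exp_bounded (- K) (c + 1)" using assms unfolding exp_tight_def by blast
  have "w \<in> K" if "rate_I_i M S X w \<le> ereal c" for w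
  proof (rule ccontr)
    assume "w \<notin> K"
    from rate_I_i_large_of_exp_bounded[OF compact_imp_closed[OF K(1)] K(2) this]
    have "ereal (c + 1) \<le> ereal c" using that by (rule order_trans)
    then show False by simp
  qed
  then have "{w. rate_I_i M S X w \<le> ereal c} = {w. rate_I_i M S X w \<le> ereal c} \<inter> K" by blast
  moreover have "closed {w. rate_I_i M S X w \<le> ereal c}"
    unfolding rate_I_i_def using ell_s_nonneg ell_s_le_ell_i
    by (intro closed_level_set lower_semicontinuous_rate_I) (rule order_trans)
  ultimately show "compact {w. rate_I_i M S X w \<le> ereal c}" using closed_Int_compact[OF _ K(1)] by metis
qed

end

theorem theorem1p1:
  fixes M :: "'w measure"
    and S :: "nat \<Rightarrow> 'w \<Rightarrow> real"
    and X :: "nat \<Rightarrow> 'w \<Rightarrow> 'a::{banach, second_countable_topology}"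
  assumes "renewal_reward M S X"
  shows "(lower_semicontinuous (rate_I_i M S X) \<and> ext_convex (rate_I_i M S X) \<and> lower_semicontinuous (rate_I_s M S X) \<and> ext_convex (rate_I_s M S X))
    \<and> (\<forall>G. open G \<longrightarrow> - (INF w\<in>G. rate_I_i M S X w) \<le> Liminf at_top (scaled_log_prob M S X G))
    \<and> (\<forall>F. compact F \<longrightarrow> Limsup at_top (scaled_log_prob M S X F) \<le> - (INF w\<in>F. rate_I_s M S X w))
    \<and> (\<forall>F \<in> sets borel.
          (open F \<and> convex F) \<or> (closed F \<and> convex F) \<or> (convex F \<and> finite_dim_type TYPE('a)) \<longrightarrow>
          ell_s M (S 1) < \<infinity> \<or> rate_I_s M S X 0 < \<infinity> \<longrightarrow>
          Limsup at_top (scaled_log_prob M S X F) \<le> - (INF w\<in>F. rate_I_s M S X w))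
    \<and> (finite_dim_type TYPE('a) \<and>
        (\<exists>\<zeta> \<sigma>. \<zeta> \<le> 0 \<and> 0 < \<sigma> \<and>
           (\<integral>\<^sup>+\<omega>. ennreal (exp (\<zeta> * S 1 \<omega> + \<sigma> * norm (X 1 \<omega>))) \<partial>M) < \<infinity>) \<longrightarrow>
        compact_level_sets (rate_I_i M S X) \<and> compact_level_sets (rate_I_s M S X) \<and>
        (\<forall>F. closed F \<longrightarrow> Limsup at_top (scaled_log_prob M S X F) \<le> - (INF w\<in>F. rate_I_s M S X w)))
    \<and> (\<not> finite_dim_type TYPE('a) \<and>
        (\<forall>\<sigma>>0. (\<integral>\<^sup>+\<omega>. ennreal (exp (\<sigma> * S 1 \<omega> + \<sigma> * norm (X 1 \<omega>))) \<partial>M) < \<infinity>) \<longrightarrow>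
        rate_I_i M S X = rate_Upsilon M (S 1) (X 1) 1 \<and> rate_I_s M S X = rate_Upsilon M (S 1) (X 1) 1 \<and> compact_level_sets (rate_Upsilon M (S 1) (X 1) 1) \<and>
        (\<forall>F. closed F \<longrightarrow> Limsup at_top (scaled_log_prob M S X F) \<le> - (INF w\<in>F. rate_I_s M S X w)))"
proof -
  interpret renewal M S X by standard (rule assms)
  have li: "0 \<le> ell_i M (S 1)" using ell_s_nonneg ell_s_le_ell_i by (rule order_trans)
  note ls = ell_s_nonneg
  show ?thesis
  proof (intro conjI allI ballI impI; (elim conjE exE)?)
    show "lower_semicontinuous (rate_I_i M S X)" "ext_convex (rate_I_i M S X)"
      unfolding rate_I_i_def by (rule lower_semicontinuous_rate_I[OF li] ext_convex_rate_I[OF li])+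
    show "lower_semicontinuous (rate_I_s M S X)" "ext_convex (rate_I_s M S X)"
      unfolding rate_I_s_def by (rule lower_semicontinuous_rate_I[OF ls] ext_convex_rate_I[OF ls])+
    show "- (INF w\<in>G. rate_I_i M S X w) \<le> Liminf at_top (scaled_log_prob M S X G)" if "open G" for G
      using that by (rule Liminf_scaled_log_prob_ge)
    show "Limsup at_top (scaled_log_prob M S X F) \<le> - (INF w\<in>F. rate_I_s M S X w)" if "compact F" for F
      using exp_bounded_compact[OF that] by (rule limsup_le_of_exp_bounded)
    show "Limsup at_top (scaled_log_prob M S X F) \<le> - (INF w\<in>F. rate_I_s M S X w)"
      if "F \<in> sets borel" "(open F \<and> convex F) \<or> (closed F \<and> convex F) \<or> (convex F \<and> finite_dim_type TYPE('a))"
        "ell_s M (S 1) < \<infinity> \<or> rate_I_s M S X 0 < \<infinity>" for F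
      using that by (rule limsup_convex)
  next
    fix \<zeta> \<sigma> :: real
    assume fd: "finite_dim_type TYPE('a)" and \<sigma>: "0 < \<sigma>"
      and mom: "(\<integral>\<^sup>+\<omega>. ennreal (exp (\<zeta> * S 1 \<omega> + \<sigma> * norm (X 1 \<omega>))) \<partial>M) < \<infinity>"
    \<comment> \<open>The geometric bounds need a moment below 1, which decreasing \<zeta>
      provides.\<close>
    obtain \<zeta>' where \<zeta>': "\<zeta>' \<le> 0" "(\<integral>\<^sup>+\<omega>. ennreal (exp (\<zeta>' * S 1 \<omega> + \<sigma> * norm (X 1 \<omega>))) \<partial>M) \<le> ennreal (1/2)"
      using exp_moment_small[OF mom] by blast
    show "compact_level_sets (rate_I_i M S X)"
      unfolding rate_I_i_def by (rule compact_level_sets_finite_dim[OF fd \<sigma> \<zeta>'(1) li \<zeta>'(2)])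
    show "compact_level_sets (rate_I_s M S X)"
      unfolding rate_I_s_def by (rule compact_level_sets_finite_dim[OF fd \<sigma> \<zeta>'(1) ls \<zeta>'(2)])
    show "Limsup at_top (scaled_log_prob M S X F) \<le> - (INF w\<in>F. rate_I_s M S X w)" if "closed F" for F
      by (rule limsup_closed_of_exp_tight[OF exp_tight_finite_dim[OF fd \<sigma> \<zeta>'] that])
  next
    assume mom: "\<forall>\<sigma>>0. (\<integral>\<^sup>+\<omega>. ennreal (exp (\<sigma> * S 1 \<omega> + \<sigma> * norm (X 1 \<omega>))) \<partial>M) < \<infinity>"
    \<comment> \<open>With \<open>ell_s\<close> infinite, so is the larger \<open>ell_i\<close>:
      idle time is excluded and both rate functions reduce to \<open>rate_Upsilon\<close> at \<beta>
      = 1.\<close>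
    have l: "ell_s M (S 1) = \<infinity>" using mom by (intro ell_s_infinite) auto
    then have "ell_i M (S 1) = \<infinity>" using ell_s_le_ell_i by simp
    then show eq: "rate_I_i M S X = rate_Upsilon M (S 1) (X 1) 1"
      by (simp add: rate_I_i_def rate_I_def fun_eq_iff)
    show "rate_I_s M S X = rate_Upsilon M (S 1) (X 1) 1"
      using l by (simp add: rate_I_s_def rate_I_def fun_eq_iff)
    have tight: exp_tight using mom by (intro exp_tight_of_all_moments) auto
    show "compact_level_sets (rate_Upsilon M (S 1) (X 1) 1)"
      using compact_level_sets_of_exp_tight[OF tight] unfolding eq .
    show "Limsup at_top (scaled_log_prob M S X F) \<le> - (INF w\<in>F. rate_I_s M S X w)" if "closed F" for F
      by (rule limsup_closed_of_exp_tight[OF tight that])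
  qed
qed

end
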